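(* Let $\delta>0$, $G_1(x)=x-\delta$, $G_2(x)=x+\delta$, and assume the integrability and limit conditions of the Dynkin game hold. Assume that for some $0\le\pi_I<1$, $0\le\pi_S<1$ and $r_I,r_S>0$ (with $-r_I<0<r_S$ the two roots of $\Psi(z)=r$), the infimum $I$ and supremum $S$ satisfy $$\mathbb E e^{zI}=\pi_I+(1-\pi_I)\frac{r_I}{r_I+z},\qquad \mathbb E e^{zS}=\pi_S+(1-\pi_S)\frac{r_S}{r_S-z},$$ i.e. $-I$ and $S$ have laws $\pi_I\delta_0+(1-\pi_I)\mathrm{Exp}(r_I)$ and $\pi_S\delta_0+(1-\pi_S)\mathrm{Exp}(r_S)$. Define $$E_I=\tfrac{1-\pi_I}{r_I},\ E_S=\tfrac{1-\pi_S}{r_S},\ F_I=\tfrac{r_I+r_S}{r_I+\pi_Ir_S},\ F_S=\tfrac{r_I+r_S}{\pi_Sr_I+r_S},\ G_I=F_I-1,\ G_S=F_S-1.$$ Then the equation in $u$ $$u-2\delta-E_I-E_S=\frac{-E_IF_Se^{r_Su}-E_SF_Ie^{r_Iu}+2E_SF_SG_I}{e^{(r_I+r_S)u}-G_IG_S}$$ has a unique positive solution $u$. With this $u$, set $$A_I=\frac{-E_Ie^{r_Su}+E_SG_I}{e^{(r_I+r_S)u}-G_IG_S},\qquad A_S=\frac{E_Se^{r_Iu}-E_IG_S}{e^{(r_I+r_S)u}-G_IG_S},$$ $$x_I=-\delta-E_I+F_IA_S,\qquad x_S=\delta+E_S+F_SA_I\quad(\text{so }x_S-x_I=u).$$ Then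 the Dynkin game with payoffs $G_1,G_2$ has optimal stopping times $\sigma^*=\inf\{t\ge0:X_t\le x_I\}$, $\tau^*=\inf\{t\ge0:X_t\ge x_S\}$ and value function $$V(x)=\begin{cases}x+\delta,& x\le x_I,\\ A_Ie^{-r_I(x-x_S)}+A_Se^{r_S(x-x_I)},& x_I\le x\le x_S,\\ x-\delta,& x\ge x_S,\end{cases}$$ that is, $V(x)=\inf_\sigma\sup_\tau M_x(\sigma,\tau)=\sup_\tau\inf_\sigma M_x(\sigma,\tau)=M_x(\sigma^*,\tau^* )$.
   Context: Let $X=(X_t)_{t\ge0}$ be a Lévy process with characteristic exponent $\Psi$ (so $\mathbb E e^{zX_t}=e^{t\Psi(z)}$), on a filtered probability space satisfying the usual conditions, with $X_0=x$ under $\mathbb P_x$. Stopping times take values in $[0,\infty]$. Fix $r>0$; for continuous $G_1\le G_2$ with $\mathbb E_x\sup_{t\ge0}|e^{-rt}G_i(X_t)|<\infty$ and $e^{-rt}G_i(X_t)\to0$ a.s. (the integrability and limit conditions), with convention $e^{-r\tau}G_i(X_\tau)=0$ on $\{\tau=\infty\}$, define $M_x(\sigma,\tau)=\mathbb E_x\big(e^{-r\tau}G_1(X_\tau)\mathbf 1_{\{\tau\le\sigma\}}+e^{-r\sigma}G_2(X_\sigma)\mathbf 1_{\{\sigma<\tau\}}\big)$. Let $e_r$ be exponential with parameter $r$, independent of $X$, $I=\inf_{0\le t\le e_r}X_t$, $S=\sup_{0\le t\le e_r}X_t$ under $\mathbb P=\mathbb P_0$. *)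

theory Defs
  imports "HOL-Probability.Probability"
begin

definition filtered_usual :: "'a measure \<Rightarrow> (real \<Rightarrow> 'a measure) \<Rightarrow> bool" where
  "filtered_usual M F \<longleftrightarrow> prob_space M
     \<and> (\<forall>t\<ge>0. space (F t) = space M \<and> sets (F t) \<subseteq> sets M)
     \<and> (\<forall>s t. 0 \<le> s \<longrightarrow> s \<le> t \<longrightarrow> sets (F s) \<subseteq> sets (F t))
     \<and> (\<forall>t\<ge>0. sets (F t) = (\<Inter>u\<in>{t<..}. sets (F u)))
     \<and> (\<forall>A. A \<subseteq> space M \<longrightarrow> (\<exists>N\<in>sets M. A \<subseteq> N \<and> emeasure M N = 0) \<longrightarrow> A \<in> sets (F 0))"

definition levy_process :: "'a measure \<Rightarrow> (real \<Rightarrow> 'a measure) \<Rightarrow> (real \<Rightarrow> 'a \<Rightarrow> real) \<Rightarrow> bool" where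
  "levy_process M F X \<longleftrightarrow> filtered_usual M F
     \<and> (\<forall>\<omega>\<in>space M. X 0 \<omega> = 0)
     \<and> (\<forall>t\<ge>0. X t \<in> borel_measurable (F t))
     \<and> (\<forall>\<omega>\<in>space M. \<forall>t\<ge>0. continuous (at_right t) (\<lambda>s. X s \<omega>)
            \<and> (t > 0 \<longrightarrow> (\<exists>l. ((\<lambda>s. X s \<omega>) \<longlongrightarrow> l) (at_left t))))
     \<and> (\<forall>s\<ge>0. \<forall>t\<ge>0.
          prob_space.indep_set M (sets (F t))
            {(\<lambda>\<omega>. X (t + s) \<omega> - X t \<omega>) -` B \<inter> space M | B. B \<in> sets borel}
        \<and> distr M borel (\<lambda>\<omega>. X (t + s) \<omega> - X t \<omega>) = distr M borel (X s))"

definition stopping_time_ext :: "(real \<Rightarrow> 'a measure) \<Rightarrow> ('a \<Rightarrow> ereal) \<Rightarrow> bool" where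
  "stopping_time_ext F \<tau> \<longleftrightarrow> (\<forall>\<omega>\<in>space (F 0). 0 \<le> \<tau> \<omega>)
     \<and> (\<forall>t\<ge>0. {\<omega>\<in>space (F t). \<tau> \<omega> \<le> ereal t} \<in> sets (F t))"

text \<open>e^{-r tau} G(X_tau) under P_x (X_0 = x realised as x + X), = 0 on {tau = oo}.\<close>
definition disc_payoff :: "real \<Rightarrow> (real \<Rightarrow> real) \<Rightarrow> (real \<Rightarrow> 'a \<Rightarrow> real) \<Rightarrow> real \<Rightarrow> ('a \<Rightarrow> ereal) \<Rightarrow> 'a \<Rightarrow> real" where
  "disc_payoff r G X x \<tau> \<omega> =
     (if \<tau> \<omega> = \<infinity> then 0
      else exp (- r * real_of_ereal (\<tau> \<omega>)) * G (x + X (real_of_ereal (\<tau> \<omega>)) \<omega>))"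

definition dynkin_M :: "'a measure \<Rightarrow> (real \<Rightarrow> 'a \<Rightarrow> real) \<Rightarrow> real \<Rightarrow> (real \<Rightarrow> real) \<Rightarrow> (real \<Rightarrow> real)
     \<Rightarrow> real \<Rightarrow> ('a \<Rightarrow> ereal) \<Rightarrow> ('a \<Rightarrow> ereal) \<Rightarrow> real" where
  "dynkin_M M X r G1 G2 x \<sigma> \<tau> =
     (\<integral>\<omega>. (if \<tau> \<omega> \<le> \<sigma> \<omega> then disc_payoff r G1 X x \<tau> \<omega> else disc_payoff r G2 X x \<sigma> \<omega>) \<partial>M)"

definition dynkin_conditions :: "'a measure \<Rightarrow> (real \<Rightarrow> 'a \<Rightarrow> real) \<Rightarrow> real \<Rightarrow> (real \<Rightarrow> real) \<Rightarrow> bool" where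
  "dynkin_conditions M X r G \<longleftrightarrow> (\<forall>x.
      (\<integral>\<^sup>+\<omega>. (SUP t\<in>{0..}. ennreal \<bar>exp (- r * t) * G (x + X t \<omega>)\<bar>) \<partial>M) < \<infinity>
    \<and> (AE \<omega> in M. ((\<lambda>t. exp (- r * t) * G (x + X t \<omega>)) \<longlongrightarrow> 0) at_top))"

definition hit_below :: "(real \<Rightarrow> 'a \<Rightarrow> real) \<Rightarrow> real \<Rightarrow> real \<Rightarrow> 'a \<Rightarrow> ereal" where
  "hit_below X x a \<omega> = (if \<exists>t\<ge>0. x + X t \<omega> \<le> a then ereal (Inf {t. 0 \<le> t \<and> x + X t \<omega> \<le> a}) else \<infinity>)"

definition hit_above :: "(real \<Rightarrow> 'a \<Rightarrow> real) \<Rightarrow> real \<Rightarrow> real \<Rightarrow> 'a \<Rightarrow> ereal" where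
  "hit_above X x a \<omega> = (if \<exists>t\<ge>0. x + X t \<omega> \<ge> a then ereal (Inf {t. 0 \<le> t \<and> x + X t \<omega> \<ge> a}) else \<infinity>)"

end

theory Submission
  imports Defs
begin

text \<open>
  Write \<open>Q(y) = y - E\<^sub>S - \<delta> - F\<^sub>S A\<^sub>I exp (-r\<^sub>I (y - x\<^sub>S))\<close> for \<open>y \<ge> x\<^sub>S\<close> and \<open>Q(y) = 0\<close> below. The definition
  of \<open>x\<^sub>S\<close> says that \<open>Q\<close> is continuous, and \<open>r\<^sub>I F\<^sub>S |A\<^sub>I| \<le> 1\<close> makes it nondecreasing. With the
  mirror image \<open>Q'\<close> of \<open>Q\<close> at \<open>x\<^sub>I\<close>, the value function is \<open>V(x) = E Q(x + S) - E Q'(x + I)\<close>. Since the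
  supremum over \<open>[t, e\<^sub>r]\<close> is at most the one over \<open>[0, e\<^sub>r]\<close>, the discounted first term is a
  supermartingale, and it is a martingale up to the first passage above \<open>x\<^sub>S\<close>, before which the
  discarded part of the path does not contribute. Likewise for the second term and \<open>x\<^sub>I\<close>. So \<open>V\<close> is a
  supermartingale up to \<open>\<sigma>\<^sup>*\<close> and a submartingale up to \<open>\<tau>\<^sup>*\<close>, and \<open>G\<^sub>1 \<le> V \<le> G\<^sub>2\<close> gives the saddle
  point. The second half is the first half applied to \<open>-X\<close>.

  Optional sampling is proved on time grids of mesh \<open>h\<close>, where it reduces to the independence of a single
  increment from the past, and carried over by right-continuity of the paths as \<open>h\<close> tends to \<open>0\<close>.
\<close>

text \<open>\<open>E\<^sub>S\<close> is the mean of \<open>S\<close> and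
  \<open>1 / F\<^sub>S\<close> the mean of \<open>exp (-r\<^sub>I S)\<close>. So above
  \<open>x\<^sub>S\<close> averaging \<open>Q\<close> over \<open>S\<close> undoes these constants
  and returns \<open>y - \<delta> - A\<^sub>I exp (-r\<^sub>I (y - x\<^sub>S))\<close>, while below
  \<open>x\<^sub>S\<close> only the exponential tail of \<open>S\<close> contributes and the average
  is a multiple of \<open>exp (r\<^sub>S y)\<close>. The mirror term does the same with the ends
  exchanged, so in the difference each exponential left over beyond one end is cancelled. That the
  multiples fit is a linear system for \<open>A\<^sub>I\<close> and \<open>A\<^sub>S\<close>, and
  \<open>x\<^sub>S - x\<^sub>I = u\<close> becomes the equation for \<open>u\<close>.

  A separate obstacle is that the first passage times must be stopping times: reaching a closed
  half-line by time \<open>t\<close> need not be readable from countably many times. It is replaced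
  by an event that is, and the difference is null because the law of \<open>S\<close> has no atom
  above \<open>0\<close>.\<close>

section \<open>Saddle points and minimax values\<close>

lemma saddle_point_minimax:
  fixes K :: "'a \<Rightarrow> 'b \<Rightarrow> real"
  assumes s: "s \<in> A" and t: "t \<in> B"
    and upper: "\<And>y. y \<in> B \<Longrightarrow> K s y \<le> v"
    and lower: "\<And>x. x \<in> A \<Longrightarrow> v \<le> K x t"
    and bound: "\<And>x y. x \<in> A \<Longrightarrow> y \<in> B \<Longrightarrow> \<bar>K x y\<bar> \<le> c"
  shows "v = (INF x\<in>A. SUP y\<in>B. K x y)" "v = (SUP y\<in>B. INF x\<in>A. K x y)" "v = K s t"
proof -
  \<comment> \<open>Infima and suprema of reals are only informative for bounded families; the
    uniform bound \<open>c\<close> supplies this for every row and column.\<close>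
  have bdd: "bdd_above (K x ` B)" if "x \<in> A" for x
    using bound[OF that] by (intro bdd_aboveI[of _ c]) fastforce
  have bdd': "bdd_below ((\<lambda>x. K x y) ` A)" if "y \<in> B" for y
    using bound[OF _ that] by (intro bdd_belowI[of _ "-c"]) fastforce
  have SUPge: "v \<le> (SUP y\<in>B. K x y)" if "x \<in> A" for x
    using cSUP_upper[OF t bdd[OF that]] lower[OF that] by linarith
  have INFle: "(INF x\<in>A. K x y) \<le> v" if "y \<in> B" for y
    using cINF_lower[OF bdd'[OF that] s] upper[OF that] by linarith
  have "(INF x\<in>A. SUP y\<in>B. K x y) \<le> (SUP y\<in>B. K s y)"
    by (rule cINF_lower[OF _ s]) (use SUPge in \<open>auto intro: bdd_belowI[of _ v]\<close>)
  moreover have "(SUP y\<in>B. K s y) \<le> v"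
    using t upper by (intro cSUP_least) auto
  moreover have "v \<le> (INF x\<in>A. SUP y\<in>B. K x y)"
    using s SUPge by (intro cINF_greatest) auto
  ultimately show "v = (INF x\<in>A. SUP y\<in>B. K x y)" by linarith
  have "(INF x\<in>A. K x t) \<le> (SUP y\<in>B. INF x\<in>A. K x y)"
    by (rule cSUP_upper[OF t]) (use INFle in \<open>auto intro: bdd_aboveI[of _ v]\<close>)
  moreover have "v \<le> (INF x\<in>A. K x t)"
    using s lower by (intro cINF_greatest) auto
  moreover have "(SUP y\<in>B. INF x\<in>A. K x y) \<le> v"
    using t INFle by (intro cSUP_least) auto
  ultimately show "v = (SUP y\<in>B. INF x\<in>A. K x y)" by linarith
  show "v = K s t" using upper[OF t] lower[OF s] by linarith
qed

section \<open>The equation for the length of the continuation interval\<close>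

locale gap_equation =
  fixes a b p q :: real
  assumes a: "a > 0" and b: "b > 0" and p: "0 \<le> p" "p < 1" and q: "0 \<le> q" "q < 1"
begin

text \<open>In these terms \<open>G\<^sub>I G\<^sub>S = \<mu> \<nu>\<close>, and the equation reads \<open>u + gS u + gI u = 2 \<delta> + E\<^sub>I + E\<^sub>S\<close> with the increasing
  left-hand side below.\<close>

definition "mu = a * (1 - q) / (a + p * b)"
definition "nu = b * (1 - p) / (q * a + b)"

lemma denom_pos: "a + p * b > 0" "q * a + b > 0"
  using a b p q by (simp_all add: add_pos_nonneg add_nonneg_pos)

lemma mu: "0 < mu" "mu \<le> 1"
proof -
  show "0 < mu" using a q denom_pos by (simp add: mu_def)
  have "a * (1 - q) \<le> a" using a q by (simp add: algebra_simps)
  also have "\<dots> \<le> a + p * b" using b p by simp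
  finally show "mu \<le> 1" using denom_pos by (simp add: mu_def)
qed

lemma nu: "0 < nu" "nu \<le> 1"
proof -
  show "0 < nu" using b p denom_pos by (simp add: nu_def)
  have "b * (1 - p) \<le> b" using b p by (simp add: algebra_simps)
  also have "\<dots> \<le> q * a + b" using a q by simp
  finally show "nu \<le> 1" using denom_pos by (simp add: nu_def)
qed

definition "den u = exp ((a + b) * u) - mu * nu"

lemma exp_gt: "exp (a * u) > nu" "exp (b * u) > mu" if "u > 0"
proof -
  have "exp (a * u) > 1" "exp (b * u) > 1" using a b that by auto
  then show "exp (a * u) > nu" "exp (b * u) > mu" using mu nu by linarith+
qed

lemma den_pos: "den u > 0" if "u > 0"
proof -
  have "mu * nu < exp (b * u) * exp (a * u)"
    using exp_gt[OF that] mu nu by (intro mult_strict_mono) auto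
  then show ?thesis by (simp add: den_def algebra_simps exp_add)
qed

text \<open>\<open>gS\<close> and \<open>gI\<close> will be identified with \<open>FI * AS u\<close>
  and \<open>- (FS * AI u)\<close>, the coefficients of the exponentials in \<open>Q'\<close> and
  \<open>Q\<close>.\<close>

definition "gS u = ((a + b) / (a * b)) * (mu * (exp (a * u) - nu)) / den u"
definition "gI u = ((a + b) / (a * b)) * (nu * (exp (b * u) - mu)) / den u"

lemma gS_pos: "gS u > 0" and gI_pos: "gI u > 0" if "u > 0"
  using exp_gt[OF that] den_pos[OF that] mu nu a b by (simp_all add: gS_def gI_def)

text \<open>The derivative of \<open>u + gS u + gI u\<close>, cleared of its denominator
  \<open>(den u)\<^sup>2\<close> and divided by \<open>exp ((a + b) * u)\<close>. After this
  division its own derivative splits into positive factors, so that its sign follows from the value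
  at \<open>0\<close>.\<close>

definition "gap_slope u = exp ((a + b) * u) - 2 * (mu * nu) + (mu * nu)\<^sup>2 * exp (- ((a + b) * u))
   - (a + b) / b * nu * (exp (b * u) - 2 * mu + mu\<^sup>2 * exp (- (b * u)))
   - (a + b) / a * mu * (exp (a * u) - 2 * nu + nu\<^sup>2 * exp (- (a * u)))"

text \<open>At \<open>u = 0\<close> the defects \<open>1 - mu\<close>, \<open>1 - nu\<close> and
  \<open>1 - mu * nu\<close> all carry the common factor \<open>w = q * a + p * b\<close>; once it
  is pulled out, \<open>p * q * (a + b)\<close> remains. The value vanishes when \<open>p\<close> or
  \<open>q\<close> is \<open>0\<close>, so strict positivity has to come from the growth of
  \<open>gap_slope\<close>.\<close>

lemma gap_slope_0: "gap_slope 0 \<ge> 0"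
proof -
  define P T where "P = a + p * b" and "T = q * a + b"
  have PT: "P > 0" "T > 0" using denom_pos by (auto simp: P_def T_def)
  define w where "w = q * a + p * b"
  have muP: "mu * P = a * (1 - q)" and nuT: "nu * T = b * (1 - p)"
    using PT by (simp_all add: mu_def nu_def P_def T_def)
  have m: "1 - mu = w / P"
    using PT muP by (simp add: eq_divide_eq left_diff_distrib) (simp add: P_def w_def algebra_simps)
  have n: "1 - nu = w / T"
    using PT nuT by (simp add: eq_divide_eq left_diff_distrib) (simp add: T_def w_def algebra_simps)
  have mn: "1 - mu * nu = w * (a + b) / (P * T)"
  proof -
    have "(mu * P) * (nu * T) = (a * (1 - q)) * (b * (1 - p))" using muP nuT by simp
    then have "(1 - mu * nu) * (P * T) = P * T - a * (1 - q) * (b * (1 - p))" by (simp add: algebra_simps)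
    also have "\<dots> = w * (a + b)" by (simp add: P_def T_def w_def algebra_simps)
    finally show ?thesis using PT by (simp add: eq_divide_eq)
  qed
  have "gap_slope 0 = (1 - mu * nu)\<^sup>2 - (a + b) / b * nu * (1 - mu)\<^sup>2 - (a + b) / a * mu * (1 - nu)\<^sup>2"
    by (simp add: gap_slope_def power2_eq_square algebra_simps)
  also have "\<dots> = (w * (a + b) / (P * T))\<^sup>2 - (a + b) * (1 - p) / T * (w / P)\<^sup>2 - (a + b) * (1 - q) / P * (w / T)\<^sup>2"
  proof -
    have "(a + b) / b * nu = (a + b) * (1 - p) / T" using b by (simp add: nu_def T_def)
    moreover have "(a + b) / a * mu = (a + b) * (1 - q) / P" using a by (simp add: mu_def P_def)
    ultimately show ?thesis by (simp only: m n mn)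
  qed
  also have "\<dots> = (w\<^sup>2 * (a + b) / (P\<^sup>2 * T\<^sup>2)) * ((a + b) - (1 - p) * T - (1 - q) * P)"
    using PT by (simp add: field_simps power2_eq_square)
  also have "(a + b) - (1 - p) * T - (1 - q) * P = p * q * (a + b)"
    by (simp add: P_def T_def algebra_simps)
  also have "(w\<^sup>2 * (a + b) / (P\<^sup>2 * T\<^sup>2)) * (p * q * (a + b)) \<ge> 0"
    using a b p q by (intro mult_nonneg_nonneg divide_nonneg_nonneg) auto
  finally show ?thesis .
qed

lemma gap_slope_pos: "gap_slope u > 0" if "u > 0"
proof -
  have "gap_slope 0 < gap_slope u"
  \<comment> \<open>The open version is used because the derivative may vanish at \<open>0\<close>,
    namely when \<open>p = q = 0\<close> and hence \<open>mu = nu = 1\<close>.\<close>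
  proof (rule DERIV_pos_imp_increasing_open[OF that])
    fix x :: real assume x: "0 < x" "x < u"
    define A B where "A = exp (a * x)" and "B = exp (b * x)"
    have AB: "A > 0" "B > 0" "exp ((a + b) * x) = A * B" by (auto simp: A_def B_def algebra_simps exp_add)
    have inv: "exp (- (a * x)) = 1 / A" "exp (- (b * x)) = 1 / B" "exp (- ((a + b) * x)) = 1 / (A * B)"
      using AB by (simp_all add: A_def B_def exp_minus divide_inverse)
    let ?R' = "(a + b) * exp ((a + b) * x) - (mu * nu)\<^sup>2 * ((a + b) * exp (- ((a + b) * x)))
        - (a + b) / b * nu * (b * exp (b * x) - mu\<^sup>2 * (b * exp (- (b * x))))
        - (a + b) / a * mu * (a * exp (a * x) - nu\<^sup>2 * (a * exp (- (a * x))))"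
    have "((\<lambda>u. exp ((a + b) * u) - 2 * (mu * nu) + (mu * nu)\<^sup>2 * exp (- ((a + b) * u))
        - k * (exp (b * u) - 2 * mu + mu\<^sup>2 * exp (- (b * u)))
        - l * (exp (a * u) - 2 * nu + nu\<^sup>2 * exp (- (a * u)))) has_real_derivative
        (a + b) * exp ((a + b) * x) - (mu * nu)\<^sup>2 * ((a + b) * exp (- ((a + b) * x)))
        - k * (b * exp (b * x) - mu\<^sup>2 * (b * exp (- (b * x))))
        - l * (a * exp (a * x) - nu\<^sup>2 * (a * exp (- (a * x))))) (at x)" for k l
      by (auto intro!: derivative_eq_intros simp: algebra_simps)
    then have "DERIV gap_slope x :> ?R'"
      unfolding gap_slope_def .
    \<comment> \<open>With both exponentials as variables the derivative factorises into the three
      gaps \<open>A * B - mu * nu\<close>, \<open>A - nu\<close> and \<open>B - mu\<close>, each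
      positive for \<open>x > 0\<close>.\<close>
    moreover have "?R' = (a + b) * ((A * B - mu * nu) * (A - nu) * (B - mu)) / (A * B)"
    proof -
      have "?R' = (a + b) * (A * B - (mu * nu)\<^sup>2 / (A * B) - nu * (B - mu\<^sup>2 / B) - mu * (A - nu\<^sup>2 / A))"
        using a b unfolding inv AB(3) A_def[symmetric] B_def[symmetric] by (simp add: field_simps)
      also have "A * B - (mu * nu)\<^sup>2 / (A * B) - nu * (B - mu\<^sup>2 / B) - mu * (A - nu\<^sup>2 / A)
         = ((A * B - mu * nu) * (A - nu) * (B - mu)) / (A * B)"
        using AB by (simp add: field_simps power2_eq_square)
      finally show ?thesis by simp
    qed
    moreover have "\<dots> > 0"
      using exp_gt[OF x(1)] den_pos[OF x(1)] AB a b by (simp add: den_def A_def[symmetric] B_def[symmetric])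
    ultimately show "\<exists>y. DERIV gap_slope x :> y \<and> y > 0" by metis
  next
    show "continuous_on {0..u} gap_slope" unfolding gap_slope_def by (intro continuous_intros)
  qed
  then show ?thesis using gap_slope_0 by linarith
qed

lemma gap_deriv: "((\<lambda>u. u + gS u + gI u) has_real_derivative exp ((a + b) * u) * gap_slope u / (den u)\<^sup>2) (at u)"
  if u: "u > 0"
proof -
  define A B D where "A = exp (a * u)" and "B = exp (b * u)" and "D = den u"
  have AB: "A > 0" "B > 0" "exp ((a + b) * u) = A * B" by (auto simp: A_def B_def algebra_simps exp_add)
  have inv: "exp (- (a * u)) = 1 / A" "exp (- (b * u)) = 1 / B" "exp (- ((a + b) * u)) = 1 / (A * B)"
    using AB by (simp_all add: A_def B_def exp_minus divide_inverse)
  have D: "D > 0" "D = A * B - mu * nu" using den_pos[OF u] AB by (auto simp: D_def den_def)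
  have den': "(den has_real_derivative (a + b) * (A * B)) (at u)"
    unfolding den_def[abs_def] by (auto intro!: derivative_eq_intros simp: AB(3)[symmetric])
  have quot: "((\<lambda>u. k * (m * (exp (l * u) - n)) / den u) has_real_derivative
      k * ((m * l * exp (l * u)) * D - m * (exp (l * u) - n) * ((a + b) * (A * B))) / D\<^sup>2) (at u)" for k m l n
    by (rule DERIV_cong, rule DERIV_divide[OF _ den'])
      (use D in \<open>auto intro!: derivative_eq_intros simp: D_def[symmetric] power2_eq_square algebra_simps\<close>)
  have gS': "(gS has_real_derivative ((a + b) / (a * b)) * ((mu * a * A) * D - mu * (A - nu) * ((a + b) * (A * B))) / D\<^sup>2) (at u)"
    unfolding gS_def[abs_def] A_def by (rule quot[unfolded A_def])
  have gI': "(gI has_real_derivative ((a + b) / (a * b)) * ((nu * b * B) * D - nu * (B - mu) * ((a + b) * (A * B))) / D\<^sup>2) (at u)"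
    unfolding gI_def[abs_def] B_def by (rule quot[unfolded B_def])
  have "1 + ((a + b) / (a * b)) * ((mu * a * A) * D - mu * (A - nu) * ((a + b) * (A * B))) / D\<^sup>2
      + ((a + b) / (a * b)) * ((nu * b * B) * D - nu * (B - mu) * ((a + b) * (A * B))) / D\<^sup>2
      = A * B * gap_slope u / D\<^sup>2"
  proof -
    \<comment> \<open>Over the common denominator the mixed terms combine to minus two squares.
      These are the two subtracted summands of \<open>gap_slope\<close>, whose brackets are the same
      squares divided by \<open>B\<close> and \<open>A\<close>.\<close>
    have "((mu * a * A) * D - mu * (A - nu) * ((a + b) * (A * B))) + ((nu * b * B) * D - nu * (B - mu) * ((a + b) * (A * B)))
       = - a * nu * A * (B - mu)\<^sup>2 - b * mu * B * (A - nu)\<^sup>2"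
      unfolding D(2) by (simp add: algebra_simps power2_eq_square)
    moreover have "A * B * gap_slope u = D\<^sup>2 + ((a + b) / (a * b)) * (- a * nu * A * (B - mu)\<^sup>2 - b * mu * B * (A - nu)\<^sup>2)"
      unfolding gap_slope_def D(2) inv AB(3) A_def[symmetric] B_def[symmetric]
      using a b AB(1,2) by (simp add: field_simps power2_eq_square)
    moreover have "1 + k * X / D\<^sup>2 + k * Y / D\<^sup>2 = (D\<^sup>2 + k * (X + Y)) / D\<^sup>2" for k X Y
      using D(1) by (simp add: add_divide_distrib distrib_left)
    ultimately show ?thesis by (simp only:)
  qed
  then show ?thesis
    unfolding D_def[symmetric] AB(3)
    by (auto intro!: derivative_eq_intros gS' gI')
qed

lemma gap_strict_mono:
  assumes "0 < u" "u < v"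
  shows "u + gS u + gI u < v + gS v + gI v"
proof (rule DERIV_pos_imp_increasing[OF assms(2)])
  fix x assume "u \<le> x" "x \<le> v"
  then have x: "x > 0" using assms by linarith
  have "exp ((a + b) * x) * gap_slope x / (den x)\<^sup>2 > 0"
    using gap_slope_pos[OF x] den_pos[OF x] by simp
  then show "\<exists>y. ((\<lambda>u. u + gS u + gI u) has_real_derivative y) (at x) \<and> y > 0"
    using gap_deriv[OF x] by blast
qed

text \<open>The estimate with \<open>1\<close> in place of \<open>mu\<close> and \<open>nu\<close>,
  \<open>(a + b) * (A - 1) \<le> a * (A * B - 1)\<close>, rests on
  \<open>1 - exp (- s) \<le> s \<le> exp s - 1\<close>. The shift to \<open>nu\<close> and
  \<open>mu * nu\<close> is exact, because \<open>(a + b) * (1 - nu) = P * (1 - mu * nu)\<close>.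
  The bound serves twice: it locates the root \<open>u\<close>, and it gives the slope condition
  that makes a hinge function monotone.\<close>

lemma gS_le: "gS u \<le> (1 - q) / b" if u: "u > 0"
proof -
  define A B P T where "A = exp (a * u)" and "B = exp (b * u)" and "P = a + p * b" and "T = q * a + b"
  have AB: "exp ((a + b) * u) = A * B" "A > 0" by (auto simp: A_def B_def algebra_simps exp_add)
  have PT: "P > 0" "T > 0" "P \<ge> a" using denom_pos p b by (auto simp: P_def T_def)
  have "1 + - (a * u) \<le> exp (- (a * u))" by (rule exp_ge_add_one_self)
  also have "exp (- (a * u)) = 1 / A" by (simp add: A_def exp_minus divide_inverse)
  finally have "(1 + - (a * u)) * A \<le> 1" using AB(2) by (simp add: field_simps)
  then have "b * (A - 1) \<le> b * (a * u * A)" using b by (intro mult_left_mono) (auto simp: algebra_simps)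
  also have "\<dots> = a * A * (b * u)" by simp
  also have "\<dots> \<le> a * A * (B - 1)"
    unfolding B_def using exp_ge_add_one_self[of "b * u"] a AB(2)
    by (intro mult_left_mono mult_nonneg_nonneg) linarith+
  finally have "(a + b) * (A - 1) \<le> a * (A * B - 1)" by (simp add: algebra_simps)
  also have "\<dots> \<le> P * (A * B - 1)"
  proof -
    have "A * B \<ge> 1" unfolding AB(1)[symmetric] using a b u by simp
    then show ?thesis using PT by (intro mult_right_mono) auto
  qed
  finally have 1: "(a + b) * (A - 1) \<le> P * (A * B - 1)" .
  have muP: "mu * P = a * (1 - q)" and nuT: "nu * T = b * (1 - p)"
    using PT by (simp_all add: mu_def nu_def P_def T_def)
  have "T * ((a + b) * (1 - nu)) = T * (P - mu * P * nu)"
  proof -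
    have "T * ((a + b) * (1 - nu)) = (a + b) * (T - nu * T)" by (simp add: algebra_simps)
    also have "\<dots> = T * P - (mu * P) * (nu * T)" unfolding muP nuT by (simp add: P_def T_def algebra_simps)
    finally show ?thesis by (simp add: algebra_simps)
  qed
  then have "(a + b) * (1 - nu) = P - mu * P * nu" using PT by simp
  with 1 have 2: "(a + b) * (A - nu) \<le> P * (A * B - mu * nu)" by (simp add: algebra_simps)
  have 3: "(a + b) * (A - nu) / P \<le> den u"
    unfolding den_def AB(1) using 2 PT by (simp add: pos_divide_le_eq mult.commute[of _ P])
  have "gS u = (1 - q) / b * ((a + b) * (A - nu) / P) / den u"
    using a b PT unfolding gS_def A_def[symmetric] by (simp add: mu_def P_def)
  also have "\<dots> \<le> (1 - q) / b * den u / den u"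
    using 3 q b den_pos[OF u] by (intro divide_right_mono mult_left_mono) auto
  finally show ?thesis using den_pos[OF u] by simp
qed

text \<open>Exchanging \<open>a\<close> with \<open>b\<close> and \<open>p\<close> with
  \<open>q\<close> exchanges \<open>mu\<close> with \<open>nu\<close> and \<open>gS\<close> with
  \<open>gI\<close>.\<close>

lemma gI_le: "gI u \<le> (1 - p) / a" if u: "u > 0"
proof -
  interpret mirror: gap_equation b a q p
    using a b p q by unfold_locales
  have "mirror.mu = nu" "mirror.nu = mu"
    by (simp_all add: mirror.mu_def mirror.nu_def mu_def nu_def add.commute)
  then have "mirror.gS u = gI u"
    by (simp add: mirror.gS_def gI_def mirror.den_def den_def ac_simps)
  then show ?thesis using mirror.gS_le[OF u] by simp
qed

lemma gap_unique_solution: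
  assumes "\<delta> > 0"
  shows "\<exists>!u. u > 0 \<and> u + gS u + gI u = 2 * \<delta> + (1 - p) / a + (1 - q) / b"
proof -
  let ?c = "2 * \<delta> + (1 - p) / a + (1 - q) / b"
  have c: "\<delta> \<le> ?c" using assms p q a b by (simp add: add_increasing2)
  have "\<exists>u. \<delta> \<le> u \<and> u \<le> ?c \<and> u + gS u + gI u = ?c"
  \<comment> \<open>The interval starts at \<open>\<delta>\<close> and not at \<open>0\<close>,
    where \<open>den\<close> may vanish. At the left end the bounds on \<open>gS\<close> and
    \<open>gI\<close> keep the sum below the target; at the right end it is enough that both are
    positive.\<close>
  proof (rule IVT'[OF _ _ c])
    show "\<delta> + gS \<delta> + gI \<delta> \<le> ?c" using gS_le[OF assms] gI_le[OF assms] assms by linarith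
    show "?c \<le> ?c + gS ?c + gI ?c" using gS_pos[of ?c] gI_pos[of ?c] c assms by linarith
    show "continuous_on {\<delta>..?c} (\<lambda>u. u + gS u + gI u)"
    proof (intro continuous_at_imp_continuous_on ballI)
      fix x assume "x \<in> {\<delta>..?c}"
      then have "x > 0" using assms by simp
      then show "isCont (\<lambda>u. u + gS u + gI u) x" by (rule DERIV_isCont[OF gap_deriv])
    qed
  qed
  then obtain u where u: "u > 0" "u + gS u + gI u = ?c" using assms by (meson less_le_trans)
  show ?thesis
  proof (rule ex1I[of _ u])
    fix v assume v: "v > 0 \<and> v + gS v + gI v = ?c"
    then show "v = u" using gap_strict_mono[of u v] gap_strict_mono[of v u] u by (cases v u rule: linorder_cases) auto
  qed (use u in simp)
qed

section \<open>The constants of the statement and the equations they satisfy\<close>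

definition "EI = (1 - p) / a"
definition "ES = (1 - q) / b"
definition "FI = (a + b) / (a + p * b)"
definition "FS = (a + b) / (q * a + b)"
definition "GI = (a + b) / (a + p * b) - 1"
definition "GS = (a + b) / (q * a + b) - 1"
definition "AI u = (- EI * exp (b * u) + ES * GI) / (exp ((a + b) * u) - GI * GS)"
definition "AS u = (ES * exp (a * u) - EI * GS) / (exp ((a + b) * u) - GI * GS)"

lemma GI_eq: "GI = b * (1 - p) / (a + p * b)" and GS_eq: "GS = a * (1 - q) / (q * a + b)"
  using denom_pos by (auto simp: GI_def GS_def diff_eq_eq add_divide_distrib[symmetric] divide_simps algebra_simps)

lemma den_eq: "exp ((a + b) * u) - GI * GS = den u"
  by (simp add: GI_eq GS_eq den_def mu_def nu_def)

lemma FI_AS: "FI * AS u = gS u"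
proof -
  have 1: "FI * ES = (a + b) / (a * b) * mu" using a b denom_pos by (simp add: FI_def ES_def mu_def)
  have 2: "FI * (EI * GS) = (a + b) / (a * b) * mu * nu"
    using a b denom_pos by (simp add: FI_def EI_def GS_eq mu_def nu_def)
  have "FI * AS u = (FI * ES * exp (a * u) - FI * (EI * GS)) / den u"
    unfolding AS_def den_eq by (simp add: right_diff_distrib)
  also have "\<dots> = gS u" unfolding 1 2 gS_def by (simp add: algebra_simps)
  finally show ?thesis .
qed

lemma FS_AI: "FS * AI u = - gI u"
proof -
  have 1: "FS * EI = (a + b) / (a * b) * nu" using a b denom_pos by (simp add: FS_def EI_def nu_def)
  have 2: "FS * (ES * GI) = (a + b) / (a * b) * nu * mu"
    using a b denom_pos by (simp add: FS_def ES_def GI_eq mu_def nu_def)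
  have "FS * AI u = - ((FS * EI * exp (b * u) - FS * (ES * GI)) / den u)"
    unfolding AI_def den_eq by (simp add: right_diff_distrib minus_divide_left)
  also have "\<dots> = - gI u" unfolding 1 2 gI_def by (simp add: algebra_simps)
  finally show ?thesis .
qed

lemma gap_equation_rhs:
  "(- EI * FS * exp (b * u) - ES * FI * exp (a * u) + 2 * ES * FS * GI) / (exp ((a + b) * u) - GI * GS)
    = - gS u - gI u"
proof -
  have "ES * FS * GI = EI * FI * GS"
    using a b denom_pos by (simp add: EI_def ES_def FI_def FS_def GI_eq GS_eq mult_ac)
  then have "(- EI * FS * exp (b * u) - ES * FI * exp (a * u) + 2 * ES * FS * GI) / (exp ((a + b) * u) - GI * GS)
      = FS * AI u - FI * AS u"
    by (simp add: AI_def AS_def diff_divide_distrib[symmetric] algebra_simps)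
  then show ?thesis by (simp add: FI_AS FS_AI)
qed

text \<open>Cramer's rule: \<open>AI u\<close> and \<open>AS u\<close> solve this linear system.
  With \<open>FI = GI + 1\<close> and \<open>FS = GS + 1\<close> it says that the middle branch of
  the value function meets \<open>x + \<delta>\<close> at \<open>x\<^sub>I\<close> and
  \<open>x - \<delta>\<close> at \<open>x\<^sub>S\<close>.\<close>

lemma AI_exp: "AI u * exp (a * u) = GI * AS u - EI"
  and AS_exp: "AS u * exp (b * u) = GS * AI u + ES" if "u > 0"
proof -
  define D where "D = exp ((a + b) * u) - GI * GS"
  have D: "D \<noteq> 0" using den_pos[OF that] by (simp add: D_def den_eq)
  have e: "exp (a * u) * exp (b * u) = D + GI * GS" by (simp add: D_def exp_add algebra_simps)
  have AI: "AI u * D = - EI * exp (b * u) + ES * GI" and AS: "AS u * D = ES * exp (a * u) - EI * GS"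
    using D by (simp_all add: AI_def AS_def D_def)
  have "(AI u * exp (a * u)) * D = (AI u * D) * exp (a * u)" by simp
  also have "\<dots> = - EI * (exp (a * u) * exp (b * u)) + ES * GI * exp (a * u)"
    unfolding AI by (simp add: algebra_simps)
  also have "\<dots> = GI * (AS u * D) - EI * D" unfolding AS e by (simp add: algebra_simps)
  also have "\<dots> = (GI * AS u - EI) * D" by (simp add: algebra_simps)
  finally show "AI u * exp (a * u) = GI * AS u - EI" using D by simp
  have "(AS u * exp (b * u)) * D = (AS u * D) * exp (b * u)" by simp
  also have "\<dots> = ES * (exp (a * u) * exp (b * u)) - EI * GS * exp (b * u)"
    unfolding AS by (simp add: algebra_simps)
  also have "\<dots> = GS * (AI u * D) + ES * D" unfolding AI e by (simp add: algebra_simps)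
  also have "\<dots> = (GS * AI u + ES) * D" by (simp add: algebra_simps)
  finally show "AS u * exp (b * u) = GS * AI u + ES" using D by simp
qed

text \<open>The second bound is the slope condition under which a hinge with coefficient
  \<open>FI * AS u\<close> is nondecreasing. The signs of \<open>AS u\<close> and
  \<open>AI u\<close> make the derivative of the middle branch convex.\<close>

lemma AS_bounds: "0 < AS u" "b * (FI * AS u) \<le> 1" if "u > 0"
proof -
  have "FI > 0" using a b denom_pos by (simp add: FI_def)
  then show "0 < AS u" using gS_pos[OF that] FI_AS[of u] by (metis zero_less_mult_pos)
  show "b * (FI * AS u) \<le> 1" using gS_le[OF that] b q by (simp add: FI_AS field_simps)
qed

lemma AI_bounds: "AI u < 0" "a * (FS * - AI u) \<le> 1" if "u > 0"
proof -
  have "FS > 0" using a b denom_pos by (simp add: FS_def)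
  then show "AI u < 0" using gI_pos[OF that] FS_AI[of u]
    by (metis neg_less_0_iff_less mult_less_0_iff not_less_iff_gr_or_eq)
  have "FS * - AI u = gI u" using FS_AI[of u] by simp
  then show "a * (FS * - AI u) \<le> 1" using gI_le[OF that] a p by (simp add: field_simps)
qed

end

section \<open>Random walks and independence\<close>

text \<open>Independence of the preimages makes the joint law of \<open>Z\<close> and
  \<open>Y\<close> the product of their laws, and Tonelli does the rest. The set systems are left
  abstract so that the lemma serves both for an increment against the past and for the killing time
  against the path.\<close>

lemma (in prob_space) indep_set_nn_integral:
  assumes ind: "indep_set \<A> \<B>"
    and Z[measurable]: "Z \<in> measurable M N" and Y[measurable]: "Y \<in> measurable M K"
    and ZA: "\<And>A. A \<in> sets N \<Longrightarrow> Z -` A \<inter> space M \<in> \<A>"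
    and YB: "\<And>B. B \<in> sets K \<Longrightarrow> Y -` B \<inter> space M \<in> \<B>"
    and f[measurable]: "f \<in> borel_measurable (N \<Otimes>\<^sub>M K)"
  shows "(\<integral>\<^sup>+\<omega>. f (Z \<omega>, Y \<omega>) \<partial>M) = (\<integral>\<^sup>+\<omega>. \<integral>\<^sup>+\<omega>'. f (Z \<omega>, Y \<omega>') \<partial>M \<partial>M)"
proof -
  interpret Z: prob_space "distr M N Z" by (rule prob_space_distr) fact
  interpret Y: prob_space "distr M K Y" by (rule prob_space_distr) fact
  have eq: "distr M N Z \<Otimes>\<^sub>M distr M K Y = distr M (N \<Otimes>\<^sub>M K) (\<lambda>x. (Z x, Y x))"
  proof (rule pair_measure_eqI)
    fix A B assume "A \<in> sets (distr M N Z)" "B \<in> sets (distr M K Y)"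
    then have AB[measurable]: "A \<in> sets N" "B \<in> sets K" by auto
    have "emeasure (distr M (N \<Otimes>\<^sub>M K) (\<lambda>x. (Z x, Y x))) (A \<times> B)
        = emeasure M ((Z -` A \<inter> space M) \<inter> (Y -` B \<inter> space M))"
      by (subst emeasure_distr) (auto intro!: arg_cong[where f="emeasure M"])
    also have "\<dots> = ennreal (prob (Z -` A \<inter> space M) * prob (Y -` B \<inter> space M))"
      unfolding emeasure_eq_measure by (rule arg_cong[where f=ennreal], rule indep_setD[OF ind ZA YB]) fact+
    finally show "emeasure (distr M N Z) A * emeasure (distr M K Y) B
        = emeasure (distr M (N \<Otimes>\<^sub>M K) (\<lambda>x. (Z x, Y x))) (A \<times> B)"
      by (simp add: emeasure_distr emeasure_eq_measure ennreal_mult)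
  qed (simp_all add: Z.sigma_finite_measure_axioms Y.sigma_finite_measure_axioms)
  have "(\<integral>\<^sup>+\<omega>. f (Z \<omega>, Y \<omega>) \<partial>M) = (\<integral>\<^sup>+p. f p \<partial>(distr M N Z \<Otimes>\<^sub>M distr M K Y))"
    unfolding eq by (subst nn_integral_distr) auto
  also have "\<dots> = (\<integral>\<^sup>+z. \<integral>\<^sup>+y. f (z, y) \<partial>distr M K Y \<partial>distr M N Z)"
    by (rule Y.nn_integral_fst[symmetric]) simp
  also have "\<dots> = (\<integral>\<^sup>+\<omega>. \<integral>\<^sup>+y. f (Z \<omega>, y) \<partial>distr M K Y \<partial>M)"
    by (subst nn_integral_distr) auto
  also have "\<dots> = (\<integral>\<^sup>+\<omega>. \<integral>\<^sup>+\<omega>'. f (Z \<omega>, Y \<omega>') \<partial>M \<partial>M)"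
    by (intro nn_integral_cong, subst nn_integral_distr)
      (auto intro: measurable_compose[OF _ f] measurable_Pair1' simp: measurable_space[OF Z])
  finally show ?thesis .
qed

text \<open>The expectation of \<open>max v (g y\<^sub>0) \<dots> (g y\<^sub>k)\<close> along \<open>k\<close> steps of a random walk started at \<open>y\<^sub>0 = y\<close> with
  step law \<open>\<mu>\<close>.\<close>

primrec walk_sup :: "(real \<Rightarrow> ennreal) \<Rightarrow> real measure \<Rightarrow> nat \<Rightarrow> ennreal \<Rightarrow> real \<Rightarrow> ennreal" where
  "walk_sup g \<mu> 0 v y = max v (g y)"
| "walk_sup g \<mu> (Suc k) v y = (\<integral>\<^sup>+z. walk_sup g \<mu> k (max v (g y)) (y + z) \<partial>\<mu>)"

lemma measurable_walk_sup_pair: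
  assumes [measurable]: "g \<in> borel_measurable borel" and "prob_space \<mu>" and [measurable_cong]: "sets \<mu> = sets borel"
  shows "(\<lambda>p. walk_sup g \<mu> k (fst p) (snd p)) \<in> borel_measurable (borel \<Otimes>\<^sub>M borel)"
proof (induction k)
  case (Suc k)
  interpret prob_space \<mu> by fact
  have "(\<lambda>p. walk_sup g \<mu> k (fst (f p)) (snd (f p))) \<in> borel_measurable N"
    if "f \<in> measurable N (borel \<Otimes>\<^sub>M borel)" for f and N :: "'x measure"
    using measurable_compose[OF that Suc] .
  from this[of "\<lambda>p. (max (fst (fst p)) (g (snd (fst p))), snd (fst p) + snd p)"]
  have [measurable]: "(\<lambda>p. walk_sup g \<mu> k (max (fst (fst p)) (g (snd (fst p)))) (snd (fst p) + snd p))
     \<in> borel_measurable ((borel \<Otimes>\<^sub>M borel) \<Otimes>\<^sub>M \<mu>)"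
    by simp
  show ?case by (simp add: borel_measurable_nn_integral split_beta')
qed simp

lemma measurable_walk_sup:
  assumes "g \<in> borel_measurable borel" "prob_space \<mu>" "sets \<mu> = sets borel"
    and "v \<in> borel_measurable N" "y \<in> borel_measurable N"
  shows "(\<lambda>x. walk_sup g \<mu> k (v x) (y x)) \<in> borel_measurable N"
  using measurable_compose[OF measurable_Pair[OF assms(4,5)] measurable_walk_sup_pair[OF assms(1-3)]] by simp

lemma walk_sup_mono: "v \<le> w \<Longrightarrow> walk_sup g \<mu> k v y \<le> walk_sup g \<mu> k w y"
proof (induction k arbitrary: v w y)
  case 0 then show ?case by (auto simp: max.coboundedI1)
next
  case (Suc k)
  show ?case unfolding walk_sup.simps by (intro nn_integral_mono Suc.IH max.mono Suc.prems order_refl)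
qed

lemma walk_sup_le:
  assumes "prob_space \<mu>" and g: "\<And>y. g y \<le> C"
  shows "v \<le> C \<Longrightarrow> walk_sup g \<mu> k v y \<le> C"
proof (induction k arbitrary: v y)
  case 0 then show ?case using g by simp
next
  case (Suc k)
  interpret prob_space \<mu> by fact
  have "walk_sup g \<mu> (Suc k) v y \<le> (\<integral>\<^sup>+z. C \<partial>\<mu>)"
    unfolding walk_sup.simps using Suc g by (intro nn_integral_mono) auto
  then show ?case by (simp add: emeasure_space_1)
qed

section \<open>Levy processes killed at an exponential time\<close>

text \<open>Here \<open>q\<close> is the atom of the supremum at \<open>0\<close> and
  \<open>b\<close> its exponential rate. The infimum is treated as the supremum in a second instance
  at \<open>-X\<close>, which is why only one law appears.\<close>

locale exp_killed_levy =
  fixes M :: "'a measure" and F :: "real \<Rightarrow> 'a measure" and X :: "real \<Rightarrow> 'a \<Rightarrow> real"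
    and er :: "'a \<Rightarrow> real" and r q b :: real
  assumes levy: "levy_process M F X"
    and r_pos: "r > 0"
    and er_exp: "distributed M lborel er (exponential_density r)"
    and er_indep: "prob_space.indep_set M
        {er -` B \<inter> space M | B. B \<in> sets borel}
        (sigma_sets (space M) {X t -` B \<inter> space M | t B. 0 \<le> t \<and> B \<in> sets borel})"
    and b: "b > 0" and q: "0 \<le> q" "q < 1"
    and law_S: "\<forall>y\<ge>0. measure M {\<omega>\<in>space M. Sup ((\<lambda>t. X t \<omega>) ` {0..er \<omega>}) > y}
                       = (1 - q) * exp (- b * y)"
begin

sublocale prob_space M
  using levy by (auto simp: levy_process_def filtered_usual_def)

lemma
  shows space_F: "\<And>t. t \<ge> 0 \<Longrightarrow> space (F t) = space M"
    and sets_F: "\<And>t. t \<ge> 0 \<Longrightarrow> sets (F t) \<subseteq> sets M"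
    and sets_F_mono: "\<And>s t. 0 \<le> s \<Longrightarrow> s \<le> t \<Longrightarrow> sets (F s) \<subseteq> sets (F t)"
    and null_F: "\<And>A t N. 0 \<le> t \<Longrightarrow> A \<subseteq> N \<Longrightarrow> N \<in> null_sets M \<Longrightarrow> A \<in> sets (F t)"
    and X_0: "\<And>\<omega>. \<omega> \<in> space M \<Longrightarrow> X 0 \<omega> = 0"
    and X_adapted: "\<And>t. t \<ge> 0 \<Longrightarrow> X t \<in> borel_measurable (F t)"
    and X_right_cont: "\<And>\<omega> t. \<omega> \<in> space M \<Longrightarrow> t \<ge> 0 \<Longrightarrow> ((\<lambda>s. X s \<omega>) \<longlongrightarrow> X t \<omega>) (at_right t)"
    and X_left_lim: "\<And>\<omega> t. \<omega> \<in> space M \<Longrightarrow> t > 0 \<Longrightarrow> \<exists>l. ((\<lambda>s. X s \<omega>) \<longlongrightarrow> l) (at_left t)"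
    and incr_indep: "\<And>s t. 0 \<le> s \<Longrightarrow> 0 \<le> t \<Longrightarrow> indep_set (sets (F t))
            {(\<lambda>\<omega>. X (t + s) \<omega> - X t \<omega>) -` B \<inter> space M | B. B \<in> sets borel}"
    and incr_distr: "\<And>s t. 0 \<le> s \<Longrightarrow> 0 \<le> t \<Longrightarrow>
           distr M borel (\<lambda>\<omega>. X (t + s) \<omega> - X t \<omega>) = distr M borel (X s)"
proof -
  have fu: "filtered_usual M F" using levy by (simp add: levy_process_def)
  then have "\<forall>t\<ge>0. space (F t) = space M \<and> sets (F t) \<subseteq> sets M"
    unfolding filtered_usual_def by (elim conjE)
  then show "\<And>t. t \<ge> 0 \<Longrightarrow> space (F t) = space M" "\<And>t. t \<ge> 0 \<Longrightarrow> sets (F t) \<subseteq> sets M"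
    by auto
  have "\<forall>s t. 0 \<le> s \<longrightarrow> s \<le> t \<longrightarrow> sets (F s) \<subseteq> sets (F t)"
    using fu unfolding filtered_usual_def by (elim conjE)
  then show mono: "\<And>s t. 0 \<le> s \<Longrightarrow> s \<le> t \<Longrightarrow> sets (F s) \<subseteq> sets (F t)"
    by auto
  show "A \<in> sets (F t)" if t: "0 \<le> t" and A: "A \<subseteq> N" and N: "N \<in> null_sets M" for A t N
  proof -
    have "A \<subseteq> space M" using A sets.sets_into_space[of N M] N by auto
    moreover have "\<forall>A. A \<subseteq> space M \<longrightarrow> (\<exists>N\<in>sets M. A \<subseteq> N \<and> emeasure M N = 0) \<longrightarrow> A \<in> sets (F 0)"
      using fu unfolding filtered_usual_def by (elim conjE)
    ultimately have "A \<in> sets (F 0)" using A N unfolding null_sets_def by blast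
    then show ?thesis using mono[OF order_refl t] by auto
  qed
  show "\<And>\<omega>. \<omega> \<in> space M \<Longrightarrow> X 0 \<omega> = 0" "\<And>t. t \<ge> 0 \<Longrightarrow> X t \<in> borel_measurable (F t)"
    using levy unfolding levy_process_def by (elim conjE; simp)+
  show "\<And>\<omega> t. \<omega> \<in> space M \<Longrightarrow> t \<ge> 0 \<Longrightarrow> ((\<lambda>s. X s \<omega>) \<longlongrightarrow> X t \<omega>) (at_right t)"
    "\<And>\<omega> t. \<omega> \<in> space M \<Longrightarrow> t > 0 \<Longrightarrow> \<exists>l. ((\<lambda>s. X s \<omega>) \<longlongrightarrow> l) (at_left t)"
    using levy unfolding levy_process_def continuous_within by (elim conjE; simp)+
  show "\<And>s t. 0 \<le> s \<Longrightarrow> 0 \<le> t \<Longrightarrow> indep_set (sets (F t))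
            {(\<lambda>\<omega>. X (t + s) \<omega> - X t \<omega>) -` B \<inter> space M | B. B \<in> sets borel}"
    "\<And>s t. 0 \<le> s \<Longrightarrow> 0 \<le> t \<Longrightarrow>
           distr M borel (\<lambda>\<omega>. X (t + s) \<omega> - X t \<omega>) = distr M borel (X s)"
    using levy unfolding levy_process_def by (elim conjE; blast)+
qed

lemma measurable_F_M: "t \<ge> 0 \<Longrightarrow> f \<in> measurable (F t) N \<Longrightarrow> f \<in> measurable M N"
  using space_F[of t] sets_F[of t] by (auto simp: measurable_def)

lemma measurable_F_mono: "0 \<le> s \<Longrightarrow> s \<le> t \<Longrightarrow> f \<in> measurable (F s) N \<Longrightarrow> f \<in> measurable (F t) N"
  using space_F[of t] space_F[of s] sets_F_mono[of s t] by (auto simp: measurable_def)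

lemma X_measurable_F: "0 \<le> s \<Longrightarrow> s \<le> t \<Longrightarrow> X s \<in> borel_measurable (F t)"
  by (rule measurable_F_mono[OF _ _ X_adapted])

lemma X_measurable[measurable]: "t \<ge> 0 \<Longrightarrow> X t \<in> borel_measurable M"
  by (rule measurable_F_M[OF _ X_adapted])

lemma X_right_cont_seq:
  assumes "\<omega> \<in> space M" "t \<ge> 0" "s \<longlonglongrightarrow> t" "\<And>n. t \<le> s n"
  shows "(\<lambda>n. X (s n) \<omega>) \<longlonglongrightarrow> X t \<omega>"
proof -
  have "continuous (at t within {t..}) (\<lambda>s. X s \<omega>)"
    using X_right_cont[OF assms(1,2)] by (simp add: continuous_within at_within_Ici_at_right)
  then show ?thesis
    using assms(3,4) unfolding continuous_within_sequentially by (auto simp: o_def)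
qed

text \<open>One-sided limits bound the path near each time, and compactness of \<open>{0..T}\<close>
  makes the bound global. Without it, \<open>Sup\<close> over a path would be an unspecified
  real.\<close>

lemma X_bdd_above:
  assumes \<omega>: "\<omega> \<in> space M"
  shows "bdd_above ((\<lambda>t. X t \<omega>) ` {0..T})"
proof -
  have "\<exists>d>0. \<exists>c. \<forall>s\<in>{0..T}. dist s t < d \<longrightarrow> X s \<omega> \<le> c" if t: "t \<in> {0..T}" for t
  proof -
    have "eventually (\<lambda>s. X s \<omega> < X t \<omega> + 1) (at_right t)"
      using X_right_cont[OF \<omega>, of t] t by (intro order_tendstoD(2)) auto
    then obtain d1 where d1: "d1 > t" "\<And>s. t < s \<Longrightarrow> s < d1 \<Longrightarrow> X s \<omega> < X t \<omega> + 1"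
      unfolding eventually_at_right_field by blast
    obtain d2 c where d2: "d2 < t" "\<And>s. d2 < s \<Longrightarrow> s < t \<Longrightarrow> 0 \<le> s \<Longrightarrow> X s \<omega> \<le> c"
    proof (cases "t = 0")
      case True
      \<comment> \<open>No time in the domain lies to the left of \<open>0\<close>, so a negative
        \<open>d2\<close> makes the condition empty.\<close>
      show thesis by (rule that[of "-1"]) (use True in auto)
    next
      case False
      then obtain l where "((\<lambda>s. X s \<omega>) \<longlongrightarrow> l) (at_left t)" using X_left_lim[OF \<omega>, of t] t by auto
      then have "eventually (\<lambda>s. X s \<omega> < l + 1) (at_left t)"
        by (rule order_tendstoD(2)) simp
      then obtain d where "d < t" "\<And>s. d < s \<Longrightarrow> s < t \<Longrightarrow> X s \<omega> < l + 1"
        unfolding eventually_at_left_field by blast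
      then show thesis by (intro that[of d "l + 1"]) (auto intro: less_imp_le)
    qed
    have "\<forall>s\<in>{0..T}. dist s t < min (d1 - t) (t - d2) \<longrightarrow> X s \<omega> \<le> max c (X t \<omega> + 1)"
    proof (intro ballI impI)
      fix s assume "s \<in> {0..T}" "dist s t < min (d1 - t) (t - d2)"
      then show "X s \<omega> \<le> max c (X t \<omega> + 1)"
        using d1(2)[of s] d2(2)[of s] by (cases s t rule: linorder_cases) (auto simp: dist_real_def)
    qed
    moreover have "min (d1 - t) (t - d2) > 0" using d1 d2 by auto
    ultimately show ?thesis by blast
  qed
  then have "\<forall>t\<in>{0..T}. \<exists>d c. d > 0 \<and> (\<forall>s\<in>{0..T}. dist s t < d \<longrightarrow> X s \<omega> \<le> c)"
    by blast
  then obtain d c where dc: "\<And>t. t \<in> {0..T} \<Longrightarrow> d t > 0"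
    "\<And>t s. t \<in> {0..T} \<Longrightarrow> s \<in> {0..T} \<Longrightarrow> dist s t < d t \<Longrightarrow> X s \<omega> \<le> c t"
    unfolding bchoice_iff by blast
  obtain C where C: "C \<subseteq> {0..T}" "finite C" "{0..T} \<subseteq> (\<Union>t\<in>C. ball t (d t))"
  proof (rule compactE_image[OF compact_Icc, of "{0..T}" "\<lambda>t. ball t (d t)" 0 T])
    show "{0..T} \<subseteq> (\<Union>t\<in>{0..T}. ball t (d t))" using dc(1) by fastforce
  qed auto
  show ?thesis
  proof (cases "C = {}")
    case True
    with C show ?thesis by simp
  next
    case False
    show ?thesis
    proof (rule bdd_aboveI2)
      fix s assume s: "s \<in> {0..T}"
      then obtain t where t: "t \<in> C" "s \<in> ball t (d t)" using C by auto
      then have "X s \<omega> \<le> c t" using dc(2)[of t s] s C by (auto simp: dist_commute)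
      also have "\<dots> \<le> Max (c ` C)" using t C by simp
      finally show "X s \<omega> \<le> Max (c ` C)" .
    qed
  qed
qed

section \<open>The process on a time grid\<close>

definition "step_law h = distr M borel (X h)"

lemma prob_space_step_law: "h \<ge> 0 \<Longrightarrow> prob_space (step_law h)"
  unfolding step_law_def by (intro prob_space_distr) simp

lemma sets_step_law[measurable_cong]: "sets (step_law h) = sets borel"
  by (simp add: step_law_def)

text \<open>The Markov property for one increment against anything known at time \<open>t\<close>.
  The conditioning is carried by the argument \<open>Z\<close> in place of a conditional
  expectation.\<close>

lemma markov_step:
  assumes t: "0 \<le> t" and h: "0 \<le> h" and Z: "Z \<in> measurable (F t) N"
    and f[measurable]: "f \<in> borel_measurable (N \<Otimes>\<^sub>M borel)"
  shows "(\<integral>\<^sup>+\<omega>. f (Z \<omega>, X (t + h) \<omega> - X t \<omega>) \<partial>M) = (\<integral>\<^sup>+\<omega>. \<integral>\<^sup>+z. f (Z \<omega>, z) \<partial>step_law h \<partial>M)"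
proof -
  have [measurable]: "Z \<in> measurable M N" by (rule measurable_F_M[OF t Z])
  have "(\<integral>\<^sup>+\<omega>. f (Z \<omega>, X (t + h) \<omega> - X t \<omega>) \<partial>M)
      = (\<integral>\<^sup>+\<omega>. \<integral>\<^sup>+\<omega>'. f (Z \<omega>, X (t + h) \<omega>' - X t \<omega>') \<partial>M \<partial>M)"
    using t h measurable_sets[OF Z] space_F[OF t]
    by (intro indep_set_nn_integral[OF incr_indep[OF h t], where N=N and K=borel]) auto
  also have "\<dots> = (\<integral>\<^sup>+\<omega>. \<integral>\<^sup>+z. f (Z \<omega>, z) \<partial>distr M borel (\<lambda>\<omega>. X (t + h) \<omega> - X t \<omega>) \<partial>M)"
    using t h measurable_space[OF Z] space_F[OF t]
    by (intro nn_integral_cong, subst nn_integral_distr)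
      (auto intro: measurable_compose[OF _ f] measurable_Pair1')
  finally show ?thesis unfolding incr_distr[OF h t] step_law_def .
qed

text \<open>Only indices below \<open>i\<close> are included, so \<open>grid_sup\<close> at
  \<open>i\<close> is the maximum before the current position is looked at. This matches
  \<open>walk_sup\<close>, which itself takes the maximum with \<open>g\<close> at its starting
  point; the empty supremum is \<open>0\<close>.\<close>

definition grid_sup :: "(real \<Rightarrow> ennreal) \<Rightarrow> real \<Rightarrow> real \<Rightarrow> nat \<Rightarrow> 'a \<Rightarrow> ennreal" where
  "grid_sup g h y i \<omega> = (SUP j\<in>{..<i}. g (y + X (real j * h) \<omega>))"

lemma grid_sup_0: "grid_sup g h y 0 \<omega> = 0"
  by (simp add: grid_sup_def bot_ennreal)

lemma grid_sup_Suc: "grid_sup g h y (Suc i) \<omega> = max (grid_sup g h y i \<omega>) (g (y + X (real i * h) \<omega>))"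
  by (simp add: grid_sup_def lessThan_Suc sup_commute flip: sup_max)

lemma grid_sup_measurable_F:
  assumes g: "g \<in> borel_measurable borel" and h: "h > 0"
  shows "i \<le> Suc k \<Longrightarrow> grid_sup g h y i \<in> borel_measurable (F (real k * h))"
proof (induction i)
  case 0
  have "grid_sup g h y 0 = (\<lambda>_. 0)" by (simp add: grid_sup_0 fun_eq_iff)
  then show ?case by simp
next
  case (Suc i)
  have "X (real i * h) \<in> borel_measurable (F (real k * h))"
    using Suc.prems h by (intro X_measurable_F) (auto intro: mult_right_mono)
  then have [measurable]: "(\<lambda>\<omega>. g (y + X (real i * h) \<omega>)) \<in> borel_measurable (F (real k * h))"
    using g by measurable
  have [measurable]: "grid_sup g h y i \<in> borel_measurable (F (real k * h))" using Suc by simp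
  show ?case unfolding grid_sup_Suc[abs_def] by measurable
qed

lemma grid_sup_measurable[measurable]:
  assumes "g \<in> borel_measurable borel" "h > 0"
  shows "grid_sup g h y i \<in> borel_measurable M"
  by (rule measurable_F_M[OF _ grid_sup_measurable_F[OF assms, of i i]]) (use assms in auto)

text \<open>Conditioning at time \<open>i * h\<close> replaces one averaged step of the abstract
  walk by an actual increment of the process. The index \<open>i\<close> is generalised because the
  elapsed time grows while the number of remaining steps falls.\<close>

lemma nn_integral_walk_sup:
  assumes g[measurable]: "g \<in> borel_measurable borel" and h: "h > 0"
  shows "(\<integral>\<^sup>+\<omega>. walk_sup g (step_law h) k (grid_sup g h y i \<omega>) (y + X (real i * h) \<omega>) \<partial>M)
       = (\<integral>\<^sup>+\<omega>. grid_sup g h y (Suc (i + k)) \<omega> \<partial>M)"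
proof (induction k arbitrary: i)
  case 0
  show ?case by (simp add: grid_sup_Suc)
next
  case (Suc k)
  note [measurable] = measurable_walk_sup[OF g prob_space_step_law sets_step_law]
  let ?t = "real i * h"
  have t: "?t \<ge> 0" "h \<ge> 0" using h by auto
  have t': "real (Suc i) * h = ?t + h" by (simp add: algebra_simps)
  let ?Z = "\<lambda>\<omega>. (grid_sup g h y (Suc i) \<omega>, y + X ?t \<omega>)"
  have [measurable]: "grid_sup g h y (Suc i) \<in> borel_measurable (F ?t)" "X ?t \<in> borel_measurable (F ?t)"
    using grid_sup_measurable_F[OF g h] X_adapted[OF t(1)] by auto
  have Z: "?Z \<in> measurable (F ?t) (borel \<Otimes>\<^sub>M borel)" by measurable
  have "(\<integral>\<^sup>+\<omega>. walk_sup g (step_law h) (Suc k) (grid_sup g h y i \<omega>) (y + X ?t \<omega>) \<partial>M)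
      = (\<integral>\<^sup>+\<omega>. \<integral>\<^sup>+z. (\<lambda>p. walk_sup g (step_law h) k (fst (fst p)) (snd (fst p) + snd p)) (?Z \<omega>, z) \<partial>step_law h \<partial>M)"
    by (simp add: grid_sup_Suc)
  also have "\<dots> = (\<integral>\<^sup>+\<omega>. (\<lambda>p. walk_sup g (step_law h) k (fst (fst p)) (snd (fst p) + snd p)) (?Z \<omega>, X (?t + h) \<omega> - X ?t \<omega>) \<partial>M)"
    using t by (intro markov_step[OF t Z, symmetric]) measurable
  also have "\<dots> = (\<integral>\<^sup>+\<omega>. walk_sup g (step_law h) k (grid_sup g h y (Suc i) \<omega>) (y + X (real (Suc i) * h) \<omega>) \<partial>M)"
    unfolding t' by (simp add: algebra_simps)
  also have "\<dots> = (\<integral>\<^sup>+\<omega>. grid_sup g h y (Suc (Suc i + k)) \<omega> \<partial>M)" by (rule Suc.IH)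
  finally show ?case by simp
qed

lemma nn_integral_grid_sup:
  assumes g: "g \<in> borel_measurable borel" and h: "h > 0"
  shows "(\<integral>\<^sup>+\<omega>. grid_sup g h y (Suc k) \<omega> \<partial>M) = walk_sup g (step_law h) k 0 y"
proof -
  have "(\<integral>\<^sup>+\<omega>. walk_sup g (step_law h) k (grid_sup g h y 0 \<omega>) (y + X (real 0 * h) \<omega>) \<partial>M)
      = (\<integral>\<^sup>+\<omega>. walk_sup g (step_law h) k 0 y \<partial>M)"
    by (intro nn_integral_cong) (simp add: grid_sup_0 X_0)
  then show ?thesis using nn_integral_walk_sup[OF g h, of k y 0] by (simp add: emeasure_space_1)
qed

section \<open>Geometric killing of the grid walk\<close>

text \<open>The probability that \<open>er\<close> lies between \<open>k * h\<close> and
  \<open>(k + 1) * h\<close>, that is, the law of \<open>\<lfloor>er / h\<rfloor>\<close>.\<close>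

definition geo :: "real \<Rightarrow> nat \<Rightarrow> ennreal" where
  "geo h k = ennreal (1 - exp (- r * h)) * ennreal (exp (- r * h)) ^ k"

text \<open>Here the number of grid steps is \<open>\<lfloor>er / h\<rfloor>\<close>, which makes the one-step relation below exact, whereas
  convergence to the supremum needs \<open>\<lceil>er / h\<rceil>\<close>; the two differ by a term of size \<open>1 - exp (- r * h)\<close>.\<close>

definition grid_value :: "(real \<Rightarrow> ennreal) \<Rightarrow> real \<Rightarrow> real \<Rightarrow> ennreal" where
  "grid_value g h y = (\<Sum>k. geo h k * walk_sup g (step_law h) k 0 y)"

lemma suminf_geo: "h > 0 \<Longrightarrow> (\<Sum>k. geo h k) = 1"
proof -
  assume h: "h > 0"
  let ?q = "exp (- r * h)"
  have q: "0 \<le> ?q" "?q < 1" using h r_pos by auto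
  have "(\<lambda>k. (1 - ?q) * ?q ^ k) sums ((1 - ?q) * (1 / (1 - ?q)))"
    using q by (intro sums_mult geometric_sums) auto
  then have "(\<lambda>k. ennreal ((1 - ?q) * ?q ^ k)) sums ennreal ((1 - ?q) * (1 / (1 - ?q)))"
    using q by (subst sums_ennreal) auto
  moreover have "ennreal ((1 - ?q) * ?q ^ k) = geo h k" for k
    using q by (simp only: geo_def ennreal_mult ennreal_power diff_ge_0_iff_ge less_imp_le zero_le_power)
  moreover have "(1 - ?q) * (1 / (1 - ?q)) = 1" using q by auto
  ultimately show ?thesis by (simp only: sums_iff ennreal_1)
qed

lemma geo_Suc: "geo h (Suc k) = ennreal (exp (- r * h)) * geo h k"
  by (simp add: geo_def mult_ac)

lemma grid_value_measurable[measurable]: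
  assumes "g \<in> borel_measurable borel" "h > 0"
  shows "grid_value g h \<in> borel_measurable borel"
proof -
  have "h \<ge> 0" using assms by simp
  note [measurable] = measurable_walk_sup[OF assms(1) prob_space_step_law[OF this] sets_step_law]
  show ?thesis unfolding grid_value_def[abs_def] by measurable
qed

lemma grid_value_le:
  assumes g: "\<And>y. g y \<le> C" and h: "h > 0"
  shows "grid_value g h y \<le> C"
proof -
  have "grid_value g h y \<le> (\<Sum>k. geo h k * C)"
    unfolding grid_value_def using h
    by (intro suminf_le mult_left_mono walk_sup_le[OF prob_space_step_law g]) auto
  then show ?thesis by (simp add: ennreal_suminf_multc suminf_geo[OF h])
qed

text \<open>The first summand is killing before the first step; the second, by memorylessness of the
  geometric law, starts the clock afresh with one more step of the walk to make.\<close>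

lemma grid_value_split:
  "grid_value g h y = ennreal (1 - exp (- r * h)) * g y
     + ennreal (exp (- r * h)) * (\<Sum>k. geo h k * walk_sup g (step_law h) (Suc k) 0 y)"
proof -
  have "grid_value g h y = (\<Sum>k. geo h (Suc k) * walk_sup g (step_law h) (Suc k) 0 y) + geo h 0 * walk_sup g (step_law h) 0 0 y"
    unfolding grid_value_def by (subst suminf_offset[of _ 1]) (auto simp: add.commute)
  also have "(\<Sum>k. geo h (Suc k) * walk_sup g (step_law h) (Suc k) 0 y)
      = ennreal (exp (- r * h)) * (\<Sum>k. geo h k * walk_sup g (step_law h) (Suc k) 0 y)"
    unfolding geo_Suc mult.assoc by (rule ennreal_suminf_cmult)
  finally show ?thesis by (simp add: geo_def add.commute)
qed

text \<open>Starting the walk one step later forgets only the value \<open>g y\<close> at the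
  starting point. Dropping it can only lower the maximum, and it costs nothing when
  \<open>g y = 0\<close>.\<close>

lemma nn_integral_grid_value_step:
  assumes g[measurable]: "g \<in> borel_measurable borel" and h: "h > 0"
  shows "ennreal (exp (- r * h)) * (\<integral>\<^sup>+z. grid_value g h (y + z) \<partial>step_law h) \<le> grid_value g h y"
    and "g y = 0 \<Longrightarrow>
      ennreal (exp (- r * h)) * (\<integral>\<^sup>+z. grid_value g h (y + z) \<partial>step_law h) = grid_value g h y"
proof -
  note [measurable] = measurable_walk_sup[OF g prob_space_step_law sets_step_law]
  have h0: "h \<ge> 0" using h by simp
  have *: "(\<integral>\<^sup>+z. grid_value g h (y + z) \<partial>step_law h)
      = (\<Sum>k. geo h k * (\<integral>\<^sup>+z. walk_sup g (step_law h) k 0 (y + z) \<partial>step_law h))"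
    unfolding grid_value_def using h0 by (subst nn_integral_suminf) (auto simp: nn_integral_cmult)
  have "(\<Sum>k. geo h k * (\<integral>\<^sup>+z. walk_sup g (step_law h) k 0 (y + z) \<partial>step_law h))
      \<le> (\<Sum>k. geo h k * walk_sup g (step_law h) (Suc k) 0 y)"
    unfolding walk_sup.simps by (intro suminf_le mult_left_mono nn_integral_mono walk_sup_mono) auto
  then have "ennreal (exp (- r * h)) * (\<integral>\<^sup>+z. grid_value g h (y + z) \<partial>step_law h)
      \<le> ennreal (exp (- r * h)) * (\<Sum>k. geo h k * walk_sup g (step_law h) (Suc k) 0 y)"
    unfolding * by (intro mult_left_mono) auto
  also have "\<dots> \<le> grid_value g h y" unfolding grid_value_split by simp
  finally show "ennreal (exp (- r * h)) * (\<integral>\<^sup>+z. grid_value g h (y + z) \<partial>step_law h) \<le> grid_value g h y" .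
  assume "g y = 0"
  then show "ennreal (exp (- r * h)) * (\<integral>\<^sup>+z. grid_value g h (y + z) \<partial>step_law h) = grid_value g h y"
    unfolding * grid_value_split[of g h y] by simp
qed

lemma er_measurable[measurable]: "er \<in> borel_measurable M"
  using er_exp by (auto simp: distributed_def)

lemma AE_er_pos: "AE \<omega> in M. er \<omega> > 0"
proof -
  have "prob {\<omega>\<in>space M. 0 < er \<omega>} = 1"
    using exponential_distributedD_gt[OF er_exp order_refl r_pos] by simp
  from AE_prob_1[OF this] show ?thesis by eventually_elim simp
qed

lemma prob_er_interval:
  assumes "0 \<le> s" "s \<le> t"
  shows "prob {\<omega>\<in>space M. s < er \<omega> \<and> er \<omega> \<le> t} = exp (- r * s) - exp (- r * t)"
proof -
  have "{\<omega>\<in>space M. s < er \<omega> \<and> er \<omega> \<le> t} = {\<omega>\<in>space M. s < er \<omega>} - {\<omega>\<in>space M. t < er \<omega>}"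
    by auto
  also have "prob \<dots> = prob {\<omega>\<in>space M. s < er \<omega>} - prob {\<omega>\<in>space M. t < er \<omega>}"
    using assms by (intro finite_measure_Diff) auto
  finally show ?thesis
    using exponential_distributedD_gt[OF er_exp _ r_pos] assms by (simp add: mult.commute)
qed

abbreviation "path_algebra \<equiv> sigma (space M) {X t -` B \<inter> space M | t B. 0 \<le> t \<and> B \<in> sets borel}"

lemma X_path_algebra: "t \<ge> 0 \<Longrightarrow> X t \<in> borel_measurable path_algebra"
  by (intro measurableI) (auto intro!: sigma_sets.Basic simp: sets_measure_of_conv space_measure_of_conv)

lemma sets_path_algebra:
  "sets path_algebra = sigma_sets (space M) {X t -` B \<inter> space M | t B. 0 \<le> t \<and> B \<in> sets borel}"
  by (intro sets_measure_of) auto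

lemma grid_sup_path_algebra:
  assumes g: "g \<in> borel_measurable borel" and h: "h > 0"
  shows "grid_sup g h y i \<in> borel_measurable path_algebra"
proof (induction i)
  case 0
  have "grid_sup g h y 0 = (\<lambda>_. 0)" by (simp add: grid_sup_0 fun_eq_iff)
  then show ?case by simp
next
  case (Suc i)
  have "X (real i * h) \<in> borel_measurable path_algebra"
    using h by (intro X_path_algebra) auto
  then have [measurable]: "(\<lambda>\<omega>. g (y + X (real i * h) \<omega>)) \<in> borel_measurable path_algebra"
    using g by measurable
  note Suc[measurable]
  show ?case unfolding grid_sup_Suc[abs_def] by measurable
qed

text \<open>On the event \<open>\<lceil>er / h\<rceil> = k + 1\<close> the supremum runs over
  \<open>k + 2\<close> grid points, that is \<open>k + 1\<close> steps, and independence of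
  \<open>er\<close> from the path separates the weight \<open>geo h k\<close> from the walk. The
  result is the series in the second summand of \<open>grid_value_split\<close>.\<close>

lemma nn_integral_grid_sup_er:
  assumes g[measurable]: "g \<in> borel_measurable borel" and h: "h > 0"
  shows "(\<integral>\<^sup>+\<omega>. grid_sup g h y (Suc (nat \<lceil>er \<omega> / h\<rceil>)) \<omega> \<partial>M)
    = (\<Sum>k. geo h k * walk_sup g (step_law h) (Suc k) 0 y)"
proof -
  define E where "E k = {\<omega>\<in>space M. real k * h < er \<omega> \<and> er \<omega> \<le> real (Suc k) * h}" for k
  have E[measurable]: "E k \<in> sets M" for k by (simp add: E_def)
  have ceil: "nat \<lceil>er \<omega> / h\<rceil> = Suc k" if "\<omega> \<in> E k" for \<omega> k
  proof -
    have "real k < er \<omega> / h" "er \<omega> / h \<le> real (Suc k)" using that h by (auto simp: E_def field_simps)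
    then have "\<lceil>er \<omega> / h\<rceil> = int (Suc k)" by (intro ceiling_unique) auto
    then show ?thesis by simp
  qed
  have disj: "disjoint_family E"
    unfolding disjoint_family_on_def
  proof (intro ballI impI equals0I)
    fix m n \<omega> assume "m \<noteq> n" "\<omega> \<in> E m \<inter> E n"
    then show False using ceil[of \<omega> m] ceil[of \<omega> n] by simp
  qed
  have prob_E: "emeasure M (E k) = geo h k" for k
  proof -
    have "prob (E k) = (1 - exp (- r * h)) * exp (- r * h) ^ k"
    proof -
      have *: "exp (- r * (real j * h)) = exp (- r * h) ^ j" for j
        unfolding exp_of_nat_mult[symmetric] by (simp add: mult_ac)
      have "prob (E k) = exp (- r * (real k * h)) - exp (- r * (real (Suc k) * h))"
        unfolding E_def using h by (intro prob_er_interval mult_right_mono) auto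
      then show ?thesis unfolding * by (simp add: left_diff_distrib)
    qed
    then show ?thesis using h r_pos
      by (simp add: emeasure_eq_measure geo_def ennreal_mult ennreal_power)
  qed
  have "AE \<omega> in M. grid_sup g h y (Suc (nat \<lceil>er \<omega> / h\<rceil>)) \<omega>
      = (\<Sum>k. grid_sup g h y (Suc (Suc k)) \<omega> * indicator (E k) \<omega>)"
    using AE_er_pos AE_space
  proof eventually_elim
    fix \<omega> assume \<omega>: "er \<omega> > 0" "\<omega> \<in> space M"
    define k where "k = nat \<lceil>er \<omega> / h\<rceil> - 1"
    have 1: "0 < er \<omega> / h" using \<omega> h by simp
    then have 2: "int (Suc k) = \<lceil>er \<omega> / h\<rceil>" by (simp add: k_def)
    have "real_of_int (int (Suc k)) - 1 < er \<omega> / h" "er \<omega> / h \<le> real_of_int (int (Suc k))"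
      unfolding 2 by linarith+
    then have k: "\<omega> \<in> E k" using \<omega> h by (simp add: E_def field_simps)
    show "grid_sup g h y (Suc (nat \<lceil>er \<omega> / h\<rceil>)) \<omega> = (\<Sum>k. grid_sup g h y (Suc (Suc k)) \<omega> * indicator (E k) \<omega>)"
      using suminf_cmult_indicator[OF disj k, of "\<lambda>k. grid_sup g h y (Suc (Suc k)) \<omega>"] ceil[OF k] by simp
  qed
  then have "(\<integral>\<^sup>+\<omega>. grid_sup g h y (Suc (nat \<lceil>er \<omega> / h\<rceil>)) \<omega> \<partial>M)
      = (\<integral>\<^sup>+\<omega>. (\<Sum>k. grid_sup g h y (Suc (Suc k)) \<omega> * indicator (E k) \<omega>) \<partial>M)"
    by (rule nn_integral_cong_AE)
  also have "\<dots> = (\<Sum>k. \<integral>\<^sup>+\<omega>. grid_sup g h y (Suc (Suc k)) \<omega> * indicator (E k) \<omega> \<partial>M)"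
    using h by (intro nn_integral_suminf) measurable
  also have "\<dots> = (\<Sum>k. geo h k * walk_sup g (step_law h) (Suc k) 0 y)"
  proof (rule suminf_cong)
    fix k
    let ?f = "\<lambda>p. snd p * indicator {t. real k * h < t \<and> t \<le> real (Suc k) * h} (fst p) :: ennreal"
    have "(\<integral>\<^sup>+\<omega>. grid_sup g h y (Suc (Suc k)) \<omega> * indicator (E k) \<omega> \<partial>M)
        = (\<integral>\<^sup>+\<omega>. ?f (er \<omega>, grid_sup g h y (Suc (Suc k)) \<omega>) \<partial>M)"
      by (intro nn_integral_cong) (simp add: E_def indicator_def)
    also have "\<dots> = (\<integral>\<^sup>+\<omega>. \<integral>\<^sup>+\<omega>'. ?f (er \<omega>, grid_sup g h y (Suc (Suc k)) \<omega>') \<partial>M \<partial>M)"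
      using measurable_sets[OF grid_sup_path_algebra[OF g h]] h
      by (intro indep_set_nn_integral[OF er_indep, where N=borel and K=borel])
        (auto simp: sets_path_algebra space_measure_of_conv)
    also have "\<dots> = (\<integral>\<^sup>+\<omega>. walk_sup g (step_law h) (Suc k) 0 y * indicator (E k) \<omega> \<partial>M)"
      unfolding nn_integral_grid_sup[OF g h, symmetric] using h
      by (intro nn_integral_cong) (simp add: nn_integral_multc E_def indicator_def)
    also have "\<dots> = geo h k * walk_sup g (step_law h) (Suc k) 0 y"
      unfolding nn_integral_cmult_indicator[OF E] prob_E by (rule mult.commute)
    finally show "(\<integral>\<^sup>+\<omega>. grid_sup g h y (Suc (Suc k)) \<omega> * indicator (E k) \<omega> \<partial>M)
        = geo h k * walk_sup g (step_law h) (Suc k) 0 y" .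
  qed
  finally show ?thesis .
qed

lemma stopping_time_sets:
  assumes "stopping_time_ext F \<rho>" "t \<ge> 0"
  shows "{\<omega>\<in>space M. \<rho> \<omega> \<le> ereal t} \<in> sets (F t)"
  using assms space_F[of t] by (auto simp: stopping_time_ext_def)

lemma stopping_time_nonneg: "stopping_time_ext F \<rho> \<Longrightarrow> \<omega> \<in> space M \<Longrightarrow> \<rho> \<omega> \<ge> 0"
  using space_F[of 0] by (auto simp: stopping_time_ext_def)

subsection \<open>Optional sampling on a time grid\<close>

text \<open>The discounted value at step \<open>K\<close>, frozen from the first grid time at or
  after \<open>\<rho>\<close> on. In this recursive form the passage from \<open>K\<close> to
  \<open>K + 1\<close> changes it only where \<open>\<rho>\<close> exceeds \<open>K * h\<close>, an
  event known at time \<open>K * h\<close>.\<close>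

primrec sampled :: "(real \<Rightarrow> ennreal) \<Rightarrow> real \<Rightarrow> real \<Rightarrow> ('a \<Rightarrow> ereal) \<Rightarrow> nat \<Rightarrow> 'a \<Rightarrow> ennreal" where
  "sampled g h x \<rho> 0 \<omega> = grid_value g h (x + X 0 \<omega>)"
| "sampled g h x \<rho> (Suc K) \<omega> = (if \<rho> \<omega> \<le> ereal (real K * h) then sampled g h x \<rho> K \<omega>
     else ennreal (exp (- r * (real (Suc K) * h))) * grid_value g h (x + X (real (Suc K) * h) \<omega>))"

lemma sampled_measurable:
  assumes g[measurable]: "g \<in> borel_measurable borel" and h: "h > 0" and \<rho>: "stopping_time_ext F \<rho>"
  shows "sampled g h x \<rho> K \<in> borel_measurable M"
proof (induction K)
  case 0
  have "sampled g h x \<rho> 0 = (\<lambda>\<omega>. grid_value g h (x + X 0 \<omega>))" by auto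
  then show ?case using h by simp
next
  case (Suc K)
  note Suc[measurable]
  have "{\<omega>\<in>space M. \<rho> \<omega> \<le> ereal (real K * h)} \<in> sets M"
    using stopping_time_sets[OF \<rho>, of "real K * h"] sets_F[of "real K * h"] h by auto
  moreover have "X (real (Suc K) * h) \<in> borel_measurable M" using h by (intro X_measurable) simp
  then have "(\<lambda>\<omega>. grid_value g h (x + X (real (Suc K) * h) \<omega>)) \<in> borel_measurable M" using h by measurable
  ultimately have "(\<lambda>\<omega>. if \<rho> \<omega> \<le> ereal (real K * h) then sampled g h x \<rho> K \<omega>
     else ennreal (exp (- r * (real (Suc K) * h))) * grid_value g h (x + X (real (Suc K) * h) \<omega>)) \<in> borel_measurable M"
    by (intro measurable_If) auto
  moreover have "sampled g h x \<rho> (Suc K) = (\<lambda>\<omega>. if \<rho> \<omega> \<le> ereal (real K * h) then sampled g h x \<rho> K \<omega>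
     else ennreal (exp (- r * (real (Suc K) * h))) * grid_value g h (x + X (real (Suc K) * h) \<omega>))"
    by (simp add: fun_eq_iff)
  ultimately show ?case by simp
qed

lemma sampled_before:
  assumes h: "h > 0" and "\<not> \<rho> \<omega> \<le> ereal (real K * h)"
  shows "sampled g h x \<rho> K \<omega> = ennreal (exp (- r * (real K * h))) * grid_value g h (x + X (real K * h) \<omega>)"
proof (cases K)
  case (Suc m)
  have "\<not> \<rho> \<omega> \<le> ereal (real m * h)"
  proof
    assume "\<rho> \<omega> \<le> ereal (real m * h)"
    also have "\<dots> \<le> ereal (real K * h)" using h Suc by (simp add: mult_right_mono)
    finally show False using assms by simp
  qed
  then show ?thesis using Suc by simp
qed simp

lemma nn_integral_sampled_Suc:
  assumes g[measurable]: "g \<in> borel_measurable borel" and h: "h > 0" and \<rho>: "stopping_time_ext F \<rho>"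
  shows "(\<integral>\<^sup>+\<omega>. sampled g h x \<rho> (Suc K) \<omega> \<partial>M) \<le> (\<integral>\<^sup>+\<omega>. sampled g h x \<rho> K \<omega> \<partial>M)"
    and "(\<And>\<omega>. \<omega> \<in> space M \<Longrightarrow> \<not> \<rho> \<omega> \<le> ereal (real K * h) \<Longrightarrow> g (x + X (real K * h) \<omega>) = 0) \<Longrightarrow>
      (\<integral>\<^sup>+\<omega>. sampled g h x \<rho> (Suc K) \<omega> \<partial>M) = (\<integral>\<^sup>+\<omega>. sampled g h x \<rho> K \<omega> \<partial>M)"
proof -
  let ?t = "real K * h"
  define A where "A = {\<omega>\<in>space M. \<rho> \<omega> \<le> ereal ?t}"
  have t: "?t \<ge> 0" "h \<ge> 0" using h by auto
  have t': "real (Suc K) * h = ?t + h" by (simp add: algebra_simps)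
  have AF[measurable]: "A \<in> sets (F ?t)" unfolding A_def by (rule stopping_time_sets[OF \<rho> t(1)])
  then have AM[measurable]: "A \<in> sets M" using sets_F[OF t(1)] by auto
  have [measurable]: "grid_value g h \<in> borel_measurable borel" using h by measurable
  have [measurable]: "X ?t \<in> borel_measurable M" "X (?t + h) \<in> borel_measurable M" using t by auto
  have [measurable]: "sampled g h x \<rho> K \<in> borel_measurable M" by (rule sampled_measurable[OF g h \<rho>])
  let ?c = "ennreal (exp (- r * ?t))" and ?c' = "ennreal (exp (- r * (?t + h)))"
  have c': "?c' = ?c * ennreal (exp (- r * h))"
    by (simp add: ennreal_mult[symmetric] exp_add[symmetric] algebra_simps)
  let ?B = "\<lambda>\<omega>. indicator (space M - A) \<omega> :: ennreal"
  let ?I = "\<integral>\<^sup>+\<omega>. sampled g h x \<rho> K \<omega> * indicator A \<omega> \<partial>M"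
  have "(\<integral>\<^sup>+\<omega>. sampled g h x \<rho> (Suc K) \<omega> \<partial>M)
      = (\<integral>\<^sup>+\<omega>. sampled g h x \<rho> K \<omega> * indicator A \<omega> + ?c' * (?B \<omega> * grid_value g h (x + X (?t + h) \<omega>)) \<partial>M)"
    by (intro nn_integral_cong) (simp only: sampled.simps t', auto simp: A_def indicator_def)
  also have "\<dots> = ?I + ?c' * (\<integral>\<^sup>+\<omega>. ?B \<omega> * grid_value g h (x + X (?t + h) \<omega>) \<partial>M)"
    by (simp add: nn_integral_add nn_integral_cmult)
  also have "(\<integral>\<^sup>+\<omega>. ?B \<omega> * grid_value g h (x + X (?t + h) \<omega>) \<partial>M)
     = (\<integral>\<^sup>+\<omega>. (\<lambda>p. fst (fst p) * grid_value g h (snd (fst p) + snd p)) ((?B \<omega>, x + X ?t \<omega>), X (?t + h) \<omega> - X ?t \<omega>) \<partial>M)"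
    by (intro nn_integral_cong) (simp add: algebra_simps)
  \<comment> \<open>The indicator of not yet having stopped is measurable at the present time, so it
    travels through the Markov step as a component of \<open>Z\<close>.\<close>
  also have "\<dots> = (\<integral>\<^sup>+\<omega>. \<integral>\<^sup>+z. (\<lambda>p. fst (fst p) * grid_value g h (snd (fst p) + snd p)) ((?B \<omega>, x + X ?t \<omega>), z) \<partial>step_law h \<partial>M)"
  proof (rule markov_step[OF t])
    note X_adapted[OF t(1), measurable]
    show "(\<lambda>\<omega>. (?B \<omega>, x + X ?t \<omega>)) \<in> measurable (F ?t) (borel \<Otimes>\<^sub>M borel)"
      unfolding space_F[OF t(1), symmetric] by measurable
  qed measurable
  also have "\<dots> = (\<integral>\<^sup>+\<omega>. ?B \<omega> * (\<integral>\<^sup>+z. grid_value g h (x + X ?t \<omega> + z) \<partial>step_law h) \<partial>M)"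
    by (simp add: nn_integral_cmult)
  finally have 1: "(\<integral>\<^sup>+\<omega>. sampled g h x \<rho> (Suc K) \<omega> \<partial>M)
     = ?I + ?c * (ennreal (exp (- r * h)) * (\<integral>\<^sup>+\<omega>. ?B \<omega> * (\<integral>\<^sup>+z. grid_value g h (x + X ?t \<omega> + z) \<partial>step_law h) \<partial>M))"
    unfolding c' by (simp add: mult.assoc)
  interpret step: prob_space "step_law h" by (rule prob_space_step_law[OF t(2)])
  have [measurable]: "(\<lambda>\<omega>. \<integral>\<^sup>+z. grid_value g h (x + X ?t \<omega> + z) \<partial>step_law h) \<in> borel_measurable M"
    by measurable
  have 2: "ennreal (exp (- r * h)) * (\<integral>\<^sup>+\<omega>. ?B \<omega> * (\<integral>\<^sup>+z. grid_value g h (x + X ?t \<omega> + z) \<partial>step_law h) \<partial>M)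
      = (\<integral>\<^sup>+\<omega>. ?B \<omega> * (ennreal (exp (- r * h)) * (\<integral>\<^sup>+z. grid_value g h (x + X ?t \<omega> + z) \<partial>step_law h)) \<partial>M)"
    by (subst nn_integral_cmult[symmetric], measurable) (simp add: mult.left_commute)
  have "(\<integral>\<^sup>+\<omega>. sampled g h x \<rho> K \<omega> \<partial>M)
      = (\<integral>\<^sup>+\<omega>. sampled g h x \<rho> K \<omega> * indicator A \<omega> + ?c * (?B \<omega> * grid_value g h (x + X ?t \<omega>)) \<partial>M)"
    by (intro nn_integral_cong) (auto simp: A_def indicator_def sampled_before[OF h])
  also have "\<dots> = ?I + ?c * (\<integral>\<^sup>+\<omega>. ?B \<omega> * grid_value g h (x + X ?t \<omega>) \<partial>M)"
    by (simp add: nn_integral_add nn_integral_cmult)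
  finally have 3: "(\<integral>\<^sup>+\<omega>. sampled g h x \<rho> K \<omega> \<partial>M) = \<dots>" .
  show "(\<integral>\<^sup>+\<omega>. sampled g h x \<rho> (Suc K) \<omega> \<partial>M) \<le> (\<integral>\<^sup>+\<omega>. sampled g h x \<rho> K \<omega> \<partial>M)"
    unfolding 1 2 3 using nn_integral_grid_value_step(1)[OF g h]
    by (intro add_left_mono mult_left_mono nn_integral_mono) auto
  assume "\<And>\<omega>. \<omega> \<in> space M \<Longrightarrow> \<not> \<rho> \<omega> \<le> ereal (real K * h) \<Longrightarrow> g (x + X (real K * h) \<omega>) = 0"
  then have "(\<integral>\<^sup>+\<omega>. ?B \<omega> * (ennreal (exp (- r * h)) * (\<integral>\<^sup>+z. grid_value g h (x + X ?t \<omega> + z) \<partial>step_law h)) \<partial>M)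
      = (\<integral>\<^sup>+\<omega>. ?B \<omega> * grid_value g h (x + X ?t \<omega>) \<partial>M)"
    using nn_integral_grid_value_step(2)[OF g h]
    by (intro nn_integral_cong) (auto simp: A_def indicator_def)
  then show "(\<integral>\<^sup>+\<omega>. sampled g h x \<rho> (Suc K) \<omega> \<partial>M) = (\<integral>\<^sup>+\<omega>. sampled g h x \<rho> K \<omega> \<partial>M)"
    unfolding 1 2 3 by simp
qed

text \<open>Rounding up puts the grid time at or after \<open>t\<close>, where right-continuity of
  the paths applies as \<open>h\<close> tends to \<open>0\<close>.\<close>

definition grid_up :: "real \<Rightarrow> real \<Rightarrow> real" where
  "grid_up h t = real (nat \<lceil>t / h\<rceil>) * h"

lemma grid_up: 
  assumes "h > 0" "t \<ge> 0"
  shows "t \<le> grid_up h t" "grid_up h t \<le> t + h"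
proof -
  have 0: "real (nat \<lceil>t / h\<rceil>) = real_of_int \<lceil>t / h\<rceil>" using assms by simp
  have "t = (t / h) * h" using assms by simp
  also have "\<dots> \<le> grid_up h t" unfolding grid_up_def 0 using assms by (intro mult_right_mono) auto
  finally show "t \<le> grid_up h t" .
  have "grid_up h t \<le> (t / h + 1) * h" unfolding grid_up_def 0 using assms by (intro mult_right_mono) linarith+
  also have "\<dots> = t + h" using assms by (simp add: field_simps)
  finally show "grid_up h t \<le> t + h" .
qed

definition grid_stopped :: "(real \<Rightarrow> ennreal) \<Rightarrow> real \<Rightarrow> real \<Rightarrow> ('a \<Rightarrow> ereal) \<Rightarrow> 'a \<Rightarrow> ennreal" where
  "grid_stopped g h x \<rho> \<omega> = (if \<rho> \<omega> = \<infinity> then 0 else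
     ennreal (exp (- r * grid_up h (real_of_ereal (\<rho> \<omega>)))) *
     grid_value g h (x + X (grid_up h (real_of_ereal (\<rho> \<omega>))) \<omega>))"

lemma sampled_after:
  assumes h: "h > 0" and \<rho>: "\<rho> \<omega> = ereal t" "t \<ge> 0" and K: "nat \<lceil>t / h\<rceil> \<le> K"
  shows "sampled g h x \<rho> K \<omega> = grid_stopped g h x \<rho> \<omega>"
  using K
proof (induction K rule: dec_induct)
  case base
  show ?case
  proof (cases "nat \<lceil>t / h\<rceil>")
    case 0
    then show ?thesis using \<rho> by (simp add: grid_stopped_def grid_up_def)
  next
    case (Suc m)
    \<comment> \<open>The grid time preceding the rounded one is still strictly before
      \<open>t\<close>, so the recursion takes its second branch.\<close>
    then have "\<lceil>t / h\<rceil> = int m + 1" by linarith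
    then have "real m < t / h" by linarith
    then have "\<not> t \<le> real m * h" using h by (simp add: field_simps)
    then show ?thesis unfolding Suc using \<rho> Suc by (simp add: grid_stopped_def grid_up_def)
  qed
next
  case (step K)
  have "t \<le> grid_up h t" by (rule grid_up[OF h \<rho>(2)])
  also have "\<dots> \<le> real K * h" unfolding grid_up_def using step h by (intro mult_right_mono) auto
  finally show ?case using step \<rho> by simp
qed

lemma sampled_tendsto:
  assumes g: "\<And>y. g y \<le> C" and C: "C < \<infinity>" and h: "h > 0"
    and \<rho>: "stopping_time_ext F \<rho>" and \<omega>: "\<omega> \<in> space M"
  shows "(\<lambda>K. sampled g h x \<rho> K \<omega>) \<longlonglongrightarrow> grid_stopped g h x \<rho> \<omega>"
proof (cases "\<rho> \<omega>")
  case (real t)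
  have t: "t \<ge> 0" using stopping_time_nonneg[OF \<rho> \<omega>] real by simp
  have "eventually (\<lambda>K. sampled g h x \<rho> K \<omega> = grid_stopped g h x \<rho> \<omega>) sequentially"
    using eventually_ge_at_top[of "nat \<lceil>t / h\<rceil>"]
    by eventually_elim (rule sampled_after[where \<rho>=\<rho> and \<omega>=\<omega>, OF h real t])
  then show ?thesis by (rule tendsto_eventually)
next
  case PInf
  \<comment> \<open>If \<open>\<rho>\<close> is infinite the value is never frozen, and as
    \<open>g\<close> is bounded the discount factor sends it to \<open>0\<close>. This agrees with
    the convention for payoffs at infinity.\<close>
  have "(\<lambda>K. ennreal (exp (- r * h) ^ K) * C) \<longlonglongrightarrow> ennreal 0 * C"
  proof (intro tendsto_mult_ennreal tendsto_ennrealI tendsto_const)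
    show "(\<lambda>K. exp (- r * h) ^ K) \<longlonglongrightarrow> 0" using h r_pos by (intro LIMSEQ_realpow_zero) auto
  qed (use C in auto)
  then have lim: "(\<lambda>K. ennreal (exp (- r * h) ^ K) * C) \<longlonglongrightarrow> 0" by simp
  have "sampled g h x \<rho> K \<omega> \<le> ennreal (exp (- r * h) ^ K) * C" for K
  proof -
    have "sampled g h x \<rho> K \<omega> = ennreal (exp (- r * (real K * h))) * grid_value g h (x + X (real K * h) \<omega>)"
      by (rule sampled_before[OF h]) (simp add: PInf)
    also have "exp (- r * (real K * h)) = exp (- r * h) ^ K"
      unfolding exp_of_nat_mult[symmetric] by (simp add: mult_ac)
    finally show ?thesis using grid_value_le[of g, OF g h] by (simp add: mult_left_mono)
  qed
  then have "(\<lambda>K. sampled g h x \<rho> K \<omega>) \<longlonglongrightarrow> 0"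
    by (intro tendsto_sandwich[OF _ _ tendsto_const lim]) auto
  then show ?thesis using PInf by (simp add: grid_stopped_def)
next
  case MInf
  then show ?thesis using stopping_time_nonneg[OF \<rho> \<omega>] by simp
qed

lemma grid_stopped_le:
  assumes g: "\<And>y. g y \<le> C" and h: "h > 0" and \<rho>: "stopping_time_ext F \<rho>" and \<omega>: "\<omega> \<in> space M"
  shows "grid_stopped g h x \<rho> \<omega> \<le> C"
proof (cases "\<rho> \<omega> = \<infinity>")
  case False
  have "exp (- r * grid_up h (real_of_ereal (\<rho> \<omega>))) \<le> 1"
    using r_pos h by (simp add: grid_up_def)
  then have "grid_stopped g h x \<rho> \<omega> \<le> ennreal 1 * C"
    using False grid_value_le[of g, OF g h] unfolding grid_stopped_def
    by (simp del: ennreal_1) (intro mult_mono ennreal_leI, auto)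
  then show ?thesis by simp
qed (simp add: grid_stopped_def)

lemma sampled_le:
  assumes g: "\<And>y. g y \<le> C" and h: "h > 0"
  shows "sampled g h x \<rho> K \<omega> \<le> C"
proof (induction K)
  case (Suc K)
  have "exp (- r * (real (Suc K) * h)) \<le> 1" using r_pos h by simp
  then have "ennreal (exp (- r * (real (Suc K) * h))) * grid_value g h (x + X (real (Suc K) * h) \<omega>) \<le> ennreal 1 * C"
    using grid_value_le[of g, OF g h] by (intro mult_mono ennreal_leI) auto
  then show ?case using Suc by simp
qed (simp add: grid_value_le[of g, OF g h])

lemma grid_stopped_measurable:
  assumes g: "g \<in> borel_measurable borel" "\<And>y. g y \<le> C" and C: "C < \<infinity>" and h: "h > 0" and \<rho>: "stopping_time_ext F \<rho>"
  shows "grid_stopped g h x \<rho> \<in> borel_measurable M"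
  by (rule borel_measurable_LIMSEQ_order[OF sampled_tendsto[of g, OF g(2) C h \<rho>] sampled_measurable[OF g(1) h \<rho>]])

lemma grid_optional_sampling:
  assumes g: "g \<in> borel_measurable borel" "\<And>y. g y \<le> C" and C: "C < \<infinity>" and h: "h > 0" and \<rho>: "stopping_time_ext F \<rho>"
  shows "(\<integral>\<^sup>+\<omega>. grid_stopped g h x \<rho> \<omega> \<partial>M) \<le> grid_value g h x"
    and "(\<And>\<omega> t. \<omega> \<in> space M \<Longrightarrow> t \<ge> 0 \<Longrightarrow> ereal t < \<rho> \<omega> \<Longrightarrow> g (x + X t \<omega>) = 0) \<Longrightarrow>
      (\<integral>\<^sup>+\<omega>. grid_stopped g h x \<rho> \<omega> \<partial>M) = grid_value g h x"
proof -
  have lim: "(\<lambda>K. \<integral>\<^sup>+\<omega>. sampled g h x \<rho> K \<omega> \<partial>M) \<longlonglongrightarrow> (\<integral>\<^sup>+\<omega>. grid_stopped g h x \<rho> \<omega> \<partial>M)"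
  proof (rule nn_integral_dominated_convergence[where w="\<lambda>_. C"])
    show "(\<integral>\<^sup>+\<omega>. C \<partial>M) < \<infinity>" using C by (simp add: emeasure_space_1)
  qed (use sampled_measurable[OF g(1) h \<rho>] grid_stopped_measurable[OF g C h \<rho>]
        sampled_tendsto[of g, OF g(2) C h \<rho>] sampled_le[of g, OF g(2) h] in auto)
  have 0: "(\<integral>\<^sup>+\<omega>. sampled g h x \<rho> 0 \<omega> \<partial>M) = grid_value g h x"
  proof -
    have "(\<integral>\<^sup>+\<omega>. sampled g h x \<rho> 0 \<omega> \<partial>M) = (\<integral>\<^sup>+\<omega>. grid_value g h x \<partial>M)"
      by (intro nn_integral_cong) (simp add: X_0)
    then show ?thesis by (simp add: emeasure_space_1)
  qed
  have "(\<integral>\<^sup>+\<omega>. sampled g h x \<rho> K \<omega> \<partial>M) \<le> grid_value g h x" for K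
    by (induction K) (use 0 nn_integral_sampled_Suc(1)[OF g(1) h \<rho>, of x] order_trans in \<open>auto simp del: sampled.simps\<close>)
  then show "(\<integral>\<^sup>+\<omega>. grid_stopped g h x \<rho> \<omega> \<partial>M) \<le> grid_value g h x"
    by (intro LIMSEQ_le_const2[OF lim]) auto
  assume *: "\<And>\<omega> t. \<omega> \<in> space M \<Longrightarrow> t \<ge> 0 \<Longrightarrow> ereal t < \<rho> \<omega> \<Longrightarrow> g (x + X t \<omega>) = 0"
  have "(\<integral>\<^sup>+\<omega>. sampled g h x \<rho> K \<omega> \<partial>M) = grid_value g h x" for K
  proof (induction K)
    case (Suc K)
    have "(\<integral>\<^sup>+\<omega>. sampled g h x \<rho> (Suc K) \<omega> \<partial>M) = (\<integral>\<^sup>+\<omega>. sampled g h x \<rho> K \<omega> \<partial>M)"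
      by (rule nn_integral_sampled_Suc(2)[OF g(1) h \<rho>]) (use * h in \<open>auto simp: not_le\<close>)
    then show ?case using Suc by simp
  qed (rule 0)
  then show "(\<integral>\<^sup>+\<omega>. grid_stopped g h x \<rho> \<omega> \<partial>M) = grid_value g h x"
    using LIMSEQ_unique[OF lim] by simp
qed

subsection \<open>Optional sampling in continuous time\<close>

text \<open>The truncation at \<open>0\<close> only matters on the null set where \<open>er\<close> is negative and the supremum is over
  the empty set.\<close>

definition Smax :: "'a \<Rightarrow> real" where
  "Smax \<omega> = max 0 (Sup ((\<lambda>t. X t \<omega>) ` {0..er \<omega>}))"

lemma X_le_Sup: "\<omega> \<in> space M \<Longrightarrow> 0 \<le> t \<Longrightarrow> t \<le> er \<omega> \<Longrightarrow> X t \<omega> \<le> Sup ((\<lambda>t. X t \<omega>) ` {0..er \<omega>})"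
  by (intro cSUP_upper X_bdd_above) auto

lemma Smax_eq: "\<omega> \<in> space M \<Longrightarrow> er \<omega> \<ge> 0 \<Longrightarrow> Smax \<omega> = Sup ((\<lambda>t. X t \<omega>) ` {0..er \<omega>})"
  using X_le_Sup[of \<omega> 0] X_0[of \<omega>] by (simp add: Smax_def)

text \<open>\<open>measure\<close> returns \<open>0\<close> on sets that are not measurable, so the
  strictly positive tail in \<open>law_S\<close> certifies measurability of the level sets for
  \<open>y \<ge> 0\<close>. For \<open>y < 0\<close> the truncation makes the level set the whole
  space.\<close>

lemma Smax_measurable[measurable]: "Smax \<in> borel_measurable M"
  unfolding borel_measurable_iff_greater
proof
  fix y :: real
  show "{\<omega>\<in>space M. y < Smax \<omega>} \<in> sets M"
  proof (cases "y \<ge> 0")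
    case True
    then have "{\<omega>\<in>space M. y < Smax \<omega>} = {\<omega>\<in>space M. Sup ((\<lambda>t. X t \<omega>) ` {0..er \<omega>}) > y}"
      by (auto simp: Smax_def)
    moreover have "measure M {\<omega>\<in>space M. Sup ((\<lambda>t. X t \<omega>) ` {0..er \<omega>}) > y} \<noteq> 0"
      using law_S True q by simp
    ultimately show ?thesis using measure_notin_sets by metis
  next
    case False
    then have "{\<omega>\<in>space M. y < Smax \<omega>} = space M" by (auto simp: Smax_def)
    then show ?thesis by simp
  qed
qed

lemma prob_Smax_gt: "y \<ge> 0 \<Longrightarrow> prob {\<omega>\<in>space M. y < Smax \<omega>} = (1 - q) * exp (- b * y)"
proof -
  assume y: "y \<ge> 0"
  then have "{\<omega>\<in>space M. y < Smax \<omega>} = {\<omega>\<in>space M. Sup ((\<lambda>t. X t \<omega>) ` {0..er \<omega>}) > y}"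
    by (auto simp: Smax_def)
  then show ?thesis using law_S y by simp
qed

lemma grid_up_tendsto:
  assumes t: "t \<ge> 0" and h: "\<And>n. h n > 0" "h \<longlonglongrightarrow> 0"
  shows "(\<lambda>n. grid_up (h n) t) \<longlonglongrightarrow> t"
proof (rule tendsto_sandwich[OF _ _ tendsto_const])
  show "(\<lambda>n. t + h n) \<longlonglongrightarrow> t" using tendsto_add[OF tendsto_const h(2), of t] by simp
qed (use grid_up[OF h(1) t] in auto)

lemma X_grid_up_tendsto:
  assumes "\<omega> \<in> space M" and t: "t \<ge> 0" and h: "\<And>n. h n > 0" "h \<longlonglongrightarrow> 0"
  shows "(\<lambda>n. X (grid_up (h n) t) \<omega>) \<longlonglongrightarrow> X t \<omega>"
  by (rule X_right_cont_seq[OF assms(1) t grid_up_tendsto[OF t h] grid_up(1)[OF h(1) t]])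

text \<open>The grid maximum eventually exceeds any level below the supremum, because a time in
  \<open>{0..er \<omega>}\<close> can be rounded up within the grid; this is where the ceiling
  matters. Conversely only the last grid time can lie beyond \<open>er \<omega>\<close>, and there
  right-continuity at \<open>er \<omega>\<close> controls the path.\<close>

lemma grid_sup_tendsto:
  fixes g :: "real \<Rightarrow> real"
  assumes \<omega>: "\<omega> \<in> space M" "er \<omega> > 0" and h: "\<And>n. h n > 0" "h \<longlonglongrightarrow> 0"
    and g: "mono g" "continuous_on UNIV g" and y: "y \<longlonglongrightarrow> y0"
  shows "(\<lambda>n. grid_sup (\<lambda>z. ennreal (g z)) (h n) (y n) (Suc (nat \<lceil>er \<omega> / h n\<rceil>)) \<omega>)
    \<longlonglongrightarrow> ennreal (g (y0 + Smax \<omega>))"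
proof -
  define N where "N n = nat \<lceil>er \<omega> / h n\<rceil>" for n
  define m where "m n = Max ((\<lambda>j. X (real j * h n) \<omega>) ` {..N n})" for n
  have S: "Smax \<omega> = Sup ((\<lambda>t. X t \<omega>) ` {0..er \<omega>})" using \<omega> by (simp add: Smax_eq)
  have "m \<longlonglongrightarrow> Smax \<omega>"
  proof (rule order_tendstoI)
    fix c assume "c < Smax \<omega>"
    then obtain t where t: "t \<in> {0..er \<omega>}" "c < X t \<omega>"
      unfolding S using \<omega> by (subst (asm) less_cSUP_iff[OF _ X_bdd_above]) auto
    have "eventually (\<lambda>n. c < X (grid_up (h n) t) \<omega>) sequentially"
      using X_grid_up_tendsto[OF \<omega>(1) _ h, of t] t by (intro order_tendstoD(1)) auto
    then show "eventually (\<lambda>n. c < m n) sequentially"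
    proof eventually_elim
      fix n assume c: "c < X (grid_up (h n) t) \<omega>"
      have "nat \<lceil>t / h n\<rceil> \<le> N n"
        unfolding N_def using t h(1)[of n] by (intro nat_mono ceiling_mono divide_right_mono) auto
      then have "X (grid_up (h n) t) \<omega> \<le> m n"
        unfolding m_def grid_up_def by (intro Max_ge) auto
      then show "c < m n" using c by simp
    qed
  next
    fix c assume c: "Smax \<omega> < c"
    have "X (er \<omega>) \<omega> \<le> Smax \<omega>" unfolding S using \<omega> by (intro X_le_Sup) auto
    then have "eventually (\<lambda>n. X (grid_up (h n) (er \<omega>)) \<omega> < c) sequentially"
      using \<omega> c by (intro order_tendstoD(2)[OF X_grid_up_tendsto[OF \<omega>(1) _ h]]) auto
    then show "eventually (\<lambda>n. m n < c) sequentially"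
    proof eventually_elim
      fix n assume last: "X (grid_up (h n) (er \<omega>)) \<omega> < c"
      have "X (real j * h n) \<omega> < c" if j: "j \<le> N n" for j
      proof (cases "j = N n")
        case True
        then show ?thesis using last by (simp add: grid_up_def N_def)
      next
        case False
        then have "int j < \<lceil>er \<omega> / h n\<rceil>" using j by (auto simp: N_def)
        then have "real j < er \<omega> / h n" by linarith
        then have "real j * h n \<le> er \<omega>" using h(1)[of n] by (simp add: field_simps)
        then have "X (real j * h n) \<omega> \<le> Smax \<omega>" unfolding S using \<omega> h(1)[of n] by (intro X_le_Sup) auto
        then show ?thesis using c by simp
      qed
      then show "m n < c" unfolding m_def by (subst Max_less_iff) auto
    qed
  qed
  then have "(\<lambda>n. ennreal (g (y n + m n))) \<longlonglongrightarrow> ennreal (g (y0 + Smax \<omega>))"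
    using y g(2) by (intro tendsto_ennrealI continuous_on_tendsto_compose[OF g(2)] tendsto_add) auto
  moreover have "grid_sup (\<lambda>z. ennreal (g z)) (h n) (y n) (Suc (N n)) \<omega> = ennreal (g (y n + m n))" for n
    unfolding grid_sup_def
  proof (rule antisym)
    show "(SUP j\<in>{..<Suc (N n)}. ennreal (g (y n + X (real j * h n) \<omega>))) \<le> ennreal (g (y n + m n))"
      unfolding m_def
      by (intro SUP_least ennreal_leI monoD[OF g(1)] add_left_mono Max_ge) auto
    have "m n \<in> (\<lambda>j. X (real j * h n) \<omega>) ` {..N n}" unfolding m_def by (intro Max_in) auto
    then obtain j where "j \<le> N n" "m n = X (real j * h n) \<omega>" by auto
    then show "ennreal (g (y n + m n)) \<le> (SUP j\<in>{..<Suc (N n)}. ennreal (g (y n + X (real j * h n) \<omega>)))"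
      by (intro SUP_upper2[of j]) auto
  qed
  ultimately show ?thesis unfolding N_def by simp
qed

definition sup_value :: "(real \<Rightarrow> real) \<Rightarrow> real \<Rightarrow> ennreal" where
  "sup_value g y = (\<integral>\<^sup>+\<omega>. ennreal (g (y + Smax \<omega>)) \<partial>M)"

lemma sup_value_le: "(\<And>y. g y \<le> C) \<Longrightarrow> sup_value g y \<le> ennreal C"
proof -
  assume "\<And>y. g y \<le> C"
  then have "sup_value g y \<le> (\<integral>\<^sup>+\<omega>. ennreal C \<partial>M)"
    unfolding sup_value_def by (intro nn_integral_mono ennreal_leI)
  then show ?thesis by (simp add: emeasure_space_1)
qed

text \<open>The starting points move with the mesh because optional sampling evaluates
  \<open>grid_value\<close> at the position at the rounded-up time. In
  \<open>grid_value_split\<close> the weight of the extra term \<open>g y\<close> tends to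
  \<open>0\<close>, which leaves the version with \<open>\<lceil>er / h\<rceil>\<close>
  steps.\<close>

lemma grid_value_tendsto:
  fixes g :: "real \<Rightarrow> real"
  assumes h: "\<And>n. h n > 0" "h \<longlonglongrightarrow> 0"
    and g: "mono g" "continuous_on UNIV g" "\<And>y. g y \<le> C" and y: "y \<longlonglongrightarrow> y0"
  shows "(\<lambda>n. grid_value (\<lambda>z. ennreal (g z)) (h n) (y n)) \<longlonglongrightarrow> sup_value g y0"
proof -
  let ?g = "\<lambda>z. ennreal (g z)"
  have [measurable]: "g \<in> borel_measurable borel" using g(2) by (rule borel_measurable_continuous_onI)
  define K where "K n = (\<Sum>k. geo (h n) k * walk_sup ?g (step_law (h n)) (Suc k) 0 (y n))" for n
  have K: "K n = (\<integral>\<^sup>+\<omega>. grid_sup ?g (h n) (y n) (Suc (nat \<lceil>er \<omega> / h n\<rceil>)) \<omega> \<partial>M)" for n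
    unfolding K_def by (rule nn_integral_grid_sup_er[symmetric]) (use h in auto)
  have "K \<longlonglongrightarrow> sup_value g y0"
    unfolding K[abs_def] sup_value_def
  proof (rule nn_integral_dominated_convergence[where w="\<lambda>_. ennreal C"])
    show "(\<lambda>\<omega>. grid_sup ?g (h n) (y n) (Suc (nat \<lceil>er \<omega> / h n\<rceil>)) \<omega>) \<in> borel_measurable M" for n
    proof (rule measurable_compose_countable[where f="\<lambda>i \<omega>. grid_sup ?g (h n) (y n) (Suc i) \<omega>"])
      show "(\<lambda>\<omega>. nat \<lceil>er \<omega> / h n\<rceil>) \<in> measurable M (count_space UNIV)" by measurable
    qed (use h in auto)
    show "(\<integral>\<^sup>+\<omega>. ennreal C \<partial>M) < \<infinity>" by (simp add: emeasure_space_1)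
    show "AE \<omega> in M. grid_sup ?g (h n) (y n) (Suc (nat \<lceil>er \<omega> / h n\<rceil>)) \<omega> \<le> ennreal C" for n
      unfolding grid_sup_def using g(3) by (intro AE_I2 SUP_least ennreal_leI)
    show "AE \<omega> in M. (\<lambda>n. grid_sup ?g (h n) (y n) (Suc (nat \<lceil>er \<omega> / h n\<rceil>)) \<omega>) \<longlonglongrightarrow> ennreal (g (y0 + Smax \<omega>))"
      using AE_er_pos AE_space by eventually_elim (rule grid_sup_tendsto[OF _ _ h g(1,2) y])
  qed measurable
  moreover have "sup_value g y0 < \<top>"
    using sup_value_le[of g C y0] g(3) by (auto intro: le_less_trans)
  moreover have e: "(\<lambda>n. exp (- r * h n)) \<longlonglongrightarrow> 1"
    using tendsto_exp[OF tendsto_mult[OF tendsto_const h(2), of "- r"]] by simp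
  moreover have "(\<lambda>n. g (y n)) \<longlonglongrightarrow> g y0"
    using y by (intro continuous_on_tendsto_compose[OF g(2)]) auto
  ultimately have "(\<lambda>n. ennreal (1 - exp (- r * h n)) * ?g (y n) + ennreal (exp (- r * h n)) * K n)
      \<longlonglongrightarrow> ennreal (1 - 1) * ?g y0 + ennreal 1 * sup_value g y0"
    by (intro tendsto_add tendsto_mult_ennreal tendsto_ennrealI tendsto_diff tendsto_const) auto
  then show ?thesis unfolding grid_value_split K_def by simp
qed

definition disc_value :: "(real \<Rightarrow> ennreal) \<Rightarrow> real \<Rightarrow> ('a \<Rightarrow> ereal) \<Rightarrow> 'a \<Rightarrow> ennreal" where
  "disc_value f x \<rho> \<omega> = (if \<rho> \<omega> = \<infinity> then 0 else
     ennreal (exp (- r * real_of_ereal (\<rho> \<omega>))) * f (x + X (real_of_ereal (\<rho> \<omega>)) \<omega>))"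

lemma optional_sampling_bounded:
  fixes g :: "real \<Rightarrow> real"
  assumes g: "mono g" "continuous_on UNIV g" "\<And>y. 0 \<le> g y" "\<And>y. g y \<le> C" and \<rho>: "stopping_time_ext F \<rho>"
  shows "(\<integral>\<^sup>+\<omega>. disc_value (sup_value g) x \<rho> \<omega> \<partial>M) \<le> sup_value g x" (is ?le)
    and "(\<And>\<omega> t. \<omega> \<in> space M \<Longrightarrow> t \<ge> 0 \<Longrightarrow> ereal t < \<rho> \<omega> \<Longrightarrow> g (x + X t \<omega>) = 0) \<Longrightarrow>
      (\<integral>\<^sup>+\<omega>. disc_value (sup_value g) x \<rho> \<omega> \<partial>M) = sup_value g x"
    and "disc_value (sup_value g) x \<rho> \<in> borel_measurable M" (is ?meas)
proof -
  let ?g = "\<lambda>z. ennreal (g z)"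
  define h where "h n = 1 / real (Suc n)" for n
  have h: "h n > 0" "h \<longlonglongrightarrow> 0" for n
    unfolding h_def by (simp, rule LIMSEQ_Suc[OF lim_1_over_n])
  have gm: "?g \<in> borel_measurable borel"
    using borel_measurable_continuous_onI[OF g(2)] by measurable
  have gC: "?g y \<le> ennreal C" for y using g(4) by (intro ennreal_leI)
  have C: "ennreal C < \<infinity>" by simp
  have lim: "(\<lambda>n. grid_stopped ?g (h n) x \<rho> \<omega>) \<longlonglongrightarrow> disc_value (sup_value g) x \<rho> \<omega>" if \<omega>: "\<omega> \<in> space M" for \<omega>
  proof (cases "\<rho> \<omega>")
    case (real t)
    have t: "t \<ge> 0" using stopping_time_nonneg[OF \<rho> \<omega>] real by simp
    have "(\<lambda>n. ennreal (exp (- r * grid_up (h n) t)) * grid_value ?g (h n) (x + X (grid_up (h n) t) \<omega>))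
        \<longlonglongrightarrow> ennreal (exp (- r * t)) * sup_value g (x + X t \<omega>)"
    proof (rule tendsto_mult_ennreal)
      show "(\<lambda>n. ennreal (exp (- r * grid_up (h n) t))) \<longlonglongrightarrow> ennreal (exp (- r * t))"
        by (intro tendsto_ennrealI tendsto_exp tendsto_mult tendsto_const grid_up_tendsto[OF t h])
      show "(\<lambda>n. grid_value ?g (h n) (x + X (grid_up (h n) t) \<omega>)) \<longlonglongrightarrow> sup_value g (x + X t \<omega>)"
        by (intro grid_value_tendsto[OF h g(1,2,4)] tendsto_add tendsto_const X_grid_up_tendsto[OF \<omega> t h])
    qed simp
    then show ?thesis by (simp add: disc_value_def grid_stopped_def real)
  next
    case PInf
    then show ?thesis by (simp add: disc_value_def grid_stopped_def)
  next
    case MInf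
    then show ?thesis using stopping_time_nonneg[OF \<rho> \<omega>] by simp
  qed
  have meas: "grid_stopped ?g (h n) x \<rho> \<in> borel_measurable M" for n
    by (rule grid_stopped_measurable[OF gm gC C h(1) \<rho>])
  show meas': ?meas by (rule borel_measurable_LIMSEQ_order[OF lim meas])
  have lim_int: "(\<lambda>n. \<integral>\<^sup>+\<omega>. grid_stopped ?g (h n) x \<rho> \<omega> \<partial>M) \<longlonglongrightarrow> (\<integral>\<^sup>+\<omega>. disc_value (sup_value g) x \<rho> \<omega> \<partial>M)"
  proof (rule nn_integral_dominated_convergence[where w="\<lambda>_. ennreal C"])
    show "(\<integral>\<^sup>+\<omega>. ennreal C \<partial>M) < \<infinity>" by (simp add: emeasure_space_1)
    show "AE \<omega> in M. grid_stopped ?g (h n) x \<rho> \<omega> \<le> ennreal C" for n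
      by (intro AE_I2 grid_stopped_le[OF gC h(1) \<rho>])
  qed (use meas meas' lim in auto)
  have lim_val: "(\<lambda>n. grid_value ?g (h n) x) \<longlonglongrightarrow> sup_value g x"
    by (rule grid_value_tendsto[OF h g(1,2,4) tendsto_const])
  show ?le
    by (rule LIMSEQ_le[OF lim_int lim_val]) (use grid_optional_sampling(1)[OF gm gC C h(1) \<rho>] in auto)
  assume *: "\<And>\<omega> t. \<omega> \<in> space M \<Longrightarrow> t \<ge> 0 \<Longrightarrow> ereal t < \<rho> \<omega> \<Longrightarrow> g (x + X t \<omega>) = 0"
  have "(\<integral>\<^sup>+\<omega>. grid_stopped ?g (h n) x \<rho> \<omega> \<partial>M) = grid_value ?g (h n) x" for n
    by (rule grid_optional_sampling(2)[OF gm gC C h(1) \<rho>]) (simp add: *)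
  then show "(\<integral>\<^sup>+\<omega>. disc_value (sup_value g) x \<rho> \<omega> \<partial>M) = sup_value g x"
    using LIMSEQ_unique[OF lim_int] lim_val by simp
qed

text \<open>The hinge functions grow linearly, so boundedness has to be removed. Truncation at
  \<open>n\<close> keeps \<open>g\<close> monotone, continuous and nonnegative and keeps its zeros,
  and both sides pass to the limit by monotone convergence.\<close>

lemma optional_sampling:
  fixes g :: "real \<Rightarrow> real"
  assumes g: "mono g" "continuous_on UNIV g" "\<And>y. 0 \<le> g y" and \<rho>: "stopping_time_ext F \<rho>"
  shows "(\<integral>\<^sup>+\<omega>. disc_value (sup_value g) x \<rho> \<omega> \<partial>M) \<le> sup_value g x" (is ?le)
    and "(\<And>\<omega> t. \<omega> \<in> space M \<Longrightarrow> t \<ge> 0 \<Longrightarrow> ereal t < \<rho> \<omega> \<Longrightarrow> g (x + X t \<omega>) = 0) \<Longrightarrow>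
      (\<integral>\<^sup>+\<omega>. disc_value (sup_value g) x \<rho> \<omega> \<partial>M) = sup_value g x"
    and "disc_value (sup_value g) x \<rho> \<in> borel_measurable M" (is ?meas)
proof -
  define gn where "gn n z = min (g z) (real n)" for n :: nat and z
  have gn: "mono (gn n)" "continuous_on UNIV (gn n)" "\<And>y. 0 \<le> gn n y" "\<And>y. gn n y \<le> real n" for n
    using g by (auto simp: gn_def mono_def min_le_iff_disj intro!: continuous_intros)
  have [measurable]: "gn n \<in> borel_measurable borel" for n
    by (rule borel_measurable_continuous_onI[OF gn(2)])
  have gn_inc: "incseq (\<lambda>n. ennreal (gn n z))" for z
    by (intro incseq_SucI ennreal_leI) (auto simp: gn_def)
  have gn_SUP: "(SUP n. ennreal (gn n z)) = ennreal (g z)" for z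
  proof (rule LIMSEQ_unique[OF LIMSEQ_SUP[OF gn_inc]])
    obtain N where N: "g z \<le> real N" using real_arch_simple by blast
    have "eventually (\<lambda>n. ennreal (gn n z) = ennreal (g z)) sequentially"
      using eventually_ge_at_top[of N] by eventually_elim (use N in \<open>auto simp: gn_def min_def\<close>)
    then show "(\<lambda>n. ennreal (gn n z)) \<longlonglongrightarrow> ennreal (g z)" by (rule tendsto_eventually)
  qed
  have val_inc: "incseq (\<lambda>n. sup_value (gn n) y)" for y
    unfolding sup_value_def using gn_inc by (intro monoI nn_integral_mono) (auto dest: monoD)
  have val_SUP: "sup_value g y = (SUP n. sup_value (gn n) y)" for y
    unfolding sup_value_def gn_SUP[symmetric] using gn_inc
    by (intro nn_integral_monotone_convergence_SUP) (auto simp: incseq_def le_fun_def)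
  have disc_inc: "incseq (\<lambda>n. disc_value (sup_value (gn n)) x \<rho>)"
    using val_inc by (auto simp: incseq_def le_fun_def disc_value_def intro!: mult_left_mono)
  have disc_SUP: "disc_value (sup_value g) x \<rho> \<omega> = (SUP n. disc_value (sup_value (gn n)) x \<rho> \<omega>)" for \<omega>
    unfolding disc_value_def val_SUP by (simp add: SUP_mult_left_ennreal)
  have meas[measurable]: "disc_value (sup_value (gn n)) x \<rho> \<in> borel_measurable M" for n
    by (rule optional_sampling_bounded(3)[OF gn \<rho>])
  show ?meas unfolding disc_SUP[abs_def] by measurable
  have int: "(\<integral>\<^sup>+\<omega>. disc_value (sup_value g) x \<rho> \<omega> \<partial>M) = (SUP n. \<integral>\<^sup>+\<omega>. disc_value (sup_value (gn n)) x \<rho> \<omega> \<partial>M)"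
    unfolding disc_SUP by (rule nn_integral_monotone_convergence_SUP[OF disc_inc]) measurable
  show ?le unfolding int val_SUP[of x]
    by (intro SUP_mono) (use optional_sampling_bounded(1)[OF gn \<rho>] in blast)
  assume *: "\<And>\<omega> t. \<omega> \<in> space M \<Longrightarrow> t \<ge> 0 \<Longrightarrow> ereal t < \<rho> \<omega> \<Longrightarrow> g (x + X t \<omega>) = 0"
  have "(\<integral>\<^sup>+\<omega>. disc_value (sup_value (gn n)) x \<rho> \<omega> \<partial>M) = sup_value (gn n) x" for n
    by (rule optional_sampling_bounded(2)[OF gn \<rho>]) (simp add: gn_def *)
  then show "(\<integral>\<^sup>+\<omega>. disc_value (sup_value g) x \<rho> \<omega> \<partial>M) = sup_value g x"
    unfolding int val_SUP[of x] by simp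
qed

section \<open>Averages over the killed supremum\<close>

text \<open>Layer-cake formula: with \<open>f\<close> written as an integral of \<open>f'\<close>,
  interchanging the integrals leaves the tail of \<open>Smax\<close> as weight. The half-open
  interval \<open>{0..<s}\<close> turns into the strict event \<open>z < Smax \<omega>\<close>, the
  one whose probability is known.\<close>

lemma nn_integral_Smax:
  fixes f f' :: "real \<Rightarrow> real"
  assumes [measurable]: "f' \<in> borel_measurable borel"
    and f: "\<And>s. s \<ge> 0 \<Longrightarrow> ennreal (f s) = ennreal (f 0) + (\<integral>\<^sup>+z. ennreal (f' z) * indicator {0..<s} z \<partial>lborel)"
  shows "(\<integral>\<^sup>+\<omega>. ennreal (f (Smax \<omega>)) \<partial>M)
    = ennreal (f 0) + (\<integral>\<^sup>+z. ennreal (f' z) * ennreal ((1 - q) * exp (- b * z)) * indicator {0..} z \<partial>lborel)"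
proof -
  interpret pair_sigma_finite lborel M ..
  have "(\<integral>\<^sup>+\<omega>. ennreal (f (Smax \<omega>)) \<partial>M)
      = (\<integral>\<^sup>+\<omega>. ennreal (f 0) + (\<integral>\<^sup>+z. ennreal (f' z) * indicator {0..<Smax \<omega>} z \<partial>lborel) \<partial>M)"
    by (intro nn_integral_cong f) (simp add: Smax_def)
  also have "\<dots> = (\<integral>\<^sup>+\<omega>. ennreal (f 0) + (\<integral>\<^sup>+z. ennreal (f' z) * indicator {p. 0 \<le> fst p \<and> fst p < snd p} (z, Smax \<omega>) \<partial>lborel) \<partial>M)"
    by (intro nn_integral_cong arg_cong2[where f="(+)"]) (auto simp: indicator_def)
  also have "\<dots> = ennreal (f 0) + (\<integral>\<^sup>+\<omega>. \<integral>\<^sup>+z. ennreal (f' z) * indicator {p. 0 \<le> fst p \<and> fst p < snd p} (z, Smax \<omega>) \<partial>lborel \<partial>M)"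
    by (subst nn_integral_add) (auto simp: emeasure_space_1)
  also have "(\<integral>\<^sup>+\<omega>. \<integral>\<^sup>+z. ennreal (f' z) * indicator {p. 0 \<le> fst p \<and> fst p < snd p} (z, Smax \<omega>) \<partial>lborel \<partial>M)
      = (\<integral>\<^sup>+z. \<integral>\<^sup>+\<omega>. ennreal (f' z) * indicator {p. 0 \<le> fst p \<and> fst p < snd p} (z, Smax \<omega>) \<partial>M \<partial>lborel)"
    by (rule Fubini') measurable
  also have "\<dots> = (\<integral>\<^sup>+z. ennreal (f' z) * ennreal ((1 - q) * exp (- b * z)) * indicator {0..} z \<partial>lborel)"
  proof (rule nn_integral_cong)
    fix z :: real
    have "(\<integral>\<^sup>+\<omega>. ennreal (f' z) * indicator {p. 0 \<le> fst p \<and> fst p < snd p} (z, Smax \<omega>) \<partial>M)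
       = (\<integral>\<^sup>+\<omega>. (ennreal (f' z) * indicator {0..} z) * indicator {\<omega>\<in>space M. z < Smax \<omega>} \<omega> \<partial>M)"
      by (intro nn_integral_cong) (auto simp: indicator_def)
    also have "\<dots> = (ennreal (f' z) * indicator {0..} z) * emeasure M {\<omega>\<in>space M. z < Smax \<omega>}"
      by (rule nn_integral_cmult_indicator) measurable
    also have "\<dots> = ennreal (f' z) * ennreal ((1 - q) * exp (- b * z)) * indicator {0..} z"
      by (cases "z \<ge> 0") (simp_all add: emeasure_eq_measure prob_Smax_gt)
    finally show "(\<integral>\<^sup>+\<omega>. ennreal (f' z) * indicator {p. 0 \<le> fst p \<and> fst p < snd p} (z, Smax \<omega>) \<partial>M) = \<dots>" .
  qed
  finally show ?thesis .
qed

end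

text \<open>With \<open>c = x\<^sub>S\<close> and \<open>k = - F\<^sub>S A\<^sub>I\<close> this is the function \<open>Q\<close> above.\<close>

definition hinge :: "real \<Rightarrow> real \<Rightarrow> real \<Rightarrow> real \<Rightarrow> real" where
  "hinge a k c y = (let s = max 0 (y - c) in s - k * (1 - exp (- a * s)))"

lemma hinge_mono:
  assumes "a > 0" "k \<ge> 0" "a * k \<le> 1"
  shows "mono (hinge a k c)"
proof (rule monoI)
  have "s - k * (1 - exp (- a * s)) \<le> t - k * (1 - exp (- a * t))" if "0 \<le> s" "s \<le> t" for s t :: real
  proof (rule DERIV_nonneg_imp_nondecreasing[OF that(2), of "\<lambda>s. s - k * (1 - exp (- a * s))"])
    fix x assume "s \<le> x" "x \<le> t"
    then have "exp (- a * x) \<le> 1" using that assms by simp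
    then have "a * k * exp (- a * x) \<le> a * k * 1" using assms by (intro mult_left_mono) auto
    then have "1 - a * k * exp (- a * x) \<ge> 0" using assms by linarith
    moreover have "((\<lambda>s. s - k * (1 - exp (- a * s))) has_real_derivative 1 - a * k * exp (- a * x)) (at x)"
      by (auto intro!: derivative_eq_intros)
    ultimately show "\<exists>y. ((\<lambda>s. s - k * (1 - exp (- a * s))) has_real_derivative y) (at x) \<and> y \<ge> 0" by blast
  qed
  then show "hinge a k c x \<le> hinge a k c y" if "x \<le> y" for x y
    using that unfolding hinge_def Let_def by simp
qed

lemma hinge_eq_0: "y \<le> c \<Longrightarrow> hinge a k c y = 0"
  by (simp add: hinge_def)

lemma hinge_nonneg: "a > 0 \<Longrightarrow> k \<ge> 0 \<Longrightarrow> a * k \<le> 1 \<Longrightarrow> hinge a k c y \<ge> 0"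
  using monoD[OF hinge_mono[of a k c], of "min c y" y] hinge_eq_0[of "min c y" c a k] by simp

lemma hinge_continuous: "continuous_on UNIV (hinge a k c)"
  unfolding hinge_def Let_def by (intro continuous_intros)

text \<open>The closed form of the mean of \<open>hinge a k c (y + S)\<close>. The second summand is
  the integral of the slope of the hinge at \<open>y + z\<close> against the tail
  \<open>(1 - q) * exp (- b * z)\<close> over \<open>z \<ge> max 0 (c - y)\<close>; the
  \<open>max\<close> terms cover starting points on both sides of \<open>c\<close> at once.\<close>

definition hinge_mean :: "real \<Rightarrow> real \<Rightarrow> real \<Rightarrow> real \<Rightarrow> real \<Rightarrow> real \<Rightarrow> real" where
  "hinge_mean a b q k c y = hinge a k c y +
     (1 - q) * (exp (- b * max 0 (c - y)) / b - a * k * exp (- a * max 0 (y - c) - b * max 0 (c - y)) / (a + b))"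

lemma hinge_mean_ge_hinge:
  assumes a: "a > 0" and b: "b > 0" and k: "k \<ge> 0" "a * k \<le> 1" and q: "q < 1"
  shows "hinge a k c y \<le> hinge_mean a b q k c y"
proof -
  let ?d = "max 0 (c - y)" and ?s = "max 0 (y - c)"
  have "a * k * exp (- a * ?s - b * ?d) = a * k * exp (- a * ?s) * exp (- b * ?d)"
    by (simp add: exp_add[symmetric])
  also have "\<dots> \<le> 1 * exp (- b * ?d)"
  proof (rule mult_right_mono)
    have "a * k * exp (- a * ?s) \<le> a * k * 1" using a k by (intro mult_left_mono) auto
    then show "a * k * exp (- a * ?s) \<le> 1" using k by linarith
  qed simp
  finally have "a * k * exp (- a * ?s - b * ?d) / (a + b) \<le> exp (- b * ?d) / b"
    using a b by (intro frac_le) auto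
  then have "0 \<le> (1 - q) * (exp (- b * ?d) / b - a * k * exp (- a * ?s - b * ?d) / (a + b))"
    using q by (intro mult_nonneg_nonneg) auto
  then show ?thesis by (simp add: hinge_mean_def)
qed

context exp_killed_levy
begin

lemma sup_value_hinge:
  assumes a: "a > 0" and k: "k \<ge> 0" "a * k \<le> 1"
  shows "sup_value (hinge a k c) y = ennreal (hinge_mean a b q k c y)"
proof -
  define e where "e = y - c"
  define d where "d = max 0 (- e)"
  define f where "f s = hinge a k c (y + s)" for s
  define f' where "f' z = (if d \<le> z then 1 - a * k * exp (- a * (e + z)) else 0)" for z
  have d: "d \<ge> 0" by (simp add: d_def)
  have [measurable]: "f' \<in> borel_measurable borel" unfolding f'_def by measurable
  have pos: "0 \<le> 1 - a * k * exp (- a * (e + z))" if "d \<le> z" for z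
  proof -
    have "exp (- a * (e + z)) \<le> 1" using that a by (simp add: d_def)
    then have "a * k * exp (- a * (e + z)) \<le> a * k * 1" using a k by (intro mult_left_mono) auto
    then show ?thesis using k by linarith
  qed
  have "(\<integral>\<^sup>+\<omega>. ennreal (f (Smax \<omega>)) \<partial>M)
    = ennreal (f 0) + (\<integral>\<^sup>+z. ennreal (f' z) * ennreal ((1 - q) * exp (- b * z)) * indicator {0..} z \<partial>lborel)"
  proof (rule nn_integral_Smax)
    fix s :: real assume s: "s \<ge> 0"
    show "ennreal (f s) = ennreal (f 0) + (\<integral>\<^sup>+z. ennreal (f' z) * indicator {0..<s} z \<partial>lborel)"
    \<comment> \<open>\<open>d\<close> is the distance still missing to \<open>c\<close>; within it
      \<open>f\<close> stays at its initial value.\<close>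
    proof (cases "s \<le> d")
      case True
      have "(\<integral>\<^sup>+z. ennreal (f' z) * indicator {0..<s} z \<partial>lborel) = (\<integral>\<^sup>+z. 0 \<partial>(lborel :: real measure))"
        using True by (intro nn_integral_cong) (auto simp: f'_def indicator_def)
      moreover have "f s = f 0"
      proof (cases "d = 0")
        case True
        then show ?thesis using \<open>s \<le> d\<close> s by simp
      next
        case False
        then have "y + s \<le> c" "y \<le> c" using True by (auto simp: d_def e_def max_def split: if_splits)
        then show ?thesis by (simp add: f_def hinge_eq_0)
      qed
      ultimately show ?thesis by simp
    next
      case False
      let ?H = "\<lambda>z. (e + z) - k * (1 - exp (- a * (e + z)))"
      have "(\<integral>\<^sup>+z. ennreal (f' z) * indicator {0..<s} z \<partial>lborel)
         = (\<integral>\<^sup>+z. ennreal (1 - a * k * exp (- a * (e + z))) * indicator {d..s} z \<partial>lborel)"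
        by (intro nn_integral_cong_AE AE_I[where N="{s}"])
          (use d in \<open>auto simp: f'_def indicator_def split: if_splits\<close>)
      also have "\<dots> = ennreal (?H s - ?H d)"
        using False pos by (intro nn_integral_FTC_Icc) (auto intro!: derivative_eq_intros)
      finally have 1: "(\<integral>\<^sup>+z. ennreal (f' z) * indicator {0..<s} z \<partial>lborel) = ennreal (?H s - ?H d)" .
      have 2: "f s = ?H s" "f 0 = ?H d"
        using False by (auto simp: f_def hinge_def d_def e_def Let_def max_def split: if_splits)
      have "f 0 \<le> f s" unfolding f_def by (rule monoD[OF hinge_mono[OF a k]]) (use s in simp)
      moreover have "0 \<le> f 0" unfolding f_def by (rule hinge_nonneg[OF a k])
      ultimately show ?thesis unfolding 1 2[symmetric] by (simp add: ennreal_plus[symmetric] del: ennreal_plus)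
    qed
  qed measurable
  also have "(\<integral>\<^sup>+z. ennreal (f' z) * ennreal ((1 - q) * exp (- b * z)) * indicator {0..} z \<partial>lborel)
      = (\<integral>\<^sup>+z. ennreal ((1 - q) * (exp (- b * z) - a * k * exp (- a * e - (a + b) * z))) * indicator {d..} z \<partial>lborel)"
  proof (rule nn_integral_cong)
    fix z :: real
    have "(1 - a * k * exp (- a * (e + z))) * ((1 - q) * exp (- b * z))
       = (1 - q) * (exp (- b * z) - a * k * exp (- a * e - (a + b) * z))"
      by (simp add: algebra_simps exp_add[symmetric])
    then have "ennreal (1 - a * k * exp (- a * (e + z))) * ennreal ((1 - q) * exp (- b * z))
       = ennreal ((1 - q) * (exp (- b * z) - a * k * exp (- a * e - (a + b) * z)))" if "d \<le> z"
      using pos[OF that] q by (simp only: ennreal_mult'[symmetric])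
    then show "ennreal (f' z) * ennreal ((1 - q) * exp (- b * z)) * indicator {0..} z
       = ennreal ((1 - q) * (exp (- b * z) - a * k * exp (- a * e - (a + b) * z))) * indicator {d..} z"
      using d by (cases "d \<le> z") (auto simp: f'_def)
  qed
  also have "\<dots> = ennreal (0 - (1 - q) * (- exp (- b * d) / b + a * k * exp (- a * e - (a + b) * d) / (a + b)))"
  proof (rule nn_integral_FTC_atLeast)
    fix z assume z: "d \<le> z"
    have E: "((\<lambda>z. exp (u - l * z) / l) has_real_derivative - exp (u - l * z)) (at z)" if "l > 0" for u l :: real
      using that by (auto intro!: derivative_eq_intros)
    have "((\<lambda>z. (1 - q) * (- (exp (0 - b * z) / b) + a * k * (exp (- a * e - (a + b) * z) / (a + b)))) has_real_derivative
        (1 - q) * (- (- exp (0 - b * z)) + a * k * - exp (- a * e - (a + b) * z))) (at z)"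
      by (intro DERIV_cmult DERIV_add DERIV_minus E) (use a b in auto)
    then show "((\<lambda>z. (1 - q) * (- exp (- b * z) / b + a * k * exp (- a * e - (a + b) * z) / (a + b))) has_real_derivative
        (1 - q) * (exp (- b * z) - a * k * exp (- a * e - (a + b) * z))) (at z)"
      by simp
    have "exp (- b * z) - a * k * exp (- a * e - (a + b) * z) = exp (- b * z) * (1 - a * k * exp (- a * (e + z)))"
      by (simp add: algebra_simps exp_add[symmetric])
    then show "0 \<le> (1 - q) * (exp (- b * z) - a * k * exp (- a * e - (a + b) * z))"
      using pos[OF z] q by simp
  next
    have lim: "((\<lambda>z. exp (u - l * z)) \<longlongrightarrow> 0) at_top" if "l > 0" for u l :: real
    proof (rule filterlim_compose[OF exp_at_bot])
      show "filterlim (\<lambda>z. u - l * z) at_bot at_top" using that by real_asymp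
    qed
    have "((\<lambda>z. (1 - q) * (- exp (0 - b * z) / b + a * k * exp (- a * e - (a + b) * z) / (a + b)))
        \<longlongrightarrow> (1 - q) * (- 0 / b + a * k * 0 / (a + b))) at_top"
      using a b by (intro tendsto_intros lim) auto
    then show "((\<lambda>z. (1 - q) * (- exp (- b * z) / b + a * k * exp (- a * e - (a + b) * z) / (a + b))) \<longlongrightarrow> 0) at_top"
      by simp
  qed measurable
  also have "0 - (1 - q) * (- exp (- b * d) / b + a * k * exp (- a * e - (a + b) * d) / (a + b))
     = hinge_mean a b q k c y - f 0"
  proof -
    \<comment> \<open>This rests on \<open>e + d = max 0 e\<close>, which separates the exponent
      into the part above \<open>c\<close> and the missing distance.\<close>
    have 1: "- a * e - (a + b) * d = - a * max 0 (y - c) - b * d"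
      by (auto simp: d_def e_def max_def algebra_simps)
    show ?thesis unfolding 1 by (simp add: hinge_mean_def f_def d_def e_def algebra_simps)
  qed
  also have "ennreal (f 0) + ennreal (hinge_mean a b q k c y - f 0) = ennreal (hinge_mean a b q k c y)"
    using hinge_nonneg[OF a k, of c y] hinge_mean_ge_hinge[OF a b k q(2), of c y]
    by (subst ennreal_plus[symmetric]) (auto simp: f_def)
  finally show ?thesis unfolding sup_value_def f_def .
qed

subsection \<open>Hitting times\<close>

text \<open>Right-continuity makes the infimum of the hitting set attained. Hence hitting at or
  before \<open>t\<close> is a statement about the path on \<open>[0, t]\<close> alone, with no
  limit taken from later times.\<close>

lemma hit_above_le_iff:
  assumes \<omega>: "\<omega> \<in> space M"
  shows "hit_above X x c \<omega> \<le> ereal t \<longleftrightarrow> (\<exists>s. 0 \<le> s \<and> s \<le> t \<and> c \<le> x + X s \<omega>)"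
proof -
  define A where "A = {t. 0 \<le> t \<and> x + X t \<omega> \<ge> c}"
  have bdd: "bdd_below A" by (auto simp: A_def intro: bdd_belowI[of _ 0])
  show ?thesis
  proof (cases "A = {}")
    case True
    then show ?thesis by (auto simp: hit_above_def A_def)
  next
    case False
    have "Inf A \<in> A"
    proof -
      from closure_contains_Inf[OF False bdd] obtain s where s: "\<And>n. s n \<in> A" "s \<longlonglongrightarrow> Inf A"
        unfolding closure_sequential by blast
      have 0: "0 \<le> Inf A" using False by (intro cInf_greatest) (auto simp: A_def)
      have "(\<lambda>n. x + X (s n) \<omega>) \<longlonglongrightarrow> x + X (Inf A) \<omega>"
        using s bdd by (intro tendsto_add tendsto_const X_right_cont_seq[OF \<omega> 0 s(2)] cInf_lower) auto
      then have "c \<le> x + X (Inf A) \<omega>"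
        using s(1) by (intro LIMSEQ_le_const) (auto simp: A_def)
      then show ?thesis using 0 by (simp add: A_def)
    qed
    moreover have "hit_above X x c \<omega> = ereal (Inf A)" using False by (auto simp: hit_above_def A_def)
    moreover have "s \<in> A \<Longrightarrow> Inf A \<le> s" for s using bdd by (intro cInf_lower)
    ultimately show ?thesis unfolding A_def by (auto intro: order_trans)
  qed
qed

lemma hit_above_nonneg: "hit_above X x c \<omega> \<ge> 0"
  by (auto simp: hit_above_def intro!: cInf_greatest)

text \<open>Strict exceedance is an open condition, so by right-continuity it can be tested at
  countably many times.\<close>

definition passes :: "real \<Rightarrow> real \<Rightarrow> 'a set" where
  "passes c t = {\<omega>\<in>space M. \<exists>s. 0 \<le> s \<and> s \<le> t \<and> c < X s \<omega>}"

lemma passes_measurable: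
  assumes t: "t \<ge> 0" and N: "space N = space M" "\<And>s. 0 \<le> s \<Longrightarrow> s \<le> t \<Longrightarrow> X s \<in> borel_measurable N"
  shows "passes c t \<in> sets N"
proof -
  \<comment> \<open>The end point \<open>t\<close> is added by hand: an exceedance at
    \<open>t\<close> itself need not show at rational times before \<open>t\<close>.\<close>
  define Q where "Q = insert t (\<rat> \<inter> {0..t})"
  have "passes c t = (\<Union>s\<in>Q. {\<omega>\<in>space N. c < X s \<omega>})"
  proof (intro set_eqI iffI)
    fix \<omega> assume "\<omega> \<in> passes c t"
    then obtain s where \<omega>: "\<omega> \<in> space M" and s: "0 \<le> s" "s \<le> t" "c < X s \<omega>" by (auto simp: passes_def)
    show "\<omega> \<in> (\<Union>s\<in>Q. {\<omega>\<in>space N. c < X s \<omega>})"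
    proof (cases "s = t")
      case True
      then show ?thesis using s \<omega> N by (auto simp: Q_def)
    next
      case False
      have "eventually (\<lambda>v. c < X v \<omega>) (at_right s)"
        using X_right_cont[OF \<omega> s(1)] s(3) by (rule order_tendstoD)
      then obtain d where d: "d > s" "\<And>v. s < v \<Longrightarrow> v < d \<Longrightarrow> c < X v \<omega>"
        unfolding eventually_at_right_field by blast
      obtain v where "v \<in> \<rat>" "s < v" "v < min d t"
        using Rats_dense_in_real[of s "min d t"] d s False by auto
      then show ?thesis using d(2)[of v] s \<omega> N by (auto simp: Q_def intro!: bexI[of _ v])
    qed
  qed (use N t in \<open>auto simp: passes_def Q_def\<close>)
  moreover have "countable Q" unfolding Q_def by (simp add: countable_rat countable_Int1)
  moreover have "{\<omega>\<in>space N. c < X s \<omega>} \<in> sets N" if "s \<in> Q" for s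
    using N(2)[of s] that t by (auto simp: Q_def)
  ultimately show ?thesis using sets.countable_UN''[of Q "\<lambda>s. {\<omega>\<in>space N. c < X s \<omega>}" N] by metis
qed

text \<open>The event that the supremum over \<open>[0, t]\<close> is at least \<open>c\<close>.
  Besides the paths that hit \<open>c\<close> by time \<open>t\<close> it contains those that
  approach \<open>c\<close> only through a left limit.\<close>

definition reaches :: "real \<Rightarrow> real \<Rightarrow> 'a set" where
  "reaches c t = (\<Inter>n. passes (c - 1 / real (Suc n)) t)"

lemma reaches_measurable:
  assumes "t \<ge> 0" "space N = space M" "\<And>s. 0 \<le> s \<Longrightarrow> s \<le> t \<Longrightarrow> X s \<in> borel_measurable N"
  shows "reaches c t \<in> sets N"
  unfolding reaches_def using passes_measurable[OF assms] by (intro sets.countable_INT) auto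

text \<open>The tail is continuous, and the levels \<open>y - y / real (Suc n)\<close> approach
  \<open>y\<close> within the range where it is known. At \<open>0\<close> there may be an atom, of
  mass \<open>q\<close>.\<close>

lemma prob_Smax_eq: "y > 0 \<Longrightarrow> prob {\<omega>\<in>space M. Smax \<omega> = y} = 0"
proof -
  assume y: "y > 0"
  have "prob {\<omega>\<in>space M. Smax \<omega> = y} \<le> (1 - q) * exp (- b * (y - y / real (Suc n))) - (1 - q) * exp (- b * y)" for n
  proof -
    have n: "0 \<le> y - y / real (Suc n)" "y - y / real (Suc n) < y" using y by (auto simp: field_simps)
    have "prob {\<omega>\<in>space M. Smax \<omega> = y}
        \<le> prob ({\<omega>\<in>space M. y - y / real (Suc n) < Smax \<omega>} - {\<omega>\<in>space M. y < Smax \<omega>})"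
      using n by (intro finite_measure_mono) auto
    also have "\<dots> = prob {\<omega>\<in>space M. y - y / real (Suc n) < Smax \<omega>} - prob {\<omega>\<in>space M. y < Smax \<omega>}"
      using n(2) by (intro finite_measure_Diff) (auto simp del: of_nat_Suc)
    finally show ?thesis using n y by (simp only: prob_Smax_gt less_imp_le)
  qed
  moreover have "(\<lambda>n. (1 - q) * exp (- b * (y - y / real (Suc n))) - (1 - q) * exp (- b * y))
     \<longlonglongrightarrow> (1 - q) * exp (- b * (y - 0)) - (1 - q) * exp (- b * y)"
    by (intro tendsto_intros LIMSEQ_Suc[OF lim_const_over_n])
  ultimately have "prob {\<omega>\<in>space M. Smax \<omega> = y} \<le> 0"
    by (intro LIMSEQ_le_const[where X="\<lambda>n. (1 - q) * exp (- b * (y - y / real (Suc n))) - (1 - q) * exp (- b * y)"]) auto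
  then show ?thesis using measure_nonneg[of M] by (simp add: antisym)
qed

text \<open>On a path that reaches \<open>c\<close> by time \<open>s\<close> without passing it by time \<open>t\<close>, the supremum at
  any killing time in \<open>(s, t]\<close> is exactly \<open>c\<close>, which is not an atom of its law.\<close>

lemma reaches_not_passes_null:
  assumes c: "c > 0" and st: "0 \<le> s" "s < t"
  shows "reaches c s - passes c t \<in> null_sets M"
proof -
  let ?A = "reaches c s - passes c t"
  let ?E = "er -` {s<..t} \<inter> space M"
  have sp: "space path_algebra = space M" by (simp add: space_measure_of_conv)
  have "?A \<in> sets path_algebra"
    using reaches_measurable[OF st(1) sp X_path_algebra] passes_measurable[OF _ sp X_path_algebra] st by auto
  then have A: "?A \<in> sigma_sets (space M) {X t -` B \<inter> space M | t B. 0 \<le> t \<and> B \<in> sets borel}"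
    by (simp only: sets_path_algebra)
  have AM[measurable]: "?A \<in> sets M"
    using reaches_measurable[OF st(1) refl] passes_measurable[OF _ refl, of t] st by auto
  \<comment> \<open>Killing in \<open>(s, t]\<close> has positive probability and is independent of
    the path, so once the intersection is null the set of paths must be null.\<close>
  have "prob (?E \<inter> ?A) = prob ?E * prob ?A"
    by (rule indep_setD[OF er_indep _ A]) auto
  moreover have "prob (?E \<inter> ?A) = 0"
  proof -
    have "?E \<inter> ?A \<subseteq> {\<omega>\<in>space M. Smax \<omega> = c}"
    proof safe
      fix \<omega> assume \<omega>: "\<omega> \<in> space M" and er: "er \<omega> \<in> {s<..t}" and r: "\<omega> \<in> reaches c s" and np: "\<omega> \<notin> passes c t"
      have S: "Smax \<omega> = Sup ((\<lambda>t. X t \<omega>) ` {0..er \<omega>})" using \<omega> er st by (intro Smax_eq) auto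
      have "Smax \<omega> \<le> c"
        unfolding S using np er st \<omega> by (intro cSUP_least) (auto simp: passes_def not_less)
      moreover have "c - 1 / real (Suc n) \<le> Smax \<omega>" for n
      proof -
        have "\<omega> \<in> passes (c - 1 / real (Suc n)) s" using r unfolding reaches_def by (rule INT_D) simp
        then obtain v where "0 \<le> v" "v \<le> s" "c - 1 / real (Suc n) < X v \<omega>" unfolding passes_def by blast
        moreover then have "X v \<omega> \<le> Smax \<omega>" unfolding S using er by (intro X_le_Sup[OF \<omega>]) auto
        ultimately show ?thesis by linarith
      qed
      then have "c - 0 \<le> Smax \<omega>"
        by (intro LIMSEQ_le_const2[OF tendsto_diff[OF tendsto_const LIMSEQ_Suc[OF lim_1_over_n]]]) blast
      ultimately show "Smax \<omega> = c" by simp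
    qed
    then have "prob (?E \<inter> ?A) \<le> prob {\<omega>\<in>space M. Smax \<omega> = c}" by (intro finite_measure_mono) auto
    then show ?thesis using prob_Smax_eq[OF c] measure_nonneg[of M] by (simp add: antisym)
  qed
  moreover have "prob ?E > 0"
  proof -
    have "?E = {\<omega>\<in>space M. s < er \<omega> \<and> er \<omega> \<le> t}" by auto
    then show ?thesis using prob_er_interval[of s t] st r_pos by simp
  qed
  ultimately have "prob ?A = 0" by simp
  then show ?thesis by (intro null_setsI) (auto simp: emeasure_eq_measure)
qed

text \<open>Hitting by time \<open>t\<close> is the observable event \<open>reaches y t\<close>
  minus a null set: a path in the difference fails to pass \<open>y\<close> until some time after
  \<open>t\<close>, since passing it arbitrarily soon after \<open>t\<close> would put the hitting
  time at or before \<open>t\<close>. Completeness of the filtration absorbs the null set.\<close>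

lemma hit_above_stopping_time: "stopping_time_ext F (hit_above X x c)"
  unfolding stopping_time_ext_def
proof (intro conjI ballI allI impI hit_above_nonneg)
  fix t :: real assume t: "t \<ge> 0"
  define T where "T = {\<omega>\<in>space M. hit_above X x c \<omega> \<le> ereal t}"
  have "T \<in> sets (F t)"
  proof (cases "c \<le> x")
    \<comment> \<open>A start at or above \<open>c\<close> hits at time \<open>0\<close>. The case
      is separate because the supremum may have an atom at \<open>0\<close>.\<close>
    case True
    then have "T = space (F t)"
      unfolding T_def space_F[OF t] using t X_0 by (auto simp: hit_above_le_iff intro!: exI[of _ 0])
    then show ?thesis by simp
  next
    case False
    define y where "y = c - x"
    have y: "y > 0" using False by (simp add: y_def)
    have T: "T = {\<omega>\<in>space M. \<exists>s. 0 \<le> s \<and> s \<le> t \<and> y \<le> X s \<omega>}"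
      unfolding T_def y_def by (auto simp: hit_above_le_iff algebra_simps)
    have sub: "T \<subseteq> reaches y t"
    proof
      fix \<omega> assume "\<omega> \<in> T"
      then obtain s where \<omega>: "\<omega> \<in> space M" and s: "0 \<le> s" "s \<le> t" "y \<le> X s \<omega>" unfolding T by auto
      have "y - 1 / real (Suc n) < X s \<omega>" for n using s(3) by (smt (verit) of_nat_0_less_iff zero_less_Suc zero_less_divide_1_iff)
      then show "\<omega> \<in> reaches y t" using \<omega> s unfolding reaches_def passes_def by blast
    qed
    have "reaches y t - T \<subseteq> (\<Union>n. reaches y t - passes y (t + 1 / real (Suc n)))"
    proof
      fix \<omega> assume \<omega>: "\<omega> \<in> reaches y t - T"
      then have \<omega>M: "\<omega> \<in> space M" by (auto simp: reaches_def passes_def)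
      show "\<omega> \<in> (\<Union>n. reaches y t - passes y (t + 1 / real (Suc n)))"
      proof (rule ccontr)
        assume "\<not> ?thesis"
        then have p: "\<omega> \<in> passes y (t + 1 / real (Suc n))" for n using \<omega> by auto
        have "hit_above X x c \<omega> \<le> ereal (t + 1 / real (Suc n))" for n
        proof -
          obtain s where "0 \<le> s" "s \<le> t + 1 / real (Suc n)" "y < X s \<omega>"
            using p[of n] unfolding passes_def by blast
          then show ?thesis unfolding hit_above_le_iff[OF \<omega>M] y_def by (intro exI[of _ s]) auto
        qed
        moreover have "(\<lambda>n. ereal (t + 1 / real (Suc n))) \<longlonglongrightarrow> ereal (t + 0)"
          by (intro tendsto_intros LIMSEQ_Suc[OF lim_1_over_n])
        ultimately have "hit_above X x c \<omega> \<le> ereal (t + 0)"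
          by (intro LIMSEQ_le_const[where X="\<lambda>n. ereal (t + 1 / real (Suc n))"]) blast+
        then show False using \<omega> \<omega>M by (simp add: T_def)
      qed
    qed
    moreover have "(\<Union>n. reaches y t - passes y (t + 1 / real (Suc n))) \<in> null_sets M"
      using reaches_not_passes_null[OF y t] by (intro null_sets_UN) auto
    ultimately have "reaches y t - T \<in> sets (F t)" by (rule null_F[OF t])
    moreover have "reaches y t \<in> sets (F t)"
      by (rule reaches_measurable[OF t space_F[OF t] X_measurable_F])
    ultimately have "reaches y t - (reaches y t - T) \<in> sets (F t)" by auto
    moreover have "reaches y t - (reaches y t - T) = T" using sub by auto
    ultimately show ?thesis by simp
  qed
  then show "{\<omega>\<in>space (F t). hit_above X x c \<omega> \<le> ereal t} \<in> sets (F t)"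
    unfolding T_def space_F[OF t] .
qed

lemma stopping_time_min:
  assumes "stopping_time_ext F \<rho>" "stopping_time_ext F \<sigma>"
  shows "stopping_time_ext F (\<lambda>\<omega>. min (\<rho> \<omega>) (\<sigma> \<omega>))"
  unfolding stopping_time_ext_def
proof (intro conjI allI impI ballI)
  fix t :: real assume "t \<ge> 0"
  then have "{\<omega>\<in>space (F t). \<rho> \<omega> \<le> ereal t} \<union> {\<omega>\<in>space (F t). \<sigma> \<omega> \<le> ereal t} \<in> sets (F t)"
    using assms unfolding stopping_time_ext_def by (intro sets.Un) auto
  also have "{\<omega>\<in>space (F t). \<rho> \<omega> \<le> ereal t} \<union> {\<omega>\<in>space (F t). \<sigma> \<omega> \<le> ereal t}
      = {\<omega>\<in>space (F t). min (\<rho> \<omega>) (\<sigma> \<omega>) \<le> ereal t}" by (auto simp: min_le_iff_disj)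
  finally show "{\<omega>\<in>space (F t). min (\<rho> \<omega>) (\<sigma> \<omega>) \<le> ereal t} \<in> sets (F t)" .
qed (use assms in \<open>auto simp: stopping_time_ext_def\<close>)

lemma stopping_time_measurable:
  assumes \<rho>: "stopping_time_ext F \<rho>"
  shows "\<rho> \<in> borel_measurable M"
  unfolding borel_measurable_iff_Iic_ereal
proof
  fix a :: ereal
  show "\<rho> -` {..a} \<inter> space M \<in> sets M"
  proof (cases a)
    case (real t)
    show ?thesis
    proof (cases "t \<ge> 0")
      case True
      have "\<rho> -` {..a} \<inter> space M = {\<omega>\<in>space M. \<rho> \<omega> \<le> ereal t}" using real by auto
      then show ?thesis using stopping_time_sets[OF \<rho> True] sets_F[OF True] by auto
    next
      case False
      have "\<rho> -` {..a} \<inter> space M = {}"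
      proof safe
        fix \<omega> assume "\<omega> \<in> space M" "\<rho> \<omega> \<le> a"
        then have "0 \<le> ereal t" using stopping_time_nonneg[OF \<rho>] real order_trans by blast
        then show "\<omega> \<in> {}" using False by simp
      qed
      then show ?thesis by simp
    qed
  next
    case PInf
    then have "\<rho> -` {..a} \<inter> space M = space M" by auto
    then show ?thesis by simp
  next
    case MInf
    then have "\<rho> -` {..a} \<inter> space M = {}"
      using stopping_time_nonneg[OF \<rho>] by fastforce
    then show ?thesis by (simp only: sets.empty_sets)
  qed
qed

text \<open>Right-continuity gives the payoff as a limit of payoffs at the rounded-up times, which
  take countably many values, and at each fixed time \<open>X\<close> is measurable.\<close>

lemma disc_payoff_measurable:
  assumes G: "continuous_on UNIV G" and \<rho>: "stopping_time_ext F \<rho>"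
  shows "disc_payoff r G X x \<rho> \<in> borel_measurable M"
proof -
  have [measurable]: "G \<in> borel_measurable borel" using G by (rule borel_measurable_continuous_onI)
  have [measurable]: "\<rho> \<in> borel_measurable M" by (rule stopping_time_measurable[OF \<rho>])
  define h where "h n = 1 / real (Suc n)" for n
  have h: "h n > 0" "h \<longlonglongrightarrow> 0" for n
    unfolding h_def by (simp, rule LIMSEQ_Suc[OF lim_1_over_n])
  define D where "D n \<omega> = (if \<rho> \<omega> = \<infinity> then 0 else
     exp (- r * grid_up (h n) (real_of_ereal (\<rho> \<omega>))) * G (x + X (grid_up (h n) (real_of_ereal (\<rho> \<omega>))) \<omega>))" for n \<omega>
  have meas: "D n \<in> borel_measurable M" for n
  proof -
    have "(\<lambda>\<omega>. exp (- r * (real (nat \<lceil>real_of_ereal (\<rho> \<omega>) / h n\<rceil>) * h n))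
        * G (x + X (real (nat \<lceil>real_of_ereal (\<rho> \<omega>) / h n\<rceil>) * h n) \<omega>)) \<in> borel_measurable M"
    proof (rule measurable_compose_countable[where f="\<lambda>k \<omega>. exp (- r * (real k * h n)) * G (x + X (real k * h n) \<omega>)"])
      fix k
      have [measurable]: "X (real k * h n) \<in> borel_measurable M" using h(1)[of n] by (intro X_measurable) simp
      show "(\<lambda>\<omega>. exp (- r * (real k * h n)) * G (x + X (real k * h n) \<omega>)) \<in> borel_measurable M"
        by measurable
    qed measurable
    then show ?thesis unfolding D_def[abs_def] grid_up_def by measurable
  qed
  have lim: "(\<lambda>n. D n \<omega>) \<longlonglongrightarrow> disc_payoff r G X x \<rho> \<omega>" if \<omega>: "\<omega> \<in> space M" for \<omega>
  proof (cases "\<rho> \<omega> = \<infinity>")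
    case True
    then show ?thesis by (simp add: D_def disc_payoff_def)
  next
    case False
    have t: "real_of_ereal (\<rho> \<omega>) \<ge> 0" using stopping_time_nonneg[OF \<rho> \<omega>] by (simp add: real_of_ereal_pos)
    have "(\<lambda>n. G (x + X (grid_up (h n) (real_of_ereal (\<rho> \<omega>))) \<omega>)) \<longlonglongrightarrow> G (x + X (real_of_ereal (\<rho> \<omega>)) \<omega>)"
      by (rule continuous_on_tendsto_compose[OF G])
        (auto intro: tendsto_add[OF tendsto_const X_grid_up_tendsto[OF \<omega> t h]])
    then have "(\<lambda>n. exp (- r * grid_up (h n) (real_of_ereal (\<rho> \<omega>))) * G (x + X (grid_up (h n) (real_of_ereal (\<rho> \<omega>))) \<omega>))
        \<longlonglongrightarrow> exp (- r * real_of_ereal (\<rho> \<omega>)) * G (x + X (real_of_ereal (\<rho> \<omega>)) \<omega>)"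
      by (intro tendsto_mult tendsto_exp tendsto_const grid_up_tendsto[OF t h])
    then show ?thesis unfolding D_def disc_payoff_def using False by simp
  qed
  show ?thesis by (rule borel_measurable_LIMSEQ_real[OF lim meas])
qed

end

section \<open>The explicit value function\<close>

context gap_equation
begin

definition "xI \<delta> u = - \<delta> - EI + FI * AS u"
definition "xS \<delta> u = \<delta> + ES + FS * AI u"

text \<open>Averaging multiplies the exponential of the hinge by \<open>1 / FS\<close>, which turns
  its coefficient \<open>FS * - AI u\<close> into \<open>- AI u\<close> above
  \<open>x\<^sub>S\<close>. Below, the mean is a multiple of \<open>exp (b * y)\<close>, identified
  by \<open>AS_exp\<close>.\<close>

lemma hinge_mean_S:
  assumes u: "u > 0" and gap: "xS \<delta> u - xI \<delta> u = u"
  shows "hinge_mean a b q (FS * - AI u) (xS \<delta> u) y =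
    (if y < xS \<delta> u then AS u * exp (b * (y - xI \<delta> u)) else y - \<delta> - AI u * exp (- a * (y - xS \<delta> u)))"
proof -
  define k where "k = FS * - AI u"
  have GSk: "(1 - q) * (a * k / (a + b)) = - GS * AI u"
  proof -
    have "a + b \<noteq> 0" using a b by simp
    then show ?thesis by (simp add: k_def FS_def GS_eq)
  qed
  show ?thesis
  proof (cases "y < xS \<delta> u")
    case True
    have "hinge_mean a b q k (xS \<delta> u) y = (1 - q) * (exp (b * (y - xS \<delta> u)) / b - a * k * exp (b * (y - xS \<delta> u)) / (a + b))"
      using True by (simp add: hinge_mean_def hinge_eq_0 max_def algebra_simps)
    also have "\<dots> = exp (b * (y - xS \<delta> u)) * (ES - (1 - q) * (a * k / (a + b)))"
      by (simp add: ES_def algebra_simps)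
    also have "\<dots> = AS u * (exp (b * (y - xS \<delta> u)) * exp (b * u))"
    proof -
      have "ES - (- GS * AI u) = AS u * exp (b * u)" using AS_exp[OF u] by simp
      then show ?thesis unfolding GSk by (simp add: mult_ac)
    qed
    also have "exp (b * (y - xS \<delta> u)) * exp (b * u) = exp (b * (y - xI \<delta> u))"
      unfolding exp_add[symmetric] using gap by (simp add: algebra_simps)
    finally show ?thesis using True by (simp add: k_def)
  next
    case False
    define E where "E = exp (- a * (y - xS \<delta> u))"
    have FS: "FS = GS + 1" by (simp add: FS_def GS_def)
    have k1: "k + GS * AI u = - AI u" unfolding k_def FS by (simp add: algebra_simps)
    have "hinge_mean a b q k (xS \<delta> u) y = (y - xS \<delta> u) - k * (1 - E) + (1 - q) * (1 / b - a * k * E / (a + b))"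
      using False by (simp add: hinge_mean_def hinge_def Let_def E_def)
    also have "\<dots> = (y - xS \<delta> u) - k + ES + E * (k - (1 - q) * (a * k / (a + b)))"
      by (simp add: ES_def algebra_simps)
    also have "\<dots> = y - \<delta> + E * (k + GS * AI u)"
      unfolding GSk by (simp add: xS_def k_def)
    finally show ?thesis using False unfolding k1 by (simp add: k_def E_def algebra_simps)
  qed
qed

text \<open>Reflection: when \<open>a\<close>, \<open>p\<close> are exchanged with \<open>b\<close>,
  \<open>q\<close>, the coefficients \<open>AI\<close> and \<open>AS\<close> are swapped with a
  change of sign, and so are the two end points.\<close>

lemma hinge_mean_I:
  assumes u: "u > 0" and gap: "xS \<delta> u - xI \<delta> u = u"
  shows "hinge_mean b a p (FI * AS u) (- xI \<delta> u) (- y) =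
    (if xI \<delta> u < y then - AI u * exp (- a * (y - xS \<delta> u)) else - y - \<delta> + AS u * exp (b * (y - xI \<delta> u)))"
proof -
  interpret mirror: gap_equation b a q p
    using a b p q by unfold_locales
  have m: "mirror.EI = ES" "mirror.ES = EI" "mirror.FI = FS" "mirror.FS = FI" "mirror.GI = GS" "mirror.GS = GI"
    by (simp_all add: mirror.EI_def mirror.ES_def mirror.FI_def mirror.FS_def mirror.GI_def mirror.GS_def
        EI_def ES_def FI_def FS_def GI_def GS_def add.commute)
  have A: "mirror.AI u = - AS u" "mirror.AS u = - AI u"
    unfolding mirror.AI_def mirror.AS_def AI_def AS_def m minus_divide_left
    by (simp_all add: add.commute mult.commute[of GI])
  have x: "mirror.xS \<delta> u = - xI \<delta> u" "mirror.xI \<delta> u = - xS \<delta> u"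
    by (simp_all add: mirror.xS_def mirror.xI_def xI_def xS_def m A)
  show ?thesis
    using mirror.hinge_mean_S[OF u, of \<delta> "- y"] gap unfolding m A x by (simp add: algebra_simps)
qed

definition "game_value \<delta> u x = (if x \<le> xI \<delta> u then x + \<delta>
   else if x < xS \<delta> u then AI u * exp (- a * (x - xS \<delta> u)) + AS u * exp (b * (x - xI \<delta> u))
   else x - \<delta>)"

lemma game_value_eq:
  assumes u: "u > 0" and gap: "xS \<delta> u - xI \<delta> u = u"
  shows "game_value \<delta> u y = hinge_mean a b q (FS * - AI u) (xS \<delta> u) y - hinge_mean b a p (FI * AS u) (- xI \<delta> u) (- y)"
  unfolding hinge_mean_S[OF assms] hinge_mean_I[OF assms] game_value_def using u gap by auto

text \<open>The left side is the derivative of the middle branch. As a positive combination of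
  exponentials it is convex, so a bound at the two end points suffices.\<close>

lemma middle_deriv_le_1:
  assumes u: "u > 0" and gap: "xS \<delta> u - xI \<delta> u = u" and y: "xI \<delta> u \<le> y" "y \<le> xS \<delta> u"
  shows "- a * AI u * exp (- a * (y - xS \<delta> u)) + b * AS u * exp (b * (y - xI \<delta> u)) \<le> 1"
proof -
  define t where "t = (y - xI \<delta> u) / u"
  have t: "0 \<le> t" "t \<le> 1" using y gap u by (auto simp: t_def)
  have yI: "y - xI \<delta> u = t * u" and yS: "y - xS \<delta> u = - ((1 - t) * u)"
    using u gap by (auto simp: t_def field_simps)
  have convex: "exp (s * z) \<le> (1 - s) + s * exp z" if "0 \<le> s" "s \<le> 1" for s z :: real
    using convex_onD[OF exp_convex, of s 0 z] that by simp
  have 1: "exp (- a * (y - xS \<delta> u)) \<le> t + (1 - t) * exp (a * u)"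
    using convex[of "1 - t" "a * u"] t unfolding yS by (simp add: mult_ac)
  have 2: "exp (b * (y - xI \<delta> u)) \<le> (1 - t) + t * exp (b * u)"
    using convex[of t "b * u"] t unfolding yI by (simp add: mult_ac)
  have "- a * AI u * exp (- a * (y - xS \<delta> u)) \<le> - a * AI u * (t + (1 - t) * exp (a * u))"
    using AI_bounds(1)[OF u] a 1 by (intro mult_left_mono) (auto simp: mult_nonneg_nonpos)
  moreover have "b * AS u * exp (b * (y - xI \<delta> u)) \<le> b * AS u * ((1 - t) + t * exp (b * u))"
    using AS_bounds(1)[OF u] b 2 by (intro mult_left_mono) auto
  moreover have "- a * AI u * (t + (1 - t) * exp (a * u)) + b * AS u * ((1 - t) + t * exp (b * u))
      = (1 - t) * (- a * (AI u * exp (a * u)) + b * AS u) + t * (- a * AI u + b * (AS u * exp (b * u)))"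
    by (simp add: algebra_simps)
  \<comment> \<open>By \<open>AI_exp\<close> the slope at \<open>x\<^sub>I\<close> is a convex
    combination of \<open>1\<close> and \<open>b * (FI * AS u)\<close>, the latter with weight
    \<open>p\<close>. For \<open>p = 0\<close> it equals \<open>1\<close>, which is smooth
    fit.\<close>
  moreover have "- a * (AI u * exp (a * u)) + b * AS u \<le> 1"
  proof -
    have "b - a * GI = p * (b * FI)" using a b denom_pos by (simp add: GI_eq FI_def field_simps)
    then have "(b - a * GI) * AS u = p * (b * FI) * AS u" by simp
    moreover have aE: "a * EI = 1 - p" using a by (simp add: EI_def)
    ultimately have "- a * (AI u * exp (a * u)) + b * AS u = (1 - p) + p * (b * (FI * AS u))"
      unfolding AI_exp[OF u] using aE by (simp add: algebra_simps)
    also have "\<dots> \<le> (1 - p) + p * 1" using AS_bounds(2)[OF u] p by (intro add_left_mono mult_left_mono) auto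
    finally show ?thesis by simp
  qed
  moreover have "- a * AI u + b * (AS u * exp (b * u)) \<le> 1"
  proof -
    have "a - b * GS = q * (a * FS)" using a b denom_pos by (simp add: GS_eq FS_def field_simps)
    then have "(a - b * GS) * - AI u = q * (a * FS) * - AI u" by simp
    moreover have bE: "b * ES = 1 - q" using b by (simp add: ES_def)
    ultimately have "- a * AI u + b * (AS u * exp (b * u)) = (1 - q) + q * (a * (FS * - AI u))"
      unfolding AS_exp[OF u] using bE by (simp add: algebra_simps)
    also have "\<dots> \<le> (1 - q) + q * 1" using AI_bounds(2)[OF u] q by (intro add_left_mono mult_left_mono) auto
    finally show ?thesis by simp
  qed
  ultimately show ?thesis using t
    by (smt (verit, best) mult_left_le)
qed

text \<open>On the middle interval the difference of the value and \<open>y\<close> is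
  nonincreasing, and it runs from \<open>\<delta>\<close> at \<open>x\<^sub>I\<close> down to
  \<open>- \<delta>\<close> at \<open>x\<^sub>S\<close>.\<close>

lemma game_value_bounds:
  assumes u: "u > 0" and gap: "xS \<delta> u - xI \<delta> u = u" and \<delta>: "\<delta> > 0"
  shows "y - \<delta> \<le> game_value \<delta> u y" "game_value \<delta> u y \<le> y + \<delta>"
proof -
  let ?f = "\<lambda>y. AI u * exp (- a * (y - xS \<delta> u)) + AS u * exp (b * (y - xI \<delta> u)) - y"
  have dec: "?f z \<le> ?f y" if "xI \<delta> u \<le> y" "y \<le> z" "z \<le> xS \<delta> u" for y z
  proof (rule DERIV_nonpos_imp_nonincreasing[OF that(2)])
    fix v assume v: "y \<le> v" "v \<le> z"
    have "(?f has_real_derivative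
        - a * AI u * exp (- a * (v - xS \<delta> u)) + b * AS u * exp (b * (v - xI \<delta> u)) - 1) (at v)"
      by (auto intro!: derivative_eq_intros)
    moreover have "- a * AI u * exp (- a * (v - xS \<delta> u)) + b * AS u * exp (b * (v - xI \<delta> u)) - 1 \<le> 0"
      using middle_deriv_le_1[OF u gap, of v] v that by linarith
    ultimately show "\<exists>d. (?f has_real_derivative d) (at v) \<and> d \<le> 0" by blast
  qed
  have "- a * (xI \<delta> u - xS \<delta> u) = a * u" "b * (xS \<delta> u - xI \<delta> u) = b * u"
    unfolding gap using gap by (auto simp: algebra_simps)
  then have "?f (xI \<delta> u) = AI u * exp (a * u) + AS u - xI \<delta> u" "?f (xS \<delta> u) = AI u + AS u * exp (b * u) - xS \<delta> u"
    by (simp_all only:) simp_all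
  then have "?f (xI \<delta> u) = \<delta>" "?f (xS \<delta> u) = - \<delta>"
    unfolding AI_exp[OF u] AS_exp[OF u] by (simp_all add: xI_def xS_def FI_def FS_def GI_def GS_def algebra_simps)
  then have "- \<delta> \<le> ?f y" "?f y \<le> \<delta>" if "xI \<delta> u \<le> y" "y \<le> xS \<delta> u"
    using dec[of "xI \<delta> u" y] dec[of y "xS \<delta> u"] that by auto
  then show "y - \<delta> \<le> game_value \<delta> u y" "game_value \<delta> u y \<le> y + \<delta>"
    using \<delta> unfolding game_value_def by force+
qed

end

section \<open>Reflection of the process\<close>

lemma hit_below_eq: "hit_below X x c = hit_above (\<lambda>t \<omega>. - X t \<omega>) (- x) (- c)"
proof -
  have "(- c \<le> - x + - z) = (x + z \<le> c)" for z :: real by linarith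
  then show ?thesis by (simp add: hit_below_def hit_above_def fun_eq_iff)
qed

lemma levy_process_uminus:
  assumes "levy_process M F X"
  shows "levy_process M F (\<lambda>t \<omega>. - X t \<omega>)"
proof -
  have fu: "filtered_usual M F" and X0: "\<forall>\<omega>\<in>space M. X 0 \<omega> = 0" and Xm: "\<forall>t\<ge>0. X t \<in> borel_measurable (F t)"
    using assms unfolding levy_process_def by (elim conjE; simp)+
  have path: "\<forall>\<omega>\<in>space M. \<forall>t\<ge>0. continuous (at_right t) (\<lambda>s. X s \<omega>)
            \<and> (t > 0 \<longrightarrow> (\<exists>l. ((\<lambda>s. X s \<omega>) \<longlongrightarrow> l) (at_left t)))"
    using assms unfolding levy_process_def by (elim conjE)
  have inc: "\<forall>s\<ge>0. \<forall>t\<ge>0.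
          prob_space.indep_set M (sets (F t))
            {(\<lambda>\<omega>. X (t + s) \<omega> - X t \<omega>) -` B \<inter> space M | B. B \<in> sets borel}
        \<and> distr M borel (\<lambda>\<omega>. X (t + s) \<omega> - X t \<omega>) = distr M borel (X s)"
    using assms unfolding levy_process_def by (elim conjE)
  interpret prob_space M using fu by (simp add: filtered_usual_def)
  have sub: "\<forall>t\<ge>0. space (F t) = space M \<and> sets (F t) \<subseteq> sets M"
    using fu unfolding filtered_usual_def by (elim conjE)
  have XM[measurable]: "X t \<in> borel_measurable M" if t: "t \<ge> 0" for t
  proof (rule measurableI)
    fix B :: "real set" assume "B \<in> sets borel"
    then have "X t -` B \<inter> space (F t) \<in> sets (F t)" using Xm t by (intro measurable_sets) auto
    then show "X t -` B \<inter> space M \<in> sets M" using sub t by auto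
  qed simp
  show ?thesis
    unfolding levy_process_def
  proof (intro conjI ballI allI impI fu)
    fix s t :: real assume st: "0 \<le> s" "0 \<le> t"
    have "{(\<lambda>\<omega>. - X (t + s) \<omega> - - X t \<omega>) -` B \<inter> space M | B. B \<in> sets borel}
        \<subseteq> {(\<lambda>\<omega>. X (t + s) \<omega> - X t \<omega>) -` B \<inter> space M | B. B \<in> sets borel}"
    proof safe
      fix B :: "real set" assume B: "B \<in> sets borel"
      have "uminus -` B \<inter> space borel \<in> sets (borel :: real measure)"
        by (rule measurable_sets[OF _ B]) simp
      moreover have "(\<lambda>\<omega>. - X (t + s) \<omega> - - X t \<omega>) -` B \<inter> space M
          = (\<lambda>\<omega>. X (t + s) \<omega> - X t \<omega>) -` (uminus -` B) \<inter> space M" by auto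
      ultimately show "\<exists>B'. (\<lambda>\<omega>. - X (t + s) \<omega> - - X t \<omega>) -` B \<inter> space M
          = (\<lambda>\<omega>. X (t + s) \<omega> - X t \<omega>) -` B' \<inter> space M \<and> B' \<in> sets borel" by auto
    qed
    moreover have "indep_set (sets (F t)) {(\<lambda>\<omega>. X (t + s) \<omega> - X t \<omega>) -` B \<inter> space M | B. B \<in> sets borel}"
      using inc st by blast
    ultimately show "indep_set (sets (F t)) {(\<lambda>\<omega>. - X (t + s) \<omega> - - X t \<omega>) -` B \<inter> space M | B. B \<in> sets borel}"
      unfolding indep_sets2_eq by (meson order_trans subsetD)
    have "distr M borel (\<lambda>\<omega>. - X (t + s) \<omega> - - X t \<omega>)
        = distr (distr M borel (\<lambda>\<omega>. X (t + s) \<omega> - X t \<omega>)) borel uminus"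
      using st by (subst distr_distr) (auto simp: o_def intro!: distr_cong)
    also have "\<dots> = distr (distr M borel (X s)) borel uminus" using inc st by simp
    also have "\<dots> = distr M borel (\<lambda>\<omega>. - X s \<omega>)" using st by (subst distr_distr) (auto simp: o_def)
    finally show "distr M borel (\<lambda>\<omega>. - X (t + s) \<omega> - - X t \<omega>) = distr M borel (\<lambda>\<omega>. - X s \<omega>)" .
  next
    fix \<omega> and t :: real assume "\<omega> \<in> space M" "0 \<le> t" "0 < t"
    then obtain l where "((\<lambda>s. X s \<omega>) \<longlongrightarrow> l) (at_left t)" using path by blast
    then show "\<exists>l. ((\<lambda>s. - X s \<omega>) \<longlongrightarrow> l) (at_left t)" by (auto intro!: exI[of _ "- l"] tendsto_minus)
  qed (use X0 Xm path in \<open>auto intro: continuous_minus\<close>)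
qed

section \<open>The game\<close>

text \<open>A single \<open>C\<close> for all pairs of stopping times is what makes the real-valued
  \<open>INF\<close> and \<open>SUP\<close> meaningful. The choice between the payoffs is an
  arbitrary event \<open>P\<close>, so that both ways of resolving ties are covered.\<close>

lemma dynkin_payoff_bound:
  assumes L: "exp_killed_levy M F X er r q b"
    and cond: "dynkin_conditions M X r G1" "dynkin_conditions M X r G2"
    and G: "continuous_on UNIV G1" "continuous_on UNIV G2"
  obtains C where "\<And>\<sigma> \<tau> P. stopping_time_ext F \<sigma> \<Longrightarrow> stopping_time_ext F \<tau> \<Longrightarrow> {\<omega>\<in>space M. P \<omega>} \<in> sets M \<Longrightarrow>
    integrable M (\<lambda>\<omega>. if P \<omega> then disc_payoff r G1 X x \<tau> \<omega> else disc_payoff r G2 X x \<sigma> \<omega>) \<and>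
    \<bar>\<integral>\<omega>. (if P \<omega> then disc_payoff r G1 X x \<tau> \<omega> else disc_payoff r G2 X x \<sigma> \<omega>) \<partial>M\<bar> \<le> C"
proof -
  interpret exp_killed_levy M F X er r q b by fact
  define S where "S G = (\<integral>\<^sup>+\<omega>. (SUP t\<in>{0..}. ennreal \<bar>exp (- r * t) * G (x + X t \<omega>)\<bar>) \<partial>M)" for G :: "real \<Rightarrow> real"
  have fin: "S G1 < \<infinity>" "S G2 < \<infinity>" using cond by (auto simp: S_def dynkin_conditions_def)
  have le: "(\<integral>\<^sup>+\<omega>. ennreal \<bar>disc_payoff r G X x \<rho> \<omega>\<bar> \<partial>M) \<le> S G" if "stopping_time_ext F \<rho>" for G \<rho>
    unfolding S_def
  proof (rule nn_integral_mono)
    fix \<omega> assume \<omega>: "\<omega> \<in> space M"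
    show "ennreal \<bar>disc_payoff r G X x \<rho> \<omega>\<bar> \<le> (SUP t\<in>{0..}. ennreal \<bar>exp (- r * t) * G (x + X t \<omega>)\<bar>)"
    proof (cases "\<rho> \<omega> = \<infinity>")
      case False
      have "real_of_ereal (\<rho> \<omega>) \<ge> 0" using stopping_time_nonneg[OF that \<omega>] by (simp add: real_of_ereal_pos)
      then show ?thesis using False unfolding disc_payoff_def by (intro SUP_upper2[of "real_of_ereal (\<rho> \<omega>)"]) auto
    qed (simp add: disc_payoff_def)
  qed
  show thesis
  proof (rule that[of "enn2real (S G1 + S G2)"])
    fix \<sigma> \<tau> P assume st: "stopping_time_ext F \<sigma>" "stopping_time_ext F \<tau>" and P[measurable]: "{\<omega>\<in>space M. P \<omega>} \<in> sets M"
    let ?d1 = "disc_payoff r G1 X x \<tau>" and ?d2 = "disc_payoff r G2 X x \<sigma>"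
    let ?f = "\<lambda>\<omega>. if P \<omega> then ?d1 \<omega> else ?d2 \<omega>"
    have [measurable]: "?d1 \<in> borel_measurable M" "?d2 \<in> borel_measurable M"
      using disc_payoff_measurable[OF G(1) st(2)] disc_payoff_measurable[OF G(2) st(1)] by auto
    have meas: "?f \<in> borel_measurable M" using P by (intro measurable_If) auto
    have "(\<integral>\<^sup>+\<omega>. ennreal (norm (?f \<omega>)) \<partial>M) \<le> (\<integral>\<^sup>+\<omega>. ennreal \<bar>?d1 \<omega>\<bar> + ennreal \<bar>?d2 \<omega>\<bar> \<partial>M)"
      by (intro nn_integral_mono) auto
    also have "\<dots> = (\<integral>\<^sup>+\<omega>. ennreal \<bar>?d1 \<omega>\<bar> \<partial>M) + (\<integral>\<^sup>+\<omega>. ennreal \<bar>?d2 \<omega>\<bar> \<partial>M)"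
      by (intro nn_integral_add) auto
    also have "\<dots> \<le> S G1 + S G2" using le st by (intro add_mono) auto
    finally have bound: "(\<integral>\<^sup>+\<omega>. ennreal (norm (?f \<omega>)) \<partial>M) \<le> S G1 + S G2" .
    have fin': "S G1 + S G2 < \<infinity>" using fin by simp
    have int: "integrable M ?f"
      unfolding integrable_iff_bounded using meas le_less_trans[OF bound fin'] by simp
    have "\<bar>\<integral>\<omega>. ?f \<omega> \<partial>M\<bar> \<le> (\<integral>\<omega>. norm (?f \<omega>) \<partial>M)"
      using integral_norm_bound[of M ?f] by simp
    also have "\<dots> = enn2real (\<integral>\<^sup>+\<omega>. ennreal (norm (?f \<omega>)) \<partial>M)"
      using meas by (intro integral_eq_nn_integral) auto
    also have "\<dots> \<le> enn2real (S G1 + S G2)" using bound fin' by (intro enn2real_mono) auto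
    finally show "integrable M ?f \<and> \<bar>\<integral>\<omega>. ?f \<omega> \<partial>M\<bar> \<le> enn2real (S G1 + S G2)" using int by simp
  qed
qed

text \<open>Ties are paid \<open>G2\<close> here, against the convention of the game, so that the bound can also be applied to
  \<open>-X\<close>, where the roles of the players are exchanged.\<close>

lemma dynkin_upper_bound:
  fixes X :: "real \<Rightarrow> 'a \<Rightarrow> real"
  assumes LS: "exp_killed_levy M F X er r q b"
    and LI: "exp_killed_levy M F (\<lambda>t \<omega>. - X t \<omega>) er r p a"
    and kS: "kS \<ge> 0" "a * kS \<le> 1" and kI: "kI \<ge> 0" "b * kI \<le> 1"
    and V: "\<And>y. V y = hinge_mean a b q kS cS y - hinge_mean b a p kI (- cI) (- y)"
    and V_ge: "\<And>y. cI < y \<Longrightarrow> G1 y \<le> V y" and V_eq: "\<And>y. y \<le> cI \<Longrightarrow> G2 y = V y"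
    and \<tau>: "stopping_time_ext F \<tau>"
    and int: "integrable M (\<lambda>\<omega>. if \<tau> \<omega> < hit_below X x cI \<omega> then disc_payoff r G1 X x \<tau> \<omega>
      else disc_payoff r G2 X x (hit_below X x cI) \<omega>)"
  shows "(\<integral>\<omega>. (if \<tau> \<omega> < hit_below X x cI \<omega> then disc_payoff r G1 X x \<tau> \<omega>
      else disc_payoff r G2 X x (hit_below X x cI) \<omega>) \<partial>M) \<le> V x"
proof -
  interpret S: exp_killed_levy M F X er r q b by fact
  interpret I: exp_killed_levy M F "\<lambda>t \<omega>. - X t \<omega>" er r p a by fact
  let ?\<sigma> = "hit_below X x cI"
  define \<rho> where "\<rho> \<omega> = min (\<tau> \<omega>) (?\<sigma> \<omega>)" for \<omega>
  have \<sigma>: "stopping_time_ext F ?\<sigma>" unfolding hit_below_eq by (rule I.hit_above_stopping_time)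
  have \<rho>: "stopping_time_ext F \<rho>" unfolding \<rho>_def[abs_def] by (rule S.stopping_time_min[OF \<tau> \<sigma>])
  define H where "H = hinge_mean a b q kS cS"
  define J where "J y = hinge_mean b a p kI (- cI) (- y)" for y
  have H0: "H y \<ge> 0" for y
    using hinge_nonneg[OF I.b kS] hinge_mean_ge_hinge[OF I.b S.b kS S.q(2)] unfolding H_def by (rule order_trans)
  have J0: "J y \<ge> 0" for y
    using hinge_nonneg[OF S.b kI] hinge_mean_ge_hinge[OF S.b I.b kI I.q(2)] unfolding J_def by (rule order_trans)
  have dH: "S.disc_value (S.sup_value (hinge a kS cS)) x \<rho> \<omega> = ennreal (disc_payoff r H X x \<rho> \<omega>)" for \<omega>
    unfolding S.disc_value_def disc_payoff_def S.sup_value_hinge[OF I.b kS] H_def[symmetric]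
    using H0 by (simp add: ennreal_mult)
  have dJ: "I.disc_value (I.sup_value (hinge b kI (- cI))) (- x) \<rho> \<omega> = ennreal (disc_payoff r J X x \<rho> \<omega>)" for \<omega>
    unfolding I.disc_value_def disc_payoff_def I.sup_value_hinge[OF S.b kI]
    using J0 by (simp add: ennreal_mult' J_def add.commute)
  have H_nonneg: "disc_payoff r H X x \<rho> \<omega> \<ge> 0" and J_nonneg: "disc_payoff r J X x \<rho> \<omega> \<ge> 0" for \<omega>
    using H0 J0 by (auto simp: disc_payoff_def)
  have "(\<integral>\<^sup>+\<omega>. ennreal (disc_payoff r H X x \<rho> \<omega>) \<partial>M) \<le> ennreal (H x)"
    using S.optional_sampling(1)[OF hinge_mono[OF I.b kS] hinge_continuous hinge_nonneg[OF I.b kS] \<rho>, of cS x]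
    unfolding dH S.sup_value_hinge[OF I.b kS] H_def .
  moreover have "disc_payoff r H X x \<rho> \<in> borel_measurable M"
  proof -
    have "(\<lambda>\<omega>. ennreal (disc_payoff r H X x \<rho> \<omega>)) \<in> borel_measurable M"
      using S.optional_sampling(3)[OF hinge_mono[OF I.b kS] hinge_continuous hinge_nonneg[OF I.b kS] \<rho>, of cS x]
      unfolding dH[abs_def] .
    then have "(\<lambda>\<omega>. enn2real (ennreal (disc_payoff r H X x \<rho> \<omega>))) \<in> borel_measurable M" by measurable
    then show ?thesis using H_nonneg by simp
  qed
  ultimately have H_int: "integrable M (disc_payoff r H X x \<rho>)" "(\<integral>\<omega>. disc_payoff r H X x \<rho> \<omega> \<partial>M) \<le> H x"
    using H_nonneg H0[of x] by (auto intro!: integrableI_nonneg simp: integral_eq_nn_integral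
        intro: le_less_trans enn2real_leI)
  \<comment> \<open>Since \<open>J\<close> enters \<open>V\<close> with a minus sign, an upper bound
    would point the wrong way. Equality holds because before \<open>\<rho>\<close> the path stays
    above \<open>cI\<close>, where the hinge of \<open>J\<close> vanishes.\<close>
  have "(\<integral>\<^sup>+\<omega>. ennreal (disc_payoff r J X x \<rho> \<omega>) \<partial>M) = ennreal (J x)"
    unfolding dJ[symmetric]
  proof (subst I.optional_sampling(2)[OF hinge_mono[OF S.b kI] hinge_continuous hinge_nonneg[OF S.b kI] \<rho>])
    fix \<omega> t assume \<omega>: "\<omega> \<in> space M" "0 \<le> t" "ereal t < \<rho> \<omega>"
    then have "\<not> ?\<sigma> \<omega> \<le> ereal t" by (auto simp: \<rho>_def)
    then show "hinge b kI (- cI) (- x + - X t \<omega>) = 0"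
      unfolding hit_below_eq I.hit_above_le_iff[OF \<omega>(1)] using \<omega> by (intro hinge_eq_0) auto
  qed (simp add: I.sup_value_hinge[OF S.b kI] J_def)
  moreover have "disc_payoff r J X x \<rho> \<in> borel_measurable M"
  proof -
    have "(\<lambda>\<omega>. ennreal (disc_payoff r J X x \<rho> \<omega>)) \<in> borel_measurable M"
      using I.optional_sampling(3)[OF hinge_mono[OF S.b kI] hinge_continuous hinge_nonneg[OF S.b kI] \<rho>, of "- cI" "- x"]
      unfolding dJ[abs_def] .
    then have "(\<lambda>\<omega>. enn2real (ennreal (disc_payoff r J X x \<rho> \<omega>))) \<in> borel_measurable M" by measurable
    then show ?thesis using J_nonneg by simp
  qed
  ultimately have J_int: "integrable M (disc_payoff r J X x \<rho>)" "(\<integral>\<omega>. disc_payoff r J X x \<rho> \<omega> \<partial>M) = J x"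
    using J_nonneg J0[of x] by (auto intro!: integrableI_nonneg simp: integral_eq_nn_integral)
  have V': "V = (\<lambda>y. H y - J y)" using V by (auto simp: H_def J_def)
  have disc: "disc_payoff r V X x \<rho> \<omega> = disc_payoff r H X x \<rho> \<omega> - disc_payoff r J X x \<rho> \<omega>" for \<omega>
    by (simp add: V' disc_payoff_def right_diff_distrib)
  let ?pay = "\<lambda>\<omega>. if \<tau> \<omega> < ?\<sigma> \<omega> then disc_payoff r G1 X x \<tau> \<omega> else disc_payoff r G2 X x ?\<sigma> \<omega>"
  have "(\<integral>\<omega>. ?pay \<omega> \<partial>M) \<le> (\<integral>\<omega>. disc_payoff r H X x \<rho> \<omega> - disc_payoff r J X x \<rho> \<omega> \<partial>M)"
  proof (rule integral_mono[OF int])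
    fix \<omega> assume \<omega>: "\<omega> \<in> space M"
    have "?pay \<omega> \<le> disc_payoff r V X x \<rho> \<omega>"
    proof (cases "\<tau> \<omega> < ?\<sigma> \<omega>")
      case True
      then obtain t where t: "\<tau> \<omega> = ereal t" "t \<ge> 0"
        using S.stopping_time_nonneg[OF \<tau> \<omega>] by (cases "\<tau> \<omega>") auto
      have "\<not> ?\<sigma> \<omega> \<le> ereal t" using True t by simp
      then have "cI < x + X t \<omega>"
        unfolding hit_below_eq I.hit_above_le_iff[OF \<omega>] using t by force
      moreover have "\<rho> \<omega> = ereal t" using True t by (simp add: \<rho>_def min_absorb1 less_imp_le)
      ultimately show ?thesis using True t V_ge by (simp add: disc_payoff_def)
    next
      case False
      then have \<rho>\<sigma>: "\<rho> \<omega> = ?\<sigma> \<omega>" by (simp add: \<rho>_def min_def)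
      show ?thesis
      \<comment> \<open>At a finite \<open>?\<sigma>\<close> the infimum is attained, so the path is
        at or below \<open>cI\<close>, possibly after a jump across it; \<open>G2\<close> and
        \<open>V\<close> agree on that whole half-line.\<close>
      proof (cases "?\<sigma> \<omega>")
        case (real t)
        then obtain s where s: "0 \<le> s" "s \<le> t" "- cI \<le> - x + - X s \<omega>"
          using I.hit_above_le_iff[OF \<omega>, of "- x" "- cI" t] unfolding hit_below_eq by auto
        then have "?\<sigma> \<omega> \<le> ereal s" unfolding hit_below_eq I.hit_above_le_iff[OF \<omega>] by blast
        then have "s = t" using real s by simp
        then have "x + X t \<omega> \<le> cI" using s by simp
        then show ?thesis using False real \<rho>\<sigma> V_eq by (simp add: disc_payoff_def)
      next
        case PInf
        then show ?thesis using False \<rho>\<sigma> by (simp add: disc_payoff_def)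
      next
        case MInf
        then show ?thesis using S.stopping_time_nonneg[OF \<sigma> \<omega>] by simp
      qed
    qed
    then show "?pay \<omega> \<le> disc_payoff r H X x \<rho> \<omega> - disc_payoff r J X x \<rho> \<omega>" unfolding disc .
  qed (use H_int J_int in simp)
  also have "\<dots> = (\<integral>\<omega>. disc_payoff r H X x \<rho> \<omega> \<partial>M) - (\<integral>\<omega>. disc_payoff r J X x \<rho> \<omega> \<partial>M)"
    by (rule Bochner_Integration.integral_diff[OF H_int(1) J_int(1)])
  also have "\<dots> \<le> V x" using H_int(2) J_int(2) by (simp add: V')
  finally show ?thesis .
qed

lemma exp_killed_levy_uminus:
  assumes levy: "levy_process M F X" and r: "r > 0"
    and er_exp: "distributed M lborel er (exponential_density r)"
    and er_indep: "prob_space.indep_set M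
        {er -` B \<inter> space M | B. B \<in> sets borel}
        (sigma_sets (space M) {X t -` B \<inter> space M | t B. 0 \<le> t \<and> B \<in> sets borel})"
    and a: "a > 0" and p: "0 \<le> p" "p < 1"
    and law_I: "\<forall>y\<ge>0. measure M {\<omega>\<in>space M. - Inf ((\<lambda>t. X t \<omega>) ` {0..er \<omega>}) > y} = (1 - p) * exp (- a * y)"
  shows "exp_killed_levy M F (\<lambda>t \<omega>. - X t \<omega>) er r p a"
proof unfold_locales
  interpret prob_space M using levy by (simp add: levy_process_def filtered_usual_def)
  have "sigma_sets (space M) {(\<lambda>\<omega>. - X t \<omega>) -` B \<inter> space M | t B. 0 \<le> t \<and> B \<in> sets borel}
      \<subseteq> sigma_sets (space M) {X t -` B \<inter> space M | t B. 0 \<le> t \<and> B \<in> sets borel}"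
  proof (rule sigma_sets_subseteq, safe)
    fix t :: real and B :: "real set" assume t: "0 \<le> t" and B: "B \<in> sets borel"
    have "uminus -` B \<inter> space borel \<in> sets (borel :: real measure)"
      by (rule measurable_sets[OF _ B]) simp
    moreover have "(\<lambda>\<omega>. - X t \<omega>) -` B \<inter> space M = X t -` (uminus -` B) \<inter> space M" by auto
    ultimately show "\<exists>t' B'. (\<lambda>\<omega>. - X t \<omega>) -` B \<inter> space M = X t' -` B' \<inter> space M \<and> 0 \<le> t' \<and> B' \<in> sets borel"
      using t by auto
  qed
  then show "indep_set {er -` B \<inter> space M | B. B \<in> sets borel}
      (sigma_sets (space M) {(\<lambda>\<omega>. - X t \<omega>) -` B \<inter> space M | t B. 0 \<le> t \<and> B \<in> sets borel})"
    using er_indep unfolding indep_sets2_eq by (meson order_trans subsetD)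
  \<comment> \<open>On the reals \<open>Inf\<close> is defined by reflecting \<open>Sup\<close>, so
    this holds also for the empty set that arises when \<open>er \<omega>\<close> is
    negative.\<close>
  have "Sup ((\<lambda>t. - X t \<omega>) ` {0..er \<omega>}) = - Inf ((\<lambda>t. X t \<omega>) ` {0..er \<omega>})" for \<omega>
    by (simp add: Inf_real_def image_image)
  then show "\<forall>y\<ge>0. prob {\<omega>\<in>space M. y < Sup ((\<lambda>t. - X t \<omega>) ` {0..er \<omega>})} = (1 - p) * exp (- a * y)"
    using law_I by simp
qed (use levy_process_uminus[OF levy] r er_exp a p in auto)

theorem theorem2:
  fixes M :: "'a measure" and F :: "real \<Rightarrow> 'a measure" and X :: "real \<Rightarrow> 'a \<Rightarrow> real"
    and er :: "'a \<Rightarrow> real"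
    and r \<delta> \<pi>I \<pi>S rI rS :: real
  assumes levy: "levy_process M F X"
    and r_pos: "r > 0" and delta_pos: "\<delta> > 0"
    and cond1: "dynkin_conditions M X r (\<lambda>y. y - \<delta>)"
    and cond2: "dynkin_conditions M X r (\<lambda>y. y + \<delta>)"
    and rI_pos: "rI > 0" and rS_pos: "rS > 0"
    and root_S: "\<forall>t\<ge>0. integrable M (\<lambda>\<omega>. exp (rS * X t \<omega>))
                     \<and> (\<integral>\<omega>. exp (rS * X t \<omega>) \<partial>M) = exp (t * r)"
    and root_I: "\<forall>t\<ge>0. integrable M (\<lambda>\<omega>. exp ((- rI) * X t \<omega>))
                     \<and> (\<integral>\<omega>. exp ((- rI) * X t \<omega>) \<partial>M) = exp (t * r)"
    and er_exp: "distributed M lborel er (exponential_density r)"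
    and er_indep: "prob_space.indep_set M
        {er -` B \<inter> space M | B. B \<in> sets borel}
        (sigma_sets (space M) {X t -` B \<inter> space M | t B. 0 \<le> t \<and> B \<in> sets borel})"
    and piI: "0 \<le> \<pi>I" "\<pi>I < 1" and piS: "0 \<le> \<pi>S" "\<pi>S < 1"
    and law_I: "\<forall>y\<ge>0. measure M {\<omega>\<in>space M. - Inf ((\<lambda>t. X t \<omega>) ` {0..er \<omega>}) > y}
                       = (1 - \<pi>I) * exp (- rI * y)"
    and law_S: "\<forall>y\<ge>0. measure M {\<omega>\<in>space M. Sup ((\<lambda>t. X t \<omega>) ` {0..er \<omega>}) > y}
                       = (1 - \<pi>S) * exp (- rS * y)"
  defines "EI \<equiv> (1 - \<pi>I) / rI" and "ES \<equiv> (1 - \<pi>S) / rS"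
    and "FI \<equiv> (rI + rS) / (rI + \<pi>I * rS)" and "FS \<equiv> (rI + rS) / (\<pi>S * rI + rS)"
    and "GI \<equiv> (rI + rS) / (rI + \<pi>I * rS) - 1" and "GS \<equiv> (rI + rS) / (\<pi>S * rI + rS) - 1"
  shows "(\<exists>!u. u > 0 \<and>
            u - 2 * \<delta> - EI - ES
              = (- EI * FS * exp (rS * u) - ES * FI * exp (rI * u) + 2 * ES * FS * GI)
                / (exp ((rI + rS) * u) - GI * GS))
       \<and> (\<forall>u. u > 0 \<and>
            u - 2 * \<delta> - EI - ES
              = (- EI * FS * exp (rS * u) - ES * FI * exp (rI * u) + 2 * ES * FS * GI)
                / (exp ((rI + rS) * u) - GI * GS)
          \<longrightarrow>
          (let AI = (- EI * exp (rS * u) + ES * GI) / (exp ((rI + rS) * u) - GI * GS);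
               AS = (ES * exp (rI * u) - EI * GS) / (exp ((rI + rS) * u) - GI * GS);
               xI = - \<delta> - EI + FI * AS;
               xS = \<delta> + ES + FS * AI;
               V = (\<lambda>x. if x \<le> xI then x + \<delta>
                        else if x < xS then AI * exp (- rI * (x - xS)) + AS * exp (rS * (x - xI))
                        else x - \<delta>);
               ST = {\<tau>. stopping_time_ext F \<tau>};
               Mx = dynkin_M M X r (\<lambda>y. y - \<delta>) (\<lambda>y. y + \<delta>)
           in xS - xI = u
              \<and> (\<forall>x. hit_below X x xI \<in> ST \<and> hit_above X x xS \<in> ST
                  \<and> V x = (INF \<sigma>\<in>ST. SUP \<tau>\<in>ST. Mx x \<sigma> \<tau>)
                  \<and> V x = (SUP \<tau>\<in>ST. INF \<sigma>\<in>ST. Mx x \<sigma> \<tau>)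
                  \<and> V x = Mx x (hit_below X x xI) (hit_above X x xS))))"
proof -
  interpret gap: gap_equation rI rS \<pi>I \<pi>S
    using rI_pos rS_pos piI piS by unfold_locales
  have LS: "exp_killed_levy M F X er r \<pi>S rS"
    using levy r_pos er_exp er_indep rS_pos piS law_S by unfold_locales
  have LI: "exp_killed_levy M F (\<lambda>t \<omega>. - X t \<omega>) er r \<pi>I rI"
    by (rule exp_killed_levy_uminus[OF levy r_pos er_exp er_indep rI_pos piI law_I])
  interpret S: exp_killed_levy M F X er r \<pi>S rS by (rule LS)
  interpret I: exp_killed_levy M F "\<lambda>t \<omega>. - X t \<omega>" er r \<pi>I rI by (rule LI)
  have const_eqs: "EI = gap.EI" "ES = gap.ES" "FI = gap.FI" "FS = gap.FS" "GI = gap.GI" "GS = gap.GS"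
    by (simp_all only: EI_def ES_def FI_def FS_def GI_def GS_def
        gap.EI_def gap.ES_def gap.FI_def gap.FS_def gap.GI_def gap.GS_def)
  let ?eq = "\<lambda>u. u - 2 * \<delta> - EI - ES
              = (- EI * FS * exp (rS * u) - ES * FI * exp (rI * u) + 2 * ES * FS * GI)
                / (exp ((rI + rS) * u) - GI * GS)"
  have eq_iff: "?eq u \<longleftrightarrow> u + gap.gS u + gap.gI u = 2 * \<delta> + (1 - \<pi>I) / rI + (1 - \<pi>S) / rS" for u
    unfolding const_eqs gap.gap_equation_rhs by (auto simp: gap.EI_def gap.ES_def)
  let ?ST = "{\<tau>. stopping_time_ext F \<tau>}"
  let ?G1 = "\<lambda>y. y - \<delta>" and ?G2 = "\<lambda>y. y + \<delta>"
  let ?Mx = "dynkin_M M X r ?G1 ?G2"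
  have main: "gap.xS \<delta> u - gap.xI \<delta> u = u
     \<and> (\<forall>x. hit_below X x (gap.xI \<delta> u) \<in> ?ST \<and> hit_above X x (gap.xS \<delta> u) \<in> ?ST
          \<and> gap.game_value \<delta> u x = (INF \<sigma>\<in>?ST. SUP \<tau>\<in>?ST. ?Mx x \<sigma> \<tau>)
          \<and> gap.game_value \<delta> u x = (SUP \<tau>\<in>?ST. INF \<sigma>\<in>?ST. ?Mx x \<sigma> \<tau>)
          \<and> gap.game_value \<delta> u x = ?Mx x (hit_below X x (gap.xI \<delta> u)) (hit_above X x (gap.xS \<delta> u)))"
    if u: "u > 0" and eq: "?eq u" for u
  proof (intro conjI allI)
    define cI cS where "cI = gap.xI \<delta> u" and "cS = gap.xS \<delta> u"
    define V where "V = gap.game_value \<delta> u"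
    show gap_u: "gap.xS \<delta> u - gap.xI \<delta> u = u"
      using eq unfolding eq_iff gap.xS_def gap.xI_def gap.FI_AS gap.FS_AI by (simp add: gap.EI_def gap.ES_def)
    have cIS: "cI < cS" using gap_u u by (simp add: cI_def cS_def)
    let ?kS = "gap.FS * - gap.AI u" and ?kI = "gap.FI * gap.AS u"
    have kS: "?kS \<ge> 0" "rI * ?kS \<le> 1"
      using gap.gI_pos[OF u] gap.FS_AI[of u] gap.AI_bounds(2)[OF u] by simp_all
    have kI: "?kI \<ge> 0" "rS * ?kI \<le> 1"
      using gap.gS_pos[OF u] gap.FI_AS[of u] gap.AS_bounds(2)[OF u] by simp_all
    have V: "V y = hinge_mean rI rS \<pi>S ?kS cS y - hinge_mean rS rI \<pi>I ?kI (- cI) (- y)" for y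
      unfolding V_def cS_def cI_def by (rule gap.game_value_eq[OF u gap_u])
    have V_bounds: "y - \<delta> \<le> V y" "V y \<le> y + \<delta>" for y
      using gap.game_value_bounds[OF u gap_u delta_pos] by (auto simp: V_def)
    have V_low: "V y = y + \<delta>" if "y \<le> cI" for y
      using that by (simp add: V_def gap.game_value_def cI_def)
    have V_high: "V y = y - \<delta>" if "cS \<le> y" for y
      using that cIS by (simp add: V_def gap.game_value_def cI_def cS_def)
    fix x
    let ?\<sigma> = "hit_below X x cI" and ?\<tau> = "hit_above X x cS"
    have \<sigma>: "stopping_time_ext F ?\<sigma>" unfolding hit_below_eq by (rule I.hit_above_stopping_time)
    have \<tau>: "stopping_time_ext F ?\<tau>" by (rule S.hit_above_stopping_time)
    then show "hit_below X x (gap.xI \<delta> u) \<in> ?ST" "hit_above X x (gap.xS \<delta> u) \<in> ?ST"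
      using \<sigma> by (simp_all add: cI_def cS_def)
    obtain C where C: "\<And>\<sigma> \<tau> P. stopping_time_ext F \<sigma> \<Longrightarrow> stopping_time_ext F \<tau> \<Longrightarrow> {\<omega>\<in>space M. P \<omega>} \<in> sets M \<Longrightarrow>
      integrable M (\<lambda>\<omega>. if P \<omega> then disc_payoff r ?G1 X x \<tau> \<omega> else disc_payoff r ?G2 X x \<sigma> \<omega>) \<and>
      \<bar>\<integral>\<omega>. (if P \<omega> then disc_payoff r ?G1 X x \<tau> \<omega> else disc_payoff r ?G2 X x \<sigma> \<omega>) \<partial>M\<bar> \<le> C"
      by (rule dynkin_payoff_bound[OF LS cond1 cond2, of x]) (auto intro!: continuous_intros)
    have le_sets: "{\<omega>\<in>space M. \<tau> \<omega> \<le> \<sigma> \<omega>} \<in> sets M" and less_sets: "{\<omega>\<in>space M. \<tau> \<omega> < \<sigma> \<omega>} \<in> sets M"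
      if "stopping_time_ext F \<sigma>" "stopping_time_ext F \<tau>" for \<sigma> \<tau>
      using S.stopping_time_measurable[OF that(1)] S.stopping_time_measurable[OF that(2)] by auto
    have upper: "?Mx x ?\<sigma> \<tau> \<le> V x" if \<tau>: "stopping_time_ext F \<tau>" for \<tau>
    proof -
      let ?pay = "\<lambda>\<omega>. if \<tau> \<omega> < ?\<sigma> \<omega> then disc_payoff r ?G1 X x \<tau> \<omega> else disc_payoff r ?G2 X x ?\<sigma> \<omega>"
      have int: "integrable M ?pay" using C[OF \<sigma> \<tau> less_sets[OF \<sigma> \<tau>]] by simp
      \<comment> \<open>Moving ties from \<open>?G1\<close> to \<open>?G2\<close> can only raise the
        payoff.\<close>
      have "?Mx x ?\<sigma> \<tau> \<le> (\<integral>\<omega>. ?pay \<omega> \<partial>M)"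
        unfolding dynkin_M_def
      proof (rule integral_mono)
        fix \<omega>
        have "disc_payoff r ?G1 X x \<rho> \<omega> \<le> disc_payoff r ?G2 X x \<rho> \<omega>" for \<rho>
          using delta_pos by (simp add: disc_payoff_def)
        moreover have "disc_payoff r ?G1 X x \<tau> \<omega> = disc_payoff r ?G1 X x ?\<sigma> \<omega>" if "\<tau> \<omega> = ?\<sigma> \<omega>"
          using that by (simp add: disc_payoff_def)
        ultimately show "(if \<tau> \<omega> \<le> ?\<sigma> \<omega> then disc_payoff r ?G1 X x \<tau> \<omega> else disc_payoff r ?G2 X x ?\<sigma> \<omega>) \<le> ?pay \<omega>"
          by (auto simp: le_less)
      qed (use int C[OF \<sigma> \<tau> le_sets[OF \<sigma> \<tau>]] in auto)
      also have "\<dots> \<le> V x"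
        using V_bounds V_low by (intro dynkin_upper_bound[OF LS LI kS kI V _ _ \<tau> int]) auto
      finally show ?thesis .
    qed
    have lower: "V x \<le> ?Mx x \<sigma> ?\<tau>" if \<sigma>: "stopping_time_ext F \<sigma>" for \<sigma>
    proof -
      \<comment> \<open>Reflecting the process and its starting point negates and exchanges the two
        payoffs and exchanges the players. The tie rule of the game then becomes the one of
        \<open>dynkin_upper_bound\<close>, so the two integrals agree exactly up to sign.\<close>
      let ?X = "\<lambda>t \<omega>. - X t \<omega>"
      have LS': "exp_killed_levy M F (\<lambda>t \<omega>. - ?X t \<omega>) er r \<pi>S rS" using LS by simp
      have \<tau>_eq: "hit_below ?X (- x) (- cS) = ?\<tau>" by (simp add: hit_below_eq)
      have flip: "disc_payoff r ?G1 ?X (- x) \<rho> \<omega> = - disc_payoff r ?G2 X x \<rho> \<omega>"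
        "disc_payoff r ?G2 ?X (- x) \<rho> \<omega> = - disc_payoff r ?G1 X x \<rho> \<omega>" for \<rho> \<omega>
        by (simp_all add: disc_payoff_def algebra_simps)
      have pay: "(if \<sigma> \<omega> < hit_below ?X (- x) (- cS) \<omega> then disc_payoff r ?G1 ?X (- x) \<sigma> \<omega>
            else disc_payoff r ?G2 ?X (- x) (hit_below ?X (- x) (- cS)) \<omega>)
          = - (if ?\<tau> \<omega> \<le> \<sigma> \<omega> then disc_payoff r ?G1 X x ?\<tau> \<omega> else disc_payoff r ?G2 X x \<sigma> \<omega>)" for \<omega>
        unfolding \<tau>_eq flip by (auto simp: not_le[symmetric])
      have "(\<integral>\<omega>. (if \<sigma> \<omega> < hit_below ?X (- x) (- cS) \<omega> then disc_payoff r ?G1 ?X (- x) \<sigma> \<omega>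
            else disc_payoff r ?G2 ?X (- x) (hit_below ?X (- x) (- cS)) \<omega>) \<partial>M) \<le> - V (- (- x))"
      proof (rule dynkin_upper_bound[OF LI LS' kI kS, of "\<lambda>y. - V (- y)" "- cI" "- cS"])
        show "- V (- y) = hinge_mean rS rI \<pi>I ?kI (- cI) y - hinge_mean rI rS \<pi>S ?kS (- (- cS)) (- y)" for y
          unfolding V by simp
        show "y - \<delta> \<le> - V (- y)" for y using V_bounds(2)[of "- y"] by simp
        show "y + \<delta> = - V (- y)" if "y \<le> - cS" for y using V_high[of "- y"] that by simp
        show "integrable M (\<lambda>\<omega>. if \<sigma> \<omega> < hit_below ?X (- x) (- cS) \<omega> then disc_payoff r ?G1 ?X (- x) \<sigma> \<omega>
            else disc_payoff r ?G2 ?X (- x) (hit_below ?X (- x) (- cS)) \<omega>)"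
          unfolding pay using C[OF \<sigma> \<tau> le_sets[OF \<sigma> \<tau>]] by (intro integrable_minus) simp
      qed (rule \<sigma>)
      then show ?thesis unfolding pay dynkin_M_def by simp
    qed
    have bound: "\<bar>?Mx x \<sigma> \<tau>\<bar> \<le> C" if "\<sigma> \<in> ?ST" "\<tau> \<in> ?ST" for \<sigma> \<tau>
      using C[of \<sigma> \<tau> "\<lambda>\<omega>. \<tau> \<omega> \<le> \<sigma> \<omega>"] le_sets[of \<sigma> \<tau>] that by (simp add: dynkin_M_def)
    have "?\<sigma> \<in> ?ST" "?\<tau> \<in> ?ST" using \<sigma> \<tau> by auto
    note saddle = saddle_point_minimax[OF this, of "?Mx x" "V x", OF _ _ bound]
    show "gap.game_value \<delta> u x = (INF \<sigma>\<in>?ST. SUP \<tau>\<in>?ST. ?Mx x \<sigma> \<tau>)"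
      "gap.game_value \<delta> u x = (SUP \<tau>\<in>?ST. INF \<sigma>\<in>?ST. ?Mx x \<sigma> \<tau>)"
      "gap.game_value \<delta> u x = ?Mx x (hit_below X x (gap.xI \<delta> u)) (hit_above X x (gap.xS \<delta> u))"
      using saddle upper lower unfolding V_def cI_def cS_def by auto
  qed
  show ?thesis
  proof (intro conjI allI impI)
    show "\<exists>!u. u > 0 \<and> ?eq u"
      unfolding eq_iff by (rule gap.gap_unique_solution[OF delta_pos])
  next
    fix u assume "u > 0 \<and> ?eq u"
    then show "let AI = (- EI * exp (rS * u) + ES * GI) / (exp ((rI + rS) * u) - GI * GS);
               AS = (ES * exp (rI * u) - EI * GS) / (exp ((rI + rS) * u) - GI * GS);
               xI = - \<delta> - EI + FI * AS;
               xS = \<delta> + ES + FS * AI;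
               V = (\<lambda>x. if x \<le> xI then x + \<delta>
                        else if x < xS then AI * exp (- rI * (x - xS)) + AS * exp (rS * (x - xI))
                        else x - \<delta>);
               ST = {\<tau>. stopping_time_ext F \<tau>};
               Mx = dynkin_M M X r (\<lambda>y. y - \<delta>) (\<lambda>y. y + \<delta>)
           in xS - xI = u
              \<and> (\<forall>x. hit_below X x xI \<in> ST \<and> hit_above X x xS \<in> ST
                  \<and> V x = (INF \<sigma>\<in>ST. SUP \<tau>\<in>ST. Mx x \<sigma> \<tau>)
                  \<and> V x = (SUP \<tau>\<in>ST. INF \<sigma>\<in>ST. Mx x \<sigma> \<tau>)
                  \<and> V x = Mx x (hit_below X x xI) (hit_above X x xS))"
      using main[of u]
      unfolding Let_def const_eqs gap.game_value_def gap.xI_def gap.xS_def gap.AI_def gap.AS_def by blast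
  qed
qed

end
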